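(* Let $k$ be a commutative ring, $A$ a $k$-algebra, and $H$ a $k$-bialgebra that is finitely generated and projective as a $k$-module. Then $A$ is a (right) lax (resp. partial) $H$-comodule algebra if and only if $A^{\rm op}$ is a (left) lax (resp. partial) $H^{*{\rm cop}}$-module algebra.
   Context: All unadorned $\otimes$ and ${\rm Hom}$ are over $k$; algebras are associative with unit; $\delta(h)=h_{(1)}\otimes h_{(2)}$ and $\epsilon$ denote the comultiplication and counit of $H$. For a $k$-linear map $\rho:A\to A\otimes H$ write $\rho(a)=a_{[0]}\otimes a_{[1]}=a_{[0']}\otimes a_{[1']}$, $\rho^2(a)=(\rho\otimes H)(\rho(a))=a_{[0]}\otimes a_{[1]}\otimes a_{[2]}$, and $\rho(1_A)=1_{[0]}\otimes 1_{[1]}$. Right lax $H$-comodule algebra: a $k$-algebra $A$ with a $k$-linear map $\rho:A\to A\otimes H$ such that for all $a,b\in A$, (i) $\rho(ab)=\rho(a)\rho(b)$; (ii) $\rho^2(a)=a_{[0]}1_{[0]}\otimes a_{[1](1)}1_{[1]}\otimes a_{[1](2)}$; (iii) $\epsilon(a_{[1]})a_{[0]}=\epsilon(1_{[1]})1_{[0]}a$; (iv) $\rho(1_A)=\epsilon(1_{[1']})1_{[0']}1_{[0]}\otimes 1_{[1]}$. Right partial $H$-comodule algebra: a right lax one with moreover $\epsilon(1_{[1]})1_{[0]}=1_A$; equivalently (i), (ii) and $\epsilon(a_{[1]})a_{[0]}=a$ for all $a\in A$. For a $k$-bialgebra $K$ and a $k$-algebra $B$ with a $k$-linear map $K\otimes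 B\to B$, $x\otimes b\mapsto x\cdot b$: $B$ is a left lax $K$-module algebra if for all $a,b\in B$, $x,y\in K$: $x\cdot(ab)=(x_{(1)}\cdot a)(x_{(2)}\cdot b)$; $x\cdot(a(y\cdot b))=(x_{(1)}\cdot a)((x_{(2)}y)\cdot b)$; $a(1_K\cdot 1_B)=1_K\cdot a$; $a(x\cdot 1_B)=1_K\cdot (a(x\cdot 1_B))$. It is a left partial $K$-module algebra if it is a left lax one and $1_K\cdot 1_B=1_B$. $H^*={\rm Hom}(H,k)$ is the dual bialgebra, with convolution product $(h^**g^* )(h)=h^*(h_{(1)})g^*(h_{(2)})$, unit $\epsilon$, comultiplication determined by $h^*(hg)=h^*_{(1)}(h)h^*_{(2)}(g)$, and counit $h^*\mapsto h^*(1_H)$; $H^{*{\rm cop}}$ is $H^*$ with the opposite comultiplication $h^*\mapsto h^*_{(2)}\otimes h^*_{(1)}$. $A^{\rm op}$ is the opposite algebra of $A$. *)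

theory Defs
  imports "HOL-Algebra.Module" "HOL-Algebra.AbelCoset"
begin

section \<open>Modules over a commutative ring\<close>

text \<open>
  Everything is carrier-based, over a commutative ring \<open>R\<close> in the sense of \<^theory>\<open>HOL-Algebra.Module\<close>.
  For records that are only used as modules, the fields \<^term>\<open>mult\<close> and \<^term>\<open>one\<close> are irrelevant.
\<close>

definition lin_hom ::
  "('k, 'x) ring_scheme \<Rightarrow> ('k, 'm, 'y) module_scheme \<Rightarrow> ('k, 'n, 'z) module_scheme \<Rightarrow> ('m \<Rightarrow> 'n) set"
  where "lin_hom R M N =
    {f \<in> carrier M \<rightarrow> carrier N.
       (\<forall>x\<in>carrier M. \<forall>y\<in>carrier M. f (x \<oplus>\<^bsub>M\<^esub> y) = f x \<oplus>\<^bsub>N\<^esub> f y) \<and>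
       (\<forall>r\<in>carrier R. \<forall>x\<in>carrier M. f (r \<odot>\<^bsub>M\<^esub> x) = r \<odot>\<^bsub>N\<^esub> f x)}"

definition self_module :: "('k, 'x) ring_scheme \<Rightarrow> ('k, 'k) module"
  where "self_module R =
    \<lparr>carrier = carrier R, mult = mult R, one = \<one>\<^bsub>R\<^esub>, zero = \<zero>\<^bsub>R\<^esub>, add = add R, smult = mult R\<rparr>"

definition submodule_span ::
  "('k, 'x) ring_scheme \<Rightarrow> ('k, 'm, 'y) module_scheme \<Rightarrow> 'm set \<Rightarrow> 'm set"
  where "submodule_span R M S = \<Inter>{N. submodule N R M \<and> S \<subseteq> N}"

definition finitely_generated_module ::
  "('k, 'x) ring_scheme \<Rightarrow> ('k, 'm, 'y) module_scheme \<Rightarrow> bool"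
  where "finitely_generated_module R M \<longleftrightarrow>
    (\<exists>S. finite S \<and> S \<subseteq> carrier M \<and> submodule_span R M S = carrier M)"

text \<open>
  Projectivity is the lifting property along surjections \<open>M \<rightarrow> N\<close>. A definition in HOL cannot
  quantify over the types of \<open>M\<close> and \<open>N\<close>; the types chosen here contain the free module on
  \<^term>\<open>carrier P\<close> and \<open>P\<close> itself, so that lifting the identity of \<open>P\<close> exhibits \<open>P\<close> as a direct
  summand of a free module, which gives the lifting property for all other types.
\<close>

definition projective_module ::
  "('k, 'x) ring_scheme \<Rightarrow> ('k, 'p, 'y) module_scheme \<Rightarrow> bool"
  where "projective_module R P \<longleftrightarrow>
    (\<forall>(M :: ('k, 'p \<Rightarrow> 'k) module) (N :: ('k, 'p) module) g f.
       module R M \<and> module R N \<and> g \<in> lin_hom R M N \<and> g ` carrier M = carrier N \<and> f \<in> lin_hom R P N \<longrightarrow>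
       (\<exists>h\<in>lin_hom R P M. \<forall>x\<in>carrier P. g (h x) = f x))"

text \<open>The free module on \<open>S\<close>: finitely supported functions vanishing outside \<open>S\<close>.\<close>

definition free_module :: "('k, 'x) ring_scheme \<Rightarrow> 's set \<Rightarrow> ('k, 's \<Rightarrow> 'k) module"
  where "free_module R S =
    \<lparr>carrier = {f. (\<forall>s. f s \<in> carrier R) \<and> finite {s. f s \<noteq> \<zero>\<^bsub>R\<^esub>} \<and> {s. f s \<noteq> \<zero>\<^bsub>R\<^esub>} \<subseteq> S},
     mult = undefined, one = undefined,
     zero = (\<lambda>s. \<zero>\<^bsub>R\<^esub>),
     add = (\<lambda>f g s. f s \<oplus>\<^bsub>R\<^esub> g s),
     smult = (\<lambda>r f s. r \<otimes>\<^bsub>R\<^esub> f s)\<rparr>"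

definition free_basis :: "('k, 'x) ring_scheme \<Rightarrow> 's \<Rightarrow> 's \<Rightarrow> 'k"
  where "free_basis R s = (\<lambda>t. if t = s then \<one>\<^bsub>R\<^esub> else \<zero>\<^bsub>R\<^esub>)"

definition quotient_module ::
  "('k, 'x) ring_scheme \<Rightarrow> ('k, 'm, 'y) module_scheme \<Rightarrow> 'm set \<Rightarrow> ('k, 'm set) module"
  where "quotient_module R M N =
    \<lparr>carrier = a_rcosets\<^bsub>M\<^esub> N, mult = undefined, one = undefined,
     zero = N, add = set_add M,
     smult = (\<lambda>r X. N <+>\<^bsub>M\<^esub> (\<lambda>x. r \<odot>\<^bsub>M\<^esub> x) ` X)\<rparr>"


section \<open>Tensor products\<close>

definition tensor_relations ::
  "('k, 'x) ring_scheme \<Rightarrow> ('k, 'm, 'y) module_scheme \<Rightarrow> ('k, 'n, 'z) module_scheme \<Rightarrow> ('m \<times> 'n \<Rightarrow> 'k) set"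
  where "tensor_relations R M N =
    (let F = free_module R (carrier M \<times> carrier N); b = (\<lambda>m n. free_basis R (m, n)) in
       {b (m \<oplus>\<^bsub>M\<^esub> m') n \<ominus>\<^bsub>F\<^esub> (b m n \<oplus>\<^bsub>F\<^esub> b m' n) | m m' n.
          m \<in> carrier M \<and> m' \<in> carrier M \<and> n \<in> carrier N} \<union>
       {b m (n \<oplus>\<^bsub>N\<^esub> n') \<ominus>\<^bsub>F\<^esub> (b m n \<oplus>\<^bsub>F\<^esub> b m n') | m n n'.
          m \<in> carrier M \<and> n \<in> carrier N \<and> n' \<in> carrier N} \<union>
       {b (r \<odot>\<^bsub>M\<^esub> m) n \<ominus>\<^bsub>F\<^esub> r \<odot>\<^bsub>F\<^esub> b m n | r m n.
          r \<in> carrier R \<and> m \<in> carrier M \<and> n \<in> carrier N} \<union>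
       {b m (r \<odot>\<^bsub>N\<^esub> n) \<ominus>\<^bsub>F\<^esub> r \<odot>\<^bsub>F\<^esub> b m n | r m n.
          r \<in> carrier R \<and> m \<in> carrier M \<and> n \<in> carrier N})"

definition tensor_kernel ::
  "('k, 'x) ring_scheme \<Rightarrow> ('k, 'm, 'y) module_scheme \<Rightarrow> ('k, 'n, 'z) module_scheme \<Rightarrow> ('m \<times> 'n \<Rightarrow> 'k) set"
  where "tensor_kernel R M N =
    submodule_span R (free_module R (carrier M \<times> carrier N)) (tensor_relations R M N)"

definition tensor_module ::
  "('k, 'x) ring_scheme \<Rightarrow> ('k, 'm, 'y) module_scheme \<Rightarrow> ('k, 'n, 'z) module_scheme \<Rightarrow>
   ('k, ('m \<times> 'n \<Rightarrow> 'k) set) module"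
  where "tensor_module R M N =
    quotient_module R (free_module R (carrier M \<times> carrier N)) (tensor_kernel R M N)"

text \<open>The element \<open>m \<otimes> n\<close>:\<close>

definition pure_tensor ::
  "('k, 'x) ring_scheme \<Rightarrow> ('k, 'm, 'y) module_scheme \<Rightarrow> ('k, 'n, 'z) module_scheme \<Rightarrow>
   'm \<Rightarrow> 'n \<Rightarrow> ('m \<times> 'n \<Rightarrow> 'k) set"
  where "pure_tensor R M N m n =
    tensor_kernel R M N +>\<^bsub>free_module R (carrier M \<times> carrier N)\<^esub> free_basis R (m, n)"

text \<open>
  \<open>tensor_lift R P \<phi>\<close> is the linear map into \<open>P\<close> with \<open>m \<otimes> n \<mapsto> \<phi> m n\<close>, for bilinear \<open>\<phi>\<close>. It is evaluated
  on a representative, that is, on a formal linear combination of pairs; the value does not depend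
  on the representative when \<open>\<phi>\<close> is bilinear. Sweedler notation is
  rendered this way: the expression \<open>\<phi>(t\<^sub>1, t\<^sub>2)\<close> for a tensor \<open>t = t\<^sub>1 \<otimes> t\<^sub>2\<close> (summation suppressed) is
  \<open>tensor_lift R P (\<lambda>t1 t2. \<phi> t1 t2) t\<close>.
\<close>

definition tensor_lift ::
  "('k, 'x) ring_scheme \<Rightarrow> ('k, 'p, 'y) module_scheme \<Rightarrow> ('m \<Rightarrow> 'n \<Rightarrow> 'p) \<Rightarrow> ('m \<times> 'n \<Rightarrow> 'k) set \<Rightarrow> 'p"
  where "tensor_lift R P \<phi> t =
    (THE p. \<forall>f\<in>t. p = (\<Oplus>\<^bsub>P\<^esub>q\<in>{q. f q \<noteq> \<zero>\<^bsub>R\<^esub>}. f q \<odot>\<^bsub>P\<^esub> \<phi> (fst q) (snd q)))"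

text \<open>The tensor product of two algebras, with \<open>(a \<otimes> b)(c \<otimes> d) = ac \<otimes> bd\<close>:\<close>

definition tensor_algebra ::
  "('k, 'x) ring_scheme \<Rightarrow> ('k, 'm, 'y) module_scheme \<Rightarrow> ('k, 'n, 'z) module_scheme \<Rightarrow>
   ('k, ('m \<times> 'n \<Rightarrow> 'k) set) module"
  where "tensor_algebra R A B =
    (tensor_module R A B)
      \<lparr>mult := (\<lambda>s t. tensor_lift R (tensor_module R A B)
                 (\<lambda>a b. tensor_lift R (tensor_module R A B)
                   (\<lambda>c d. pure_tensor R A B (a \<otimes>\<^bsub>A\<^esub> c) (b \<otimes>\<^bsub>B\<^esub> d)) t) s),
       one := pure_tensor R A B \<one>\<^bsub>A\<^esub> \<one>\<^bsub>B\<^esub>\<rparr>"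


section \<open>Algebras and bialgebras\<close>

text \<open>The locale \<^locale>\<open>algebra\<close> of the library requires commutativity.\<close>

locale k_algebra = module + ring M +
  assumes smult_mult_left:
      "\<lbrakk>r \<in> carrier R; x \<in> carrier M; y \<in> carrier M\<rbrakk> \<Longrightarrow>
       (r \<odot>\<^bsub>M\<^esub> x) \<otimes>\<^bsub>M\<^esub> y = r \<odot>\<^bsub>M\<^esub> (x \<otimes>\<^bsub>M\<^esub> y)"
    and smult_mult_right:
      "\<lbrakk>r \<in> carrier R; x \<in> carrier M; y \<in> carrier M\<rbrakk> \<Longrightarrow>
       x \<otimes>\<^bsub>M\<^esub> (r \<odot>\<^bsub>M\<^esub> y) = r \<odot>\<^bsub>M\<^esub> (x \<otimes>\<^bsub>M\<^esub> y)"

definition opposite :: "('k, 'a, 'z) module_scheme \<Rightarrow> ('k, 'a, 'z) module_scheme"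
  where "opposite A = A\<lparr>mult := (\<lambda>x y. y \<otimes>\<^bsub>A\<^esub> x)\<rparr>"

record ('k, 'h) bialgebra = "('k, 'h) module" +
  comult :: "'h \<Rightarrow> ('h \<times> 'h \<Rightarrow> 'k) set"
  counit :: "'h \<Rightarrow> 'k"

locale bialgebra = k_algebra R H
  for R :: "('k, 'x) ring_scheme" (structure) and H :: "('k, 'h, 'z) bialgebra_scheme" (structure) +
  assumes comult_linear: "comult H \<in> lin_hom R H (tensor_module R H H)"
    and counit_linear: "counit H \<in> lin_hom R H (self_module R)"
    and comult_coassoc:
      "h \<in> carrier H \<Longrightarrow>
       tensor_lift R (tensor_module R H (tensor_module R H H))
         (\<lambda>x z. tensor_lift R (tensor_module R H (tensor_module R H H))
           (\<lambda>x1 x2. pure_tensor R H (tensor_module R H H) x1 (pure_tensor R H H x2 z))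
           (comult H x))
         (comult H h) =
       tensor_lift R (tensor_module R H (tensor_module R H H))
         (\<lambda>x z. pure_tensor R H (tensor_module R H H) x (comult H z))
         (comult H h)"
    and counit_left:
      "h \<in> carrier H \<Longrightarrow> tensor_lift R H (\<lambda>x y. counit H x \<odot>\<^bsub>H\<^esub> y) (comult H h) = h"
    and counit_right:
      "h \<in> carrier H \<Longrightarrow> tensor_lift R H (\<lambda>x y. counit H y \<odot>\<^bsub>H\<^esub> x) (comult H h) = h"
    and comult_mult:
      "\<lbrakk>g \<in> carrier H; h \<in> carrier H\<rbrakk> \<Longrightarrow>
       comult H (g \<otimes>\<^bsub>H\<^esub> h) = comult H g \<otimes>\<^bsub>tensor_algebra R H H\<^esub> comult H h"
    and comult_one: "comult H \<one>\<^bsub>H\<^esub> = \<one>\<^bsub>tensor_algebra R H H\<^esub>"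
    and counit_mult:
      "\<lbrakk>g \<in> carrier H; h \<in> carrier H\<rbrakk> \<Longrightarrow>
       counit H (g \<otimes>\<^bsub>H\<^esub> h) = counit H g \<otimes>\<^bsub>R\<^esub> counit H h"
    and counit_one: "counit H \<one>\<^bsub>H\<^esub> = \<one>\<^bsub>R\<^esub>"

definition coopposite ::
  "('k, 'x) ring_scheme \<Rightarrow> ('k, 'h, 'z) bialgebra_scheme \<Rightarrow> ('k, 'h, 'z) bialgebra_scheme"
  where "coopposite R H =
    H\<lparr>comult := (\<lambda>h. tensor_lift R (tensor_module R H H) (\<lambda>x y. pure_tensor R H H y x) (comult H h))\<rparr>"

text \<open>
  Linear forms are \<^const>\<open>undefined\<close> outside \<^term>\<open>carrier H\<close>, so that equality in
  the carrier of the dual is equality of linear forms on \<^term>\<open>carrier H\<close>.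
\<close>

definition dual_algebra ::
  "('k, 'x) ring_scheme \<Rightarrow> ('k, 'h, 'z) bialgebra_scheme \<Rightarrow> ('k, 'h \<Rightarrow> 'k) module"
  where "dual_algebra R H =
    \<lparr>carrier = lin_hom R H (self_module R) \<inter> extensional (carrier H),
     mult = (\<lambda>f g. \<lambda>h\<in>carrier H.
               tensor_lift R (self_module R) (\<lambda>h1 h2. f h1 \<otimes>\<^bsub>R\<^esub> g h2) (comult H h)),
     one = (\<lambda>h\<in>carrier H. counit H h),
     zero = (\<lambda>h\<in>carrier H. \<zero>\<^bsub>R\<^esub>),
     add = (\<lambda>f g. \<lambda>h\<in>carrier H. f h \<oplus>\<^bsub>R\<^esub> g h),
     smult = (\<lambda>r f. \<lambda>h\<in>carrier H. r \<otimes>\<^bsub>R\<^esub> f h)\<rparr>"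

text \<open>
  The comultiplication of the dual is determined by \<open>f(hg) = f\<^sub>1(h) f\<^sub>2(g)\<close>; the description is
  meaningful when \<open>H\<close> is finitely generated and projective.
\<close>

definition dual_bialgebra ::
  "('k, 'x) ring_scheme \<Rightarrow> ('k, 'h, 'z) bialgebra_scheme \<Rightarrow> ('k, 'h \<Rightarrow> 'k) bialgebra"
  where "dual_bialgebra R H =
    module.extend (dual_algebra R H)
      \<lparr>comult = (\<lambda>f. THE t. t \<in> carrier (tensor_module R (dual_algebra R H) (dual_algebra R H)) \<and>
          (\<forall>h\<in>carrier H. \<forall>g\<in>carrier H.
             f (h \<otimes>\<^bsub>H\<^esub> g) = tensor_lift R (self_module R) (\<lambda>f1 f2. f1 h \<otimes>\<^bsub>R\<^esub> f2 g) t)),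
       counit = (\<lambda>f. f \<one>\<^bsub>H\<^esub>)\<rparr>"


section \<open>Lax and partial comodule algebras\<close>

locale lax_comodule_algebra = H: bialgebra R H + A: k_algebra R A
  for R :: "('k, 'x) ring_scheme" (structure)
    and H :: "('k, 'h, 'y) bialgebra_scheme" (structure)
    and A :: "('k, 'a, 'z) module_scheme" (structure) +
  fixes \<rho> :: "'a \<Rightarrow> ('a \<times> 'h \<Rightarrow> 'k) set"
  assumes coaction_linear: "\<rho> \<in> lin_hom R A (tensor_module R A H)"
    and coaction_mult:
      "\<lbrakk>a \<in> carrier A; b \<in> carrier A\<rbrakk> \<Longrightarrow>
       \<rho> (a \<otimes>\<^bsub>A\<^esub> b) = \<rho> a \<otimes>\<^bsub>tensor_algebra R A H\<^esub> \<rho> b"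
    and coaction_coassoc:
      "a \<in> carrier A \<Longrightarrow>
       tensor_lift R (tensor_module R (tensor_module R A H) H)
         (\<lambda>a0 a1. pure_tensor R (tensor_module R A H) H (\<rho> a0) a1) (\<rho> a) =
       tensor_lift R (tensor_module R (tensor_module R A H) H)
         (\<lambda>a0 a1. tensor_lift R (tensor_module R (tensor_module R A H) H)
           (\<lambda>e0 e1. tensor_lift R (tensor_module R (tensor_module R A H) H)
             (\<lambda>h1 h2. pure_tensor R (tensor_module R A H) H
                        (pure_tensor R A H (a0 \<otimes>\<^bsub>A\<^esub> e0) (h1 \<otimes>\<^bsub>H\<^esub> e1)) h2)
             (comult H a1))
           (\<rho> \<one>\<^bsub>A\<^esub>))
         (\<rho> a)"
    and coaction_counit:
      "a \<in> carrier A \<Longrightarrow>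
       tensor_lift R A (\<lambda>a0 a1. counit H a1 \<odot>\<^bsub>A\<^esub> a0) (\<rho> a) =
       tensor_lift R A (\<lambda>e0 e1. counit H e1 \<odot>\<^bsub>A\<^esub> (e0 \<otimes>\<^bsub>A\<^esub> a)) (\<rho> \<one>\<^bsub>A\<^esub>)"
    and coaction_one:
      "\<rho> \<one>\<^bsub>A\<^esub> =
       tensor_lift R (tensor_module R A H)
         (\<lambda>d0 d1. tensor_lift R (tensor_module R A H)
           (\<lambda>e0 e1. pure_tensor R A H (counit H d1 \<odot>\<^bsub>A\<^esub> (d0 \<otimes>\<^bsub>A\<^esub> e0)) e1) (\<rho> \<one>\<^bsub>A\<^esub>))
         (\<rho> \<one>\<^bsub>A\<^esub>)"

locale partial_comodule_algebra = lax_comodule_algebra +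
  assumes coaction_counit_one:
    "tensor_lift R A (\<lambda>e0 e1. counit H e1 \<odot>\<^bsub>A\<^esub> e0) (\<rho> \<one>\<^bsub>A\<^esub>) = \<one>\<^bsub>A\<^esub>"


section \<open>Lax and partial module algebras\<close>

text \<open>The action is a linear map on \<open>K \<otimes> B\<close>; \<open>x \<cdot> b\<close> is its value at \<open>x \<otimes> b\<close>.\<close>

locale lax_module_algebra = K: bialgebra R K + B: k_algebra R B
  for R :: "('k, 'x) ring_scheme" (structure)
    and K :: "('k, 'h, 'y) bialgebra_scheme" (structure)
    and B :: "('k, 'b, 'z) module_scheme" (structure) +
  fixes \<alpha> :: "('h \<times> 'b \<Rightarrow> 'k) set \<Rightarrow> 'b"
    and act :: "'h \<Rightarrow> 'b \<Rightarrow> 'b" (infixr \<open>\<cdot>\<close> 75)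
  defines "x \<cdot> b \<equiv> \<alpha> (pure_tensor R K B x b)"
  assumes action_linear: "\<alpha> \<in> lin_hom R (tensor_module R K B) B"
    and action_mult:
      "\<lbrakk>x \<in> carrier K; a \<in> carrier B; b \<in> carrier B\<rbrakk> \<Longrightarrow>
       x \<cdot> (a \<otimes>\<^bsub>B\<^esub> b) = tensor_lift R B (\<lambda>x1 x2. (x1 \<cdot> a) \<otimes>\<^bsub>B\<^esub> (x2 \<cdot> b)) (comult K x)"
    and action_mult_action:
      "\<lbrakk>x \<in> carrier K; y \<in> carrier K; a \<in> carrier B; b \<in> carrier B\<rbrakk> \<Longrightarrow>
       x \<cdot> (a \<otimes>\<^bsub>B\<^esub> (y \<cdot> b)) =
         tensor_lift R B (\<lambda>x1 x2. (x1 \<cdot> a) \<otimes>\<^bsub>B\<^esub> ((x2 \<otimes>\<^bsub>K\<^esub> y) \<cdot> b)) (comult K x)"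
    and action_one:
      "a \<in> carrier B \<Longrightarrow> a \<otimes>\<^bsub>B\<^esub> (\<one>\<^bsub>K\<^esub> \<cdot> \<one>\<^bsub>B\<^esub>) = \<one>\<^bsub>K\<^esub> \<cdot> a"
    and action_one_mult:
      "\<lbrakk>x \<in> carrier K; a \<in> carrier B\<rbrakk> \<Longrightarrow>
       a \<otimes>\<^bsub>B\<^esub> (x \<cdot> \<one>\<^bsub>B\<^esub>) = \<one>\<^bsub>K\<^esub> \<cdot> (a \<otimes>\<^bsub>B\<^esub> (x \<cdot> \<one>\<^bsub>B\<^esub>))"

locale partial_module_algebra = lax_module_algebra +
  assumes action_one_one: "\<one>\<^bsub>K\<^esub> \<cdot> \<one>\<^bsub>B\<^esub> = \<one>\<^bsub>B\<^esub>"


section \<open>From coactions to actions of the dual\<close>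

text \<open>\<open>f \<cdot> a = f(a\<^sub>1) a\<^sub>0\<close>, as a linear map on the tensor product of the dual with \<open>A\<close>:\<close>

definition dual_action ::
  "('k, 'x) ring_scheme \<Rightarrow> ('k, 'h, 'y) bialgebra_scheme \<Rightarrow> ('k, 'a, 'z) module_scheme \<Rightarrow>
   ('a \<Rightarrow> ('a \<times> 'h \<Rightarrow> 'k) set) \<Rightarrow> (('h \<Rightarrow> 'k) \<times> 'a \<Rightarrow> 'k) set \<Rightarrow> 'a"
  where "dual_action R H A \<rho> =
    (\<lambda>t\<in>carrier (tensor_module R (dual_bialgebra R H) A).
       tensor_lift R A (\<lambda>f a. tensor_lift R A (\<lambda>a0 a1. f a1 \<odot>\<^bsub>A\<^esub> a0) (\<rho> a)) t)"

end

(* For finitely generated projective H with dual basis (e_i, c_i), a tensor t in M (x) H is recovered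
   from its contractions (id (x) f)(t) with linear forms f on H, since t is the sum of
   (id (x) c_i)(t) (x) e_i; the same holds for H*, with the evaluations at e_i as coordinate forms.
   So every identity between values of rho can be tested against linear forms on H, and every
   identity in tensor powers of H* against evaluations; the latter makes H*cop a bialgebra, its
   comultiplication being characterised by f_1(h) f_2(g) = f(gh). Write x . a = x(a_1) a_0. Tested in
   this way, multiplicativity of rho is the first module algebra axiom. The second axiom is
   rho(b_0 a) (x) b_1 = b_0 a_0 (x) b_1(1) a_1 (x) b_1(2), which at a = 1 is the lax coassociativity
   and follows from it for all a by multiplying with rho(a) in the first two tensor factors. With
   u = eps(1_1) 1_0 = eps . 1, the counit axiom reads u a = eps . a, the remaining comodule axiom
   reads x . 1 = u (x . 1), and given the former it is equivalent to the last module axiom. *)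

theory Submission
  imports Defs
begin

text \<open>Tensors are cosets and Sweedler sums are values of a description, so nothing can be
  computed on them directly. Identities are phrased between maps that are linear in each tensor and
  compared on pure tensors; a tensor such as \<open>comult H h\<close> inside an expression is often
  first replaced by an arbitrary one, so that it may be taken pure. The price is a bilinearity proof
  for every nested expression, paid by resolution with one set of rules. Finite generation and
  projectivity enter only through the dual basis. It gives existence and uniqueness of the
  comultiplication of the dual, and the inverse of the passage from coactions to actions. The
  opposites arise from one place: in \<rho>(a) \<rho>(b) the \<open>H\<close>-parts multiply as h g,
  and x(h g) = x_1(g) x_2(h) for the opposite comultiplication. Hence x . (a b) = (x_2 . a)(x_1 .
  b), which is the module algebra law once products are read in A^op.\<close>

section \<open>Linear maps and spans of submodules\<close>

lemma lin_homI:
  assumes "\<And>x. x \<in> carrier M \<Longrightarrow> f x \<in> carrier N"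
    and "\<And>x y. \<lbrakk>x \<in> carrier M; y \<in> carrier M\<rbrakk> \<Longrightarrow> f (x \<oplus>\<^bsub>M\<^esub> y) = f x \<oplus>\<^bsub>N\<^esub> f y"
    and "\<And>r x. \<lbrakk>r \<in> carrier R; x \<in> carrier M\<rbrakk> \<Longrightarrow> f (r \<odot>\<^bsub>M\<^esub> x) = r \<odot>\<^bsub>N\<^esub> f x"
  shows "f \<in> lin_hom R M N"
  using assms unfolding lin_hom_def by auto

lemma lin_hom_closed: "\<lbrakk>f \<in> lin_hom R M N; x \<in> carrier M\<rbrakk> \<Longrightarrow> f x \<in> carrier N"
  unfolding lin_hom_def by auto

lemma lin_hom_add:
  "\<lbrakk>f \<in> lin_hom R M N; x \<in> carrier M; y \<in> carrier M\<rbrakk> \<Longrightarrow> f (x \<oplus>\<^bsub>M\<^esub> y) = f x \<oplus>\<^bsub>N\<^esub> f y"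
  unfolding lin_hom_def by auto

lemma lin_hom_smult:
  "\<lbrakk>f \<in> lin_hom R M N; r \<in> carrier R; x \<in> carrier M\<rbrakk> \<Longrightarrow> f (r \<odot>\<^bsub>M\<^esub> x) = r \<odot>\<^bsub>N\<^esub> f x"
  unfolding lin_hom_def by auto

text \<open>Linearity constrains only values on the carrier, where sums and multiples stay by the
  module axioms. Hence a map may be exchanged for its \<open>restrict\<close>, as the extensional
  encoding of forms, coactions and actions demands.\<close>

lemma lin_hom_cong:
  assumes "f \<in> lin_hom R M N" "module R M" "\<And>x. x \<in> carrier M \<Longrightarrow> f x = g x"
  shows "g \<in> lin_hom R M N"
proof -
  interpret module R M by fact
  show ?thesis using assms unfolding lin_hom_def by (auto simp: Pi_iff)
qed

lemma lin_hom_eqI: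
  assumes "f \<in> lin_hom R M N \<inter> extensional (carrier M)" "g \<in> lin_hom R M N \<inter> extensional (carrier M)"
    "\<And>x. x \<in> carrier M \<Longrightarrow> f x = g x"
  shows "f = g"
  using assms by (auto intro: extensionalityI)

lemma lin_hom_zero:
  assumes "module R M" "module R N" "f \<in> lin_hom R M N"
  shows "f \<zero>\<^bsub>M\<^esub> = \<zero>\<^bsub>N\<^esub>"
proof -
  interpret M: module R M by fact
  interpret N: module R N by fact
  have "f \<zero>\<^bsub>M\<^esub> = f (\<zero>\<^bsub>R\<^esub> \<odot>\<^bsub>M\<^esub> \<zero>\<^bsub>M\<^esub>)" by simp
  also have "\<dots> = \<zero>\<^bsub>R\<^esub> \<odot>\<^bsub>N\<^esub> f \<zero>\<^bsub>M\<^esub>"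
    using assms(3) by (intro lin_hom_smult) auto
  also have "\<dots> = \<zero>\<^bsub>N\<^esub>" using lin_hom_closed[OF assms(3)] by simp
  finally show ?thesis .
qed

lemma lin_hom_uminus:
  assumes "module R M" "module R N" "f \<in> lin_hom R M N" "x \<in> carrier M"
  shows "f (\<ominus>\<^bsub>M\<^esub> x) = \<ominus>\<^bsub>N\<^esub> f x"
proof -
  interpret M: module R M by fact
  interpret N: module R N by fact
  have "\<ominus>\<^bsub>M\<^esub> x = (\<ominus>\<^bsub>R\<^esub> \<one>\<^bsub>R\<^esub>) \<odot>\<^bsub>M\<^esub> x" "f x \<in> carrier N"
    using assms lin_hom_closed[OF assms(3)] by (simp_all add: M.smult_l_minus)
  moreover have "\<ominus>\<^bsub>N\<^esub> f x = (\<ominus>\<^bsub>R\<^esub> \<one>\<^bsub>R\<^esub>) \<odot>\<^bsub>N\<^esub> f x"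
    using calculation by (simp add: N.smult_l_minus)
  ultimately show ?thesis using assms by (simp add: lin_hom_smult[OF assms(3)])
qed

lemma lin_hom_minus:
  assumes "module R M" "module R N" "f \<in> lin_hom R M N" "x \<in> carrier M" "y \<in> carrier M"
  shows "f (x \<ominus>\<^bsub>M\<^esub> y) = f x \<ominus>\<^bsub>N\<^esub> f y"
proof -
  interpret M: module R M by fact
  show ?thesis using assms
    by (simp add: a_minus_def lin_hom_add[OF assms(3)] lin_hom_uminus[OF assms(1-3)])
qed

lemma lin_hom_finsum:
  assumes "module R M" "module R N" "f \<in> lin_hom R M N" "finite I" "\<And>i. i \<in> I \<Longrightarrow> c i \<in> carrier M"
  shows "f (\<Oplus>\<^bsub>M\<^esub>i\<in>I. c i) = (\<Oplus>\<^bsub>N\<^esub>i\<in>I. f (c i))"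
proof -
  interpret M: module R M by fact
  interpret N: module R N by fact
  show ?thesis using assms(4,5)
  proof (induction I)
    case empty
    show ?case using lin_hom_zero[OF assms(1-3)] by simp
  next
    case (insert i I)
    then show ?case using assms(3)
      by (simp add: Pi_iff lin_hom_add[OF assms(3)] lin_hom_closed[OF assms(3)])
  qed
qed

text \<open>If a linear map on a free module vanishes on the tensor relations, this kernel contains
  them and hence their span: that is how the map factors through the tensor product.\<close>

lemma lin_hom_kernel_submodule:
  assumes "module R M" "module R N" "f \<in> lin_hom R M N"
  shows "submodule {x \<in> carrier M. f x = \<zero>\<^bsub>N\<^esub>} R M"
proof -
  interpret M: module R M by fact
  interpret N: module R N by fact
  show ?thesis
  proof (rule M.submoduleI)
  qed (use assms in \<open>auto simp: lin_hom_zero lin_hom_uminus lin_hom_add[OF assms(3)] lin_hom_smult[OF assms(3)]\<close>)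
qed

lemma submodule_span_incl: "S \<subseteq> submodule_span R M S"
  unfolding submodule_span_def by auto

lemma submodule_span_least: "\<lbrakk>submodule N R M; S \<subseteq> N\<rbrakk> \<Longrightarrow> submodule_span R M S \<subseteq> N"
  unfolding submodule_span_def by auto

lemma submodule_span_submodule:
  assumes "module R M" "S \<subseteq> carrier M"
  shows "submodule (submodule_span R M S) R M"
proof -
  interpret M: module R M by fact
  \<comment> \<open>\<open>carrier M\<close> is itself a submodule above \<open>S\<close>; without
    such a member the intersection would be the whole type.\<close>
  have *: "submodule_span R M S \<subseteq> carrier M"
    using M.carrier_is_submodule assms(2) by (rule submodule_span_least)
  have zero: "\<zero>\<^bsub>M\<^esub> \<in> N" if "submodule N R M" for N
    using subgroup.one_closed[OF submodule.axioms(1)[OF that]] by simp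
  show ?thesis
    by (rule M.submoduleI[OF *]) (unfold submodule_span_def, auto simp: zero M.submoduleE(3,4,5))
qed

context cring
begin

section \<open>Free modules\<close>

lemma free_module_simps:
  "carrier (free_module R S) =
     {f. (\<forall>s. f s \<in> carrier R) \<and> finite {s. f s \<noteq> \<zero>} \<and> {s. f s \<noteq> \<zero>} \<subseteq> S}"
  "zero (free_module R S) = (\<lambda>s. \<zero>)"
  "add (free_module R S) = (\<lambda>f g s. f s \<oplus> g s)"
  "smult (free_module R S) = (\<lambda>r f s. r \<otimes> f s)"
  unfolding free_module_def by simp_all

lemma free_module_carrierI:
  assumes "\<And>s. f s \<in> carrier R" "finite T" "T \<subseteq> S" "\<And>s. s \<notin> T \<Longrightarrow> f s = \<zero>"
  shows "f \<in> carrier (free_module R S)"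
proof -
  have "{s. f s \<noteq> \<zero>} \<subseteq> T" using assms(4) by auto
  then show ?thesis using assms finite_subset by (auto simp: free_module_simps)
qed

lemma free_module_module: "module R (free_module R S)"
proof (intro moduleI abelian_groupI is_cring)
  fix f g assume fg: "f \<in> carrier (free_module R S)" "g \<in> carrier (free_module R S)"
  show "f \<oplus>\<^bsub>free_module R S\<^esub> g \<in> carrier (free_module R S)"
    by (rule free_module_carrierI[of _ "{s. f s \<noteq> \<zero>} \<union> {s. g s \<noteq> \<zero>}"])
      (use fg in \<open>auto simp: free_module_simps\<close>)
next
  fix r f assume rf: "r \<in> carrier R" "f \<in> carrier (free_module R S)"
  show "r \<odot>\<^bsub>free_module R S\<^esub> f \<in> carrier (free_module R S)"
    by (rule free_module_carrierI[of _ "{s. f s \<noteq> \<zero>}"])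
      (use rf in \<open>auto simp: free_module_simps\<close>)
next
  fix f assume f: "f \<in> carrier (free_module R S)"
  have "(\<lambda>s. \<ominus> f s) \<in> carrier (free_module R S)"
    by (rule free_module_carrierI[of _ "{s. f s \<noteq> \<zero>}"])
      (use f in \<open>auto simp: free_module_simps\<close>)
  moreover have "(\<lambda>s. \<ominus> f s) \<oplus>\<^bsub>free_module R S\<^esub> f = \<zero>\<^bsub>free_module R S\<^esub>"
    using f by (auto simp: free_module_simps l_neg)
  ultimately show "\<exists>g\<in>carrier (free_module R S). g \<oplus>\<^bsub>free_module R S\<^esub> f = \<zero>\<^bsub>free_module R S\<^esub>"
    by blast
next
  fix f g assume "f \<in> carrier (free_module R S)" "g \<in> carrier (free_module R S)"
  then show "f \<oplus>\<^bsub>free_module R S\<^esub> g = g \<oplus>\<^bsub>free_module R S\<^esub> f"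
    unfolding free_module_simps by (intro ext a_comm) auto
qed (auto simp: free_module_simps a_assoc m_assoc l_distr r_distr)

lemma free_basis_closed: "s \<in> S \<Longrightarrow> free_basis R s \<in> carrier (free_module R S)"
  by (rule free_module_carrierI[of _ "{s}"]) (auto simp: free_basis_def)

lemma free_module_induct [consumes 1, case_names zero add]:
  assumes f: "f \<in> carrier (free_module R S)"
    and zero: "Q \<zero>\<^bsub>free_module R S\<^esub>"
    and add: "\<And>r s g. \<lbrakk>r \<in> carrier R; s \<in> S; g \<in> carrier (free_module R S); Q g\<rbrakk> \<Longrightarrow>
      Q (r \<odot>\<^bsub>free_module R S\<^esub> free_basis R s \<oplus>\<^bsub>free_module R S\<^esub> g)"
  shows "Q f"
proof -
  \<comment> \<open>Induction over a finite set \<open>T\<close> that contains the support: clearing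
    the coordinate \<open>x\<close> leaves a function vanishing outside the smaller set, whether or
    not \<open>f x\<close> was zero.\<close>
  have *: "Q f" if "finite T" "T \<subseteq> S" "\<And>s. f s \<in> carrier R" "\<And>s. s \<notin> T \<Longrightarrow> f s = \<zero>" for T f
    using that
  proof (induction T arbitrary: f rule: finite_induct)
    case empty
    then have "f = \<zero>\<^bsub>free_module R S\<^esub>" by (auto simp: free_module_simps)
    then show ?case using zero by simp
  next
    case (insert x T)
    let ?g = "f(x := \<zero>)"
    have "Q ?g" by (rule insert.IH) (use insert in auto)
    moreover have "?g \<in> carrier (free_module R S)"
      by (rule free_module_carrierI[of _ T]) (use insert in auto)
    moreover have "f = f x \<odot>\<^bsub>free_module R S\<^esub> free_basis R x \<oplus>\<^bsub>free_module R S\<^esub> ?g"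
      using insert by (auto simp: free_module_simps free_basis_def)
    ultimately show ?case using add[of "f x" x ?g] insert by simp
  qed
  show ?thesis
    by (rule *[of "{s. f s \<noteq> \<zero>}"]) (use f in \<open>simp_all add: free_module_simps\<close>)
qed

text \<open>The linear extension of \<open>c\<close> to the free module. It has the shape of the sum
  inside \<open>tensor_lift\<close>, so that description can be folded into it.\<close>

definition lin_comb :: "('a, 'p, 'z) module_scheme \<Rightarrow> ('s \<Rightarrow> 'p) \<Rightarrow> ('s \<Rightarrow> 'a) \<Rightarrow> 'p"
  where "lin_comb P c f = (\<Oplus>\<^bsub>P\<^esub>s\<in>{s. f s \<noteq> \<zero>}. f s \<odot>\<^bsub>P\<^esub> c s)"

text \<open>The supports of two functions, of their sum and of a multiple differ, so linearity of
  the extension is shown with all sums taken over one common finite set.\<close>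

lemma lin_comb_superset:
  assumes "module R P" "c \<in> S \<rightarrow> carrier P" "finite T" "T \<subseteq> S"
    "\<And>s. f s \<in> carrier R" "\<And>s. s \<notin> T \<Longrightarrow> f s = \<zero>"
  shows "lin_comb P c f = (\<Oplus>\<^bsub>P\<^esub>s\<in>T. f s \<odot>\<^bsub>P\<^esub> c s)"
proof -
  interpret P: module R P by fact
  show ?thesis unfolding lin_comb_def
    by (rule P.add.finprod_mono_neutral_cong_left) (use assms in \<open>auto simp: Pi_iff subset_iff\<close>)
qed

lemma lin_comb_lin_hom:
  assumes "module R P" "c \<in> S \<rightarrow> carrier P"
  shows "lin_comb P c \<in> lin_hom R (free_module R S) P"
proof -
  interpret P: module R P by fact
  have c: "c s \<in> carrier P" if "s \<in> S" for s using assms that by auto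
  show ?thesis
  proof (rule lin_homI)
    fix f assume f: "f \<in> carrier (free_module R S)"
    let ?T = "{s. f s \<noteq> \<zero>}"
    show "lin_comb P c f \<in> carrier P"
      unfolding lin_comb_def using f by (intro P.finsum_closed) (auto simp: free_module_simps intro!: c)
    fix r assume r: "r \<in> carrier R"
    have "lin_comb P c (r \<odot>\<^bsub>free_module R S\<^esub> f) = (\<Oplus>\<^bsub>P\<^esub>s\<in>?T. (r \<otimes> f s) \<odot>\<^bsub>P\<^esub> c s)"
      using f r by (subst lin_comb_superset[OF assms, of ?T]) (auto simp: free_module_simps)
    also have "\<dots> = (\<Oplus>\<^bsub>P\<^esub>s\<in>?T. r \<odot>\<^bsub>P\<^esub> (f s \<odot>\<^bsub>P\<^esub> c s))"
      using f r c by (intro P.finsum_cong') (auto simp: free_module_simps P.smult_assoc1 subset_iff)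
    also have "\<dots> = r \<odot>\<^bsub>P\<^esub> lin_comb P c f"
      unfolding lin_comb_def using f r c
      by (intro P.finsum_smult_ldistr[symmetric]) (auto simp: free_module_simps subset_iff)
    finally show "lin_comb P c (r \<odot>\<^bsub>free_module R S\<^esub> f) = r \<odot>\<^bsub>P\<^esub> lin_comb P c f" .
  next
    fix f g assume fg: "f \<in> carrier (free_module R S)" "g \<in> carrier (free_module R S)"
    let ?T = "{s. f s \<noteq> \<zero>} \<union> {s. g s \<noteq> \<zero>}"
    have *: "lin_comb P c h = (\<Oplus>\<^bsub>P\<^esub>s\<in>?T. h s \<odot>\<^bsub>P\<^esub> c s)" if "\<And>s. h s \<in> carrier R" "\<And>s. s \<notin> ?T \<Longrightarrow> h s = \<zero>" for h
      using fg that by (intro lin_comb_superset[OF assms]) (auto simp: free_module_simps)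
    have "lin_comb P c (f \<oplus>\<^bsub>free_module R S\<^esub> g) = (\<Oplus>\<^bsub>P\<^esub>s\<in>?T. (f s \<oplus> g s) \<odot>\<^bsub>P\<^esub> c s)"
      using fg by (subst *) (auto simp: free_module_simps)
    also have "\<dots> = (\<Oplus>\<^bsub>P\<^esub>s\<in>?T. f s \<odot>\<^bsub>P\<^esub> c s \<oplus>\<^bsub>P\<^esub> g s \<odot>\<^bsub>P\<^esub> c s)"
      using fg c by (intro P.finsum_cong') (auto simp: free_module_simps P.smult_l_distr subset_iff)
    also have "\<dots> = (\<Oplus>\<^bsub>P\<^esub>s\<in>?T. f s \<odot>\<^bsub>P\<^esub> c s) \<oplus>\<^bsub>P\<^esub> (\<Oplus>\<^bsub>P\<^esub>s\<in>?T. g s \<odot>\<^bsub>P\<^esub> c s)"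
      using fg c by (intro P.finsum_addf) (auto simp: free_module_simps subset_iff)
    also have "\<dots> = lin_comb P c f \<oplus>\<^bsub>P\<^esub> lin_comb P c g"
      using fg by (subst (1 2) *) (auto simp: free_module_simps)
    finally show "lin_comb P c (f \<oplus>\<^bsub>free_module R S\<^esub> g) = lin_comb P c f \<oplus>\<^bsub>P\<^esub> lin_comb P c g" .
  qed
qed

lemma lin_comb_free_basis:
  assumes "module R P" "c s \<in> carrier P"
  shows "lin_comb P c (free_basis R s) = c s"
proof -
  interpret P: module R P by fact
  have "lin_comb P c (free_basis R s) = (\<Oplus>\<^bsub>P\<^esub>t\<in>{s}. free_basis R s t \<odot>\<^bsub>P\<^esub> c t)"
    by (rule lin_comb_superset[of _ _ "{s}"]) (use assms in \<open>auto simp: free_basis_def\<close>)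
  then show ?thesis using assms by (simp add: free_basis_def)
qed

section \<open>Quotient modules\<close>

lemma submodule_abelian_subgroup:
  assumes "module R M" "submodule N R M"
  shows "abelian_subgroup N M"
proof -
  interpret M: module R M by fact
  show ?thesis
    by (rule abelian_subgroupI3)
      (auto intro!: additive_subgroupI submodule.axioms(1)[OF assms(2)] M.abelian_group_axioms)
qed

lemma quotient_module_simps:
  "carrier (quotient_module R M N) = a_rcosets\<^bsub>M\<^esub> N"
  "zero (quotient_module R M N) = N"
  "add (quotient_module R M N) = set_add M"
  "smult (quotient_module R M N) r X = N <+>\<^bsub>M\<^esub> (\<lambda>x. r \<odot>\<^bsub>M\<^esub> x) ` X"
  unfolding quotient_module_def by simp_all

lemma quotient_carrier: "carrier (quotient_module R M N) = (\<lambda>x. N +>\<^bsub>M\<^esub> x) ` carrier M"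
  by (auto simp: quotient_module_simps A_RCOSETS_def' )

text \<open>The multiples of the elements of a coset may be fewer than a coset: for \<open>r\<close>
  zero only zero is left. Adding \<open>N\<close> in the definition fills them up to a full
  coset.\<close>

lemma quotient_smult_coset:
  assumes "module R M" "submodule N R M" "r \<in> carrier R" "x \<in> carrier M"
  shows "r \<odot>\<^bsub>quotient_module R M N\<^esub> (N +>\<^bsub>M\<^esub> x) = N +>\<^bsub>M\<^esub> (r \<odot>\<^bsub>M\<^esub> x)"
proof -
  interpret M: module R M by fact
  note N = M.submoduleE[OF assms(2)]
  have zN: "\<zero>\<^bsub>M\<^esub> \<in> N" using subgroup.one_closed[OF submodule.axioms(1)[OF assms(2)]] by simp
  show ?thesis
  proof (auto simp: quotient_module_simps set_add_def' a_r_coset_def')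
    fix m n assume "m \<in> N" "n \<in> N"
    then have "m \<oplus>\<^bsub>M\<^esub> r \<odot>\<^bsub>M\<^esub> (n \<oplus>\<^bsub>M\<^esub> x) = (m \<oplus>\<^bsub>M\<^esub> r \<odot>\<^bsub>M\<^esub> n) \<oplus>\<^bsub>M\<^esub> r \<odot>\<^bsub>M\<^esub> x"
      using assms N by (auto simp: M.smult_r_distr M.a_assoc subset_iff)
    then show "\<exists>n'\<in>N. m \<oplus>\<^bsub>M\<^esub> r \<odot>\<^bsub>M\<^esub> (n \<oplus>\<^bsub>M\<^esub> x) = n' \<oplus>\<^bsub>M\<^esub> r \<odot>\<^bsub>M\<^esub> x"
      using N assms \<open>m \<in> N\<close> \<open>n \<in> N\<close> by blast
  next
    fix m assume "m \<in> N"
    then show "\<exists>n\<in>N. \<exists>y\<in>N. m \<oplus>\<^bsub>M\<^esub> r \<odot>\<^bsub>M\<^esub> x = n \<oplus>\<^bsub>M\<^esub> r \<odot>\<^bsub>M\<^esub> (y \<oplus>\<^bsub>M\<^esub> x)"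
      using zN assms by (intro bexI[of _ m] bexI[of _ "\<zero>\<^bsub>M\<^esub>"]) auto
  qed
qed

lemma quotient_add_coset:
  assumes "module R M" "submodule N R M" "x \<in> carrier M" "y \<in> carrier M"
  shows "(N +>\<^bsub>M\<^esub> x) \<oplus>\<^bsub>quotient_module R M N\<^esub> (N +>\<^bsub>M\<^esub> y) = N +>\<^bsub>M\<^esub> (x \<oplus>\<^bsub>M\<^esub> y)"
  using abelian_subgroup.a_rcos_sum[OF submodule_abelian_subgroup[OF assms(1,2)] assms(3,4)]
  by (simp add: quotient_module_simps)

lemma quotient_module_module:
  assumes "module R M" "submodule N R M"
  shows "module R (quotient_module R M N)"
proof -
  interpret M: module R M by fact
  let ?Q = "quotient_module R M N"
  have zero: "\<zero>\<^bsub>?Q\<^esub> = N +>\<^bsub>M\<^esub> \<zero>\<^bsub>M\<^esub>"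
    using M.submoduleE(1)[OF assms(2)] by (simp add: quotient_module_simps)
  have "abelian_group ?Q"
  proof (rule abelian_groupI)
    fix X Y assume "X \<in> carrier ?Q" "Y \<in> carrier ?Q"
    then show "X \<oplus>\<^bsub>?Q\<^esub> Y = Y \<oplus>\<^bsub>?Q\<^esub> X"
      by (auto simp: quotient_carrier quotient_add_coset[OF assms] M.a_comm)
  next
    fix X assume "X \<in> carrier ?Q"
    then obtain x where x: "x \<in> carrier M" "X = N +>\<^bsub>M\<^esub> x" by (auto simp: quotient_carrier)
    then have "(N +>\<^bsub>M\<^esub> (\<ominus>\<^bsub>M\<^esub> x)) \<oplus>\<^bsub>?Q\<^esub> X = \<zero>\<^bsub>?Q\<^esub>"
      by (simp add: zero quotient_add_coset[OF assms] M.l_neg)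
    then show "\<exists>Y\<in>carrier ?Q. Y \<oplus>\<^bsub>?Q\<^esub> X = \<zero>\<^bsub>?Q\<^esub>" using x by (auto simp: quotient_carrier)
  qed (auto simp: zero quotient_carrier quotient_add_coset[OF assms] M.a_assoc)
  then show ?thesis using assms
    by (intro moduleI is_cring)
      (auto simp: quotient_carrier quotient_smult_coset quotient_add_coset M.smult_assoc1
        M.smult_l_distr M.smult_r_distr)
qed

lemma quotient_map_lin_hom:
  assumes "module R M" "submodule N R M"
  shows "(\<lambda>x. N +>\<^bsub>M\<^esub> x) \<in> lin_hom R M (quotient_module R M N)"
  using assms by (intro lin_homI) (auto simp: quotient_carrier quotient_smult_coset quotient_add_coset)

end

section \<open>Tensor products\<close>

context cring
begin

abbreviation tensor_product ::
    "('a, 'm, 'y) module_scheme \<Rightarrow> ('a, 'n, 'z) module_scheme \<Rightarrow> ('a, ('m \<times> 'n \<Rightarrow> 'a) set) module"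
    (infixr \<open>\<boxtimes>\<close> 70)
  where "M \<boxtimes> N \<equiv> tensor_module R M N"

abbreviation scalars :: "('a, 'a) module"
  where "scalars \<equiv> self_module R"

definition bilin ::
    "('a, 'm, 'y) module_scheme \<Rightarrow> ('a, 'n, 'z) module_scheme \<Rightarrow> ('a, 'p, 'w) module_scheme \<Rightarrow>
     ('m \<Rightarrow> 'n \<Rightarrow> 'p) \<Rightarrow> bool"
  where "bilin M N P \<phi> \<longleftrightarrow>
    (\<forall>n\<in>carrier N. (\<lambda>m. \<phi> m n) \<in> lin_hom R M P) \<and> (\<forall>m\<in>carrier M. \<phi> m \<in> lin_hom R N P)"

lemma bilinI:
  assumes "\<And>n. n \<in> carrier N \<Longrightarrow> (\<lambda>m. \<phi> m n) \<in> lin_hom R M P"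
    and "\<And>m. m \<in> carrier M \<Longrightarrow> (\<lambda>n. \<phi> m n) \<in> lin_hom R N P"
  shows "bilin M N P \<phi>"
  using assms unfolding bilin_def by auto

lemma bilinD:
  assumes "bilin M N P \<phi>"
  shows "n \<in> carrier N \<Longrightarrow> (\<lambda>m. \<phi> m n) \<in> lin_hom R M P"
    and "m \<in> carrier M \<Longrightarrow> (\<lambda>n. \<phi> m n) \<in> lin_hom R N P"
    and "\<lbrakk>m \<in> carrier M; n \<in> carrier N\<rbrakk> \<Longrightarrow> \<phi> m n \<in> carrier P"
  using assms lin_hom_closed unfolding bilin_def by fastforce+

context
  fixes M :: "('a, 'm, 'y) module_scheme" and N :: "('a, 'n, 'z) module_scheme"
  assumes M: "module R M" and N: "module R N"
begin

interpretation M: module R M by (rule M)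
interpretation N: module R N by (rule N)

private abbreviation "F \<equiv> free_module R (carrier M \<times> carrier N)"
private abbreviation "K \<equiv> tensor_kernel R M N"
private abbreviation "b m n \<equiv> free_basis R (m, n)"

interpretation F: module R F by (rule free_module_module)

lemma tensor_basis_closed: "\<lbrakk>m \<in> carrier M; n \<in> carrier N\<rbrakk> \<Longrightarrow> b m n \<in> carrier F"
  by (simp add: free_basis_closed)

lemma tensor_kernel_submodule: "submodule K R F"
  unfolding tensor_kernel_def
  by (rule submodule_span_submodule[OF free_module_module])
    (auto simp: tensor_relations_def Let_def intro!: F.minus_closed F.a_closed F.smult_closed
      tensor_basis_closed)

lemma tensor_module_module: "module R (M \<boxtimes> N)"
  unfolding tensor_module_def by (intro quotient_module_module free_module_module tensor_kernel_submodule)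

lemma tensor_coset_lin_hom: "(\<lambda>f. K +>\<^bsub>F\<^esub> f) \<in> lin_hom R F (M \<boxtimes> N)"
  unfolding tensor_module_def by (intro quotient_map_lin_hom free_module_module tensor_kernel_submodule)

lemma tensor_carrier: "carrier (M \<boxtimes> N) = (\<lambda>f. K +>\<^bsub>F\<^esub> f) ` carrier F"
  by (simp add: tensor_module_def quotient_carrier)

lemma tensor_coset_eqI:
  assumes "x \<ominus>\<^bsub>F\<^esub> y \<in> tensor_relations R M N" "x \<in> carrier F" "y \<in> carrier F"
  shows "K +>\<^bsub>F\<^esub> x = K +>\<^bsub>F\<^esub> y"
proof -
  interpret K: abelian_subgroup K F
    by (intro submodule_abelian_subgroup free_module_module tensor_kernel_submodule)
  have "x \<ominus>\<^bsub>F\<^esub> y \<in> K" unfolding tensor_kernel_def by (rule subsetD[OF submodule_span_incl assms(1)])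
  moreover have "x = (x \<ominus>\<^bsub>F\<^esub> y) \<oplus>\<^bsub>F\<^esub> y"
    using assms(2,3) by (simp add: a_minus_def F.a_assoc F.l_neg)
  ultimately have "x \<in> K +>\<^bsub>F\<^esub> y"
    unfolding a_r_coset_def' by blast
  then show ?thesis using K.a_repr_independence'[OF _ assms(3)] by metis
qed

lemma tensor_relationsI:
  shows "\<lbrakk>m \<in> carrier M; m' \<in> carrier M; n \<in> carrier N\<rbrakk> \<Longrightarrow>
      b (m \<oplus>\<^bsub>M\<^esub> m') n \<ominus>\<^bsub>F\<^esub> (b m n \<oplus>\<^bsub>F\<^esub> b m' n) \<in> tensor_relations R M N"
    and "\<lbrakk>m \<in> carrier M; n \<in> carrier N; n' \<in> carrier N\<rbrakk> \<Longrightarrow>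
      b m (n \<oplus>\<^bsub>N\<^esub> n') \<ominus>\<^bsub>F\<^esub> (b m n \<oplus>\<^bsub>F\<^esub> b m n') \<in> tensor_relations R M N"
    and "\<lbrakk>r \<in> carrier R; m \<in> carrier M; n \<in> carrier N\<rbrakk> \<Longrightarrow>
      b (r \<odot>\<^bsub>M\<^esub> m) n \<ominus>\<^bsub>F\<^esub> r \<odot>\<^bsub>F\<^esub> b m n \<in> tensor_relations R M N"
    and "\<lbrakk>r \<in> carrier R; m \<in> carrier M; n \<in> carrier N\<rbrakk> \<Longrightarrow>
      b m (r \<odot>\<^bsub>N\<^esub> n) \<ominus>\<^bsub>F\<^esub> r \<odot>\<^bsub>F\<^esub> b m n \<in> tensor_relations R M N"
  unfolding tensor_relations_def Let_def by blast+

text \<open>Modulo the kernel, the four families of relations are exactly the four laws of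
  bilinearity.\<close>

lemma pure_tensor_bilin: "bilin M N (M \<boxtimes> N) (pure_tensor R M N)"
proof -
  note hom = lin_hom_closed[OF tensor_coset_lin_hom] lin_hom_add[OF tensor_coset_lin_hom, symmetric]
    lin_hom_smult[OF tensor_coset_lin_hom, symmetric]
  show ?thesis
  proof (intro bilinI lin_homI)
    fix m m' n assume *: "m \<in> carrier M" "m' \<in> carrier M" "n \<in> carrier N"
    show "pure_tensor R M N (m \<oplus>\<^bsub>M\<^esub> m') n = pure_tensor R M N m n \<oplus>\<^bsub>M \<boxtimes> N\<^esub> pure_tensor R M N m' n"
      unfolding pure_tensor_def using *
      by (simp add: hom tensor_basis_closed, intro tensor_coset_eqI tensor_relationsI)
        (simp_all add: tensor_basis_closed)
  next
    fix m n n' assume *: "m \<in> carrier M" "n \<in> carrier N" "n' \<in> carrier N"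
    show "pure_tensor R M N m (n \<oplus>\<^bsub>N\<^esub> n') = pure_tensor R M N m n \<oplus>\<^bsub>M \<boxtimes> N\<^esub> pure_tensor R M N m n'"
      unfolding pure_tensor_def using *
      by (simp add: hom tensor_basis_closed, intro tensor_coset_eqI tensor_relationsI)
        (simp_all add: tensor_basis_closed)
  next
    fix r m n assume *: "r \<in> carrier R" "m \<in> carrier M" "n \<in> carrier N"
    show "pure_tensor R M N (r \<odot>\<^bsub>M\<^esub> m) n = r \<odot>\<^bsub>M \<boxtimes> N\<^esub> pure_tensor R M N m n"
      unfolding pure_tensor_def using *
      by (simp add: hom tensor_basis_closed, intro tensor_coset_eqI tensor_relationsI)
        (simp_all add: tensor_basis_closed)
    show "pure_tensor R M N m (r \<odot>\<^bsub>N\<^esub> n) = r \<odot>\<^bsub>M \<boxtimes> N\<^esub> pure_tensor R M N m n"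
      unfolding pure_tensor_def using *
      by (simp add: hom tensor_basis_closed, intro tensor_coset_eqI tensor_relationsI)
        (simp_all add: tensor_basis_closed)
  qed (auto simp: pure_tensor_def hom tensor_basis_closed)
qed

lemmas pure_tensor_closed = bilinD(3)[OF pure_tensor_bilin]

context
  fixes P :: "('a, 'p, 'w) module_scheme" and \<phi>
  assumes P: "module R P" and \<phi>: "bilin M N P \<phi>"
begin

interpretation P: module R P by (rule P)

private abbreviation "g \<equiv> lin_comb P (\<lambda>q. \<phi> (fst q) (snd q))"

text \<open>The sum in \<open>tensor_lift\<close> is a linear map \<open>g\<close> on the free
  module. By bilinearity it kills the relations, hence their span, so it is constant on each coset
  and the description is well defined.\<close>

lemma tensor_lift_coset:
  assumes f: "f \<in> carrier F"
  shows "tensor_lift R P \<phi> (K +>\<^bsub>F\<^esub> f) = g f"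
proof -
  have g: "g \<in> lin_hom R F P"
    by (rule lin_comb_lin_hom[OF P]) (auto simp: bilinD(3)[OF \<phi>])
  have gb: "g (b m n) = \<phi> m n" if "m \<in> carrier M" "n \<in> carrier N" for m n
    using that by (simp add: lin_comb_free_basis[OF P] bilinD(3)[OF \<phi>])
  note g_simps = lin_hom_minus[OF free_module_module P g] lin_hom_add[OF g] lin_hom_smult[OF g]
  have minus_self: "p \<ominus>\<^bsub>P\<^esub> p = \<zero>\<^bsub>P\<^esub>" if "p \<in> carrier P" for p
    using that by (simp add: a_minus_def P.r_neg)
  have "tensor_relations R M N \<subseteq> {x \<in> carrier F. g x = \<zero>\<^bsub>P\<^esub>}"
    unfolding tensor_relations_def Let_def
    by (auto simp: g_simps gb tensor_basis_closed bilinD(3)[OF \<phi>] lin_hom_add[OF bilinD(1)[OF \<phi>]]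
        lin_hom_add[OF bilinD(2)[OF \<phi>]] lin_hom_smult[OF bilinD(1)[OF \<phi>]]
        lin_hom_smult[OF bilinD(2)[OF \<phi>]] minus_self)
  then have "K \<subseteq> {x \<in> carrier F. g x = \<zero>\<^bsub>P\<^esub>}"
    unfolding tensor_kernel_def
    by (intro submodule_span_least lin_hom_kernel_submodule free_module_module P g)
  then have coset: "g f' = g f" if "f' \<in> K +>\<^bsub>F\<^esub> f" for f'
    using that f lin_hom_closed[OF g f] by (auto simp: a_r_coset_def' lin_hom_add[OF g])
  have "f = \<zero>\<^bsub>F\<^esub> \<oplus>\<^bsub>F\<^esub> f" using f by simp
  moreover have "\<zero>\<^bsub>F\<^esub> \<in> K"
    using subgroup.one_closed[OF submodule.axioms(1)[OF tensor_kernel_submodule]] by simp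
  \<comment> \<open>The coset is nonempty: this instance of the quantified equation forces
    uniqueness of the described value.\<close>
  ultimately have self: "f \<in> K +>\<^bsub>F\<^esub> f" unfolding a_r_coset_def' by blast
  show ?thesis
    unfolding tensor_lift_def lin_comb_def[symmetric]
  proof (rule the_equality)
    show "\<forall>f'\<in>K +>\<^bsub>F\<^esub> f. g f = g f'" using coset by simp
  qed (rule bspec[OF _ self])
qed

lemma tensor_lift_lin_hom: "tensor_lift R P \<phi> \<in> lin_hom R (M \<boxtimes> N) P"
proof -
  have g: "g \<in> lin_hom R F P"
    by (rule lin_comb_lin_hom[OF P]) (auto simp: bilinD(3)[OF \<phi>])
  note hom = lin_hom_add[OF tensor_coset_lin_hom, symmetric] lin_hom_smult[OF tensor_coset_lin_hom, symmetric]
  show ?thesis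
    by (rule lin_homI)
     (auto simp: tensor_carrier hom tensor_lift_coset lin_hom_closed[OF g] lin_hom_add[OF g] lin_hom_smult[OF g])
qed

lemma tensor_lift_pure:
  "\<lbrakk>m \<in> carrier M; n \<in> carrier N\<rbrakk> \<Longrightarrow> tensor_lift R P \<phi> (pure_tensor R M N m n) = \<phi> m n"
  by (simp add: pure_tensor_def tensor_lift_coset tensor_basis_closed lin_comb_free_basis[OF P] bilinD(3)[OF \<phi>])

lemma tensor_lift_closed: "t \<in> carrier (M \<boxtimes> N) \<Longrightarrow> tensor_lift R P \<phi> t \<in> carrier P"
  by (rule lin_hom_closed[OF tensor_lift_lin_hom])

end

text \<open>Scalar multiples need no case of their own, since a multiple of a pure tensor is pure;
  zero is covered as the pure tensor of two zeros.\<close>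

lemma tensor_induct [consumes 1, case_names pure add]:
  assumes t: "t \<in> carrier (M \<boxtimes> N)"
    and pure: "\<And>m n. \<lbrakk>m \<in> carrier M; n \<in> carrier N\<rbrakk> \<Longrightarrow> Q (pure_tensor R M N m n)"
    and add: "\<And>s t. \<lbrakk>s \<in> carrier (M \<boxtimes> N); t \<in> carrier (M \<boxtimes> N); Q s; Q t\<rbrakk> \<Longrightarrow> Q (s \<oplus>\<^bsub>M \<boxtimes> N\<^esub> t)"
  shows "Q t"
proof -
  interpret T: module R "M \<boxtimes> N" by (rule tensor_module_module)
  note hom = lin_hom_closed[OF tensor_coset_lin_hom] lin_hom_add[OF tensor_coset_lin_hom]
    lin_hom_smult[OF tensor_coset_lin_hom]
  note bil = bilinD[OF pure_tensor_bilin]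
  have "Q (K +>\<^bsub>F\<^esub> f)" if "f \<in> carrier F" for f
    using that
  proof (induction f rule: free_module_induct)
    case zero
    have "pure_tensor R M N \<zero>\<^bsub>M\<^esub> \<zero>\<^bsub>N\<^esub> = \<zero>\<^bsub>M \<boxtimes> N\<^esub>"
      using lin_hom_zero[OF M tensor_module_module bil(1)] by simp
    then show ?case
      using pure[of "\<zero>\<^bsub>M\<^esub>" "\<zero>\<^bsub>N\<^esub>"] lin_hom_zero[OF free_module_module tensor_module_module tensor_coset_lin_hom]
      by simp
  next
    case (add r q f)
    obtain m n where q: "q = (m, n)" "m \<in> carrier M" "n \<in> carrier N" using add by auto
    have "K +>\<^bsub>F\<^esub> (r \<odot>\<^bsub>F\<^esub> free_basis R q) = pure_tensor R M N (r \<odot>\<^bsub>M\<^esub> m) n"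
      using q add by (simp add: hom tensor_basis_closed lin_hom_smult[OF bil(1)]) (simp add: pure_tensor_def)
    then show ?case
      using q add by (simp add: hom tensor_basis_closed) (intro assms(3) pure hom; simp add: pure_tensor_closed)
  qed
  then show ?thesis using t by (auto simp: tensor_carrier)
qed

text \<open>Sums of pure tensors exhaust the tensor product. In identities with several tensors this
  is applied to one of them at a time, the others staying fixed.\<close>

lemma tensor_lin_eq:
  assumes "t \<in> carrier (M \<boxtimes> N)" "f \<in> lin_hom R (M \<boxtimes> N) P" "g \<in> lin_hom R (M \<boxtimes> N) P"
    and "\<And>m n. \<lbrakk>m \<in> carrier M; n \<in> carrier N\<rbrakk> \<Longrightarrow> f (pure_tensor R M N m n) = g (pure_tensor R M N m n)"
  shows "f t = g t"
  using assms(1) by (induction rule: tensor_induct) (simp_all add: assms(4) lin_hom_add[OF assms(2)] lin_hom_add[OF assms(3)])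

end

text \<open>Serves to rewrite under a Sweedler sum, where the bound elements are known only to lie
  in the carriers. Bilinearity of \<open>\<psi>\<close> is inherited from \<open>\<phi>\<close>
  through the agreement there.\<close>

lemma tensor_lift_cong:
  assumes "module R M" "module R N" "module R P"
    and "t \<in> carrier (M \<boxtimes> N)" "bilin M N P \<phi>"
    and "\<And>m n. \<lbrakk>m \<in> carrier M; n \<in> carrier N\<rbrakk> \<Longrightarrow> \<phi> m n = \<psi> m n"
  shows "tensor_lift R P \<phi> t = tensor_lift R P \<psi> t"
proof (rule tensor_lin_eq[OF assms(1,2,4)])
  have "bilin M N P \<psi>"
    using assms lin_hom_cong[OF bilinD(1)[OF assms(5)] assms(1)] lin_hom_cong[OF bilinD(2)[OF assms(5)] assms(2)]
    by (auto intro!: bilinI)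
  then show "tensor_lift R P \<psi> \<in> lin_hom R (M \<boxtimes> N) P"
    "\<lbrakk>m \<in> carrier M; n \<in> carrier N\<rbrakk> \<Longrightarrow> tensor_lift R P \<phi> (pure_tensor R M N m n) = tensor_lift R P \<psi> (pure_tensor R M N m n)" for m n
    using assms by (simp_all add: tensor_lift_lin_hom tensor_lift_pure)
  show "tensor_lift R P \<phi> \<in> lin_hom R (M \<boxtimes> N) P" using assms by (intro tensor_lift_lin_hom)
qed

section \<open>Linearity of composite expressions\<close>

lemma self_module_simps:
  "carrier scalars = carrier R" "add scalars = add R" "zero scalars = \<zero>" "smult scalars = mult R"
  by (simp_all add: self_module_def)

lemma self_module_module: "module R scalars"
  by (intro moduleI abelian_groupI is_cring)
    (auto simp: self_module_simps a_ac m_assoc l_distr r_distr intro: bexI[of _ "\<ominus> _"] l_neg)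

lemma lin_id: "(\<lambda>x. x) \<in> lin_hom R M M"
  by (simp add: lin_hom_def)

lemma lin_comp: "\<lbrakk>g \<in> lin_hom R N P; f \<in> lin_hom R M N\<rbrakk> \<Longrightarrow> (\<lambda>x. g (f x)) \<in> lin_hom R M P"
  by (rule lin_homI) (auto simp: lin_hom_closed[of f] lin_hom_closed[of g] lin_hom_add[of f] lin_hom_add[of g]
      lin_hom_smult[of f] lin_hom_smult[of g])

lemma lin_pure_left:
  assumes "f \<in> lin_hom R Q M" "module R M" "module R N" "n \<in> carrier N"
  shows "(\<lambda>x. pure_tensor R M N (f x) n) \<in> lin_hom R Q (M \<boxtimes> N)"
  using lin_comp[OF bilinD(1)[OF pure_tensor_bilin] assms(1)] assms by simp

lemma lin_pure_right:
  assumes "f \<in> lin_hom R Q N" "module R M" "module R N" "m \<in> carrier M"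
  shows "(\<lambda>x. pure_tensor R M N m (f x)) \<in> lin_hom R Q (M \<boxtimes> N)"
  using lin_comp[OF bilinD(2)[OF pure_tensor_bilin] assms(1)] assms by simp

lemma lin_smult_left:
  assumes "f \<in> lin_hom R Q scalars" "module R P" "p \<in> carrier P"
  shows "(\<lambda>x. f x \<odot>\<^bsub>P\<^esub> p) \<in> lin_hom R Q P"
proof -
  interpret P: module R P by fact
  have "(\<lambda>r. r \<odot>\<^bsub>P\<^esub> p) \<in> lin_hom R scalars P"
    using assms by (intro lin_homI) (auto simp: self_module_simps P.smult_l_distr P.smult_assoc1)
  from lin_comp[OF this assms(1)] show ?thesis .
qed

lemma lin_smult_right:
  assumes "f \<in> lin_hom R Q P" "module R P" "r \<in> carrier R"
  shows "(\<lambda>x. r \<odot>\<^bsub>P\<^esub> f x) \<in> lin_hom R Q P"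
proof -
  interpret P: module R P by fact
  have "(\<lambda>p. r \<odot>\<^bsub>P\<^esub> p) \<in> lin_hom R P P"
    using assms by (intro lin_homI) (auto simp: P.smult_r_distr P.smult_assoc1[symmetric] m_comm)
  from lin_comp[OF this assms(1)] show ?thesis .
qed

lemma lin_scalar_left:
  assumes "f \<in> lin_hom R Q scalars" "r \<in> carrier R"
  shows "(\<lambda>x. f x \<otimes> r) \<in> lin_hom R Q scalars"
  using lin_smult_left[OF assms(1) self_module_module] assms(2) by (simp add: self_module_simps)

lemma lin_scalar_right:
  assumes "f \<in> lin_hom R Q scalars" "r \<in> carrier R"
  shows "(\<lambda>x. r \<otimes> f x) \<in> lin_hom R Q scalars"
  using lin_smult_right[OF assms(1) self_module_module] assms(2) by (simp add: self_module_simps)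

lemma lin_mult_left:
  assumes "f \<in> lin_hom R Q B" "k_algebra R B" "b \<in> carrier B"
  shows "(\<lambda>x. f x \<otimes>\<^bsub>B\<^esub> b) \<in> lin_hom R Q B"
proof -
  interpret B: k_algebra R B by fact
  have "(\<lambda>x. x \<otimes>\<^bsub>B\<^esub> b) \<in> lin_hom R B B"
    using assms by (intro lin_homI) (auto simp: B.l_distr B.smult_mult_left)
  from lin_comp[OF this assms(1)] show ?thesis .
qed

lemma lin_mult_right:
  assumes "f \<in> lin_hom R Q B" "k_algebra R B" "b \<in> carrier B"
  shows "(\<lambda>x. b \<otimes>\<^bsub>B\<^esub> f x) \<in> lin_hom R Q B"
proof -
  interpret B: k_algebra R B by fact
  have "(\<lambda>x. b \<otimes>\<^bsub>B\<^esub> x) \<in> lin_hom R B B"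
    using assms by (intro lin_homI) (auto simp: B.r_distr B.smult_mult_right)
  from lin_comp[OF this assms(1)] show ?thesis .
qed

lemma lin_tensor_lift_arg:
  assumes "f \<in> lin_hom R Q (M \<boxtimes> N)" "module R M" "module R N" "module R P" "bilin M N P \<phi>"
  shows "(\<lambda>x. tensor_lift R P \<phi> (f x)) \<in> lin_hom R Q P"
  using lin_comp[OF tensor_lift_lin_hom assms(1)] assms by simp

lemma lin_add:
  assumes "f \<in> lin_hom R Q P" "g \<in> lin_hom R Q P" "module R P"
  shows "(\<lambda>x. f x \<oplus>\<^bsub>P\<^esub> g x) \<in> lin_hom R Q P"
proof -
  interpret P: module R P by fact
  show ?thesis
    by (rule lin_homI) (auto simp: lin_hom_add[OF assms(1)] lin_hom_add[OF assms(2)] P.a_ac P.smult_r_distr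
        lin_hom_smult[OF assms(1)] lin_hom_smult[OF assms(2)] lin_hom_closed[OF assms(1)] lin_hom_closed[OF assms(2)])
qed

text \<open>Here the tensor is fixed and the integrand varies linearly with \<open>x\<close>, as
  nested Sweedler sums require. By induction on the tensor: a pure one evaluates the integrand, and
  a sum adds two linear maps.\<close>

lemma lin_tensor_lift_fun:
  assumes "t \<in> carrier (M \<boxtimes> N)" "module R Q" "module R M" "module R N" "module R P"
    and \<phi>: "\<And>m n. \<lbrakk>m \<in> carrier M; n \<in> carrier N\<rbrakk> \<Longrightarrow> (\<lambda>x. \<phi> x m n) \<in> lin_hom R Q P"
    and bil: "\<And>x. x \<in> carrier Q \<Longrightarrow> bilin M N P (\<phi> x)"
  shows "(\<lambda>x. tensor_lift R P (\<phi> x) t) \<in> lin_hom R Q P"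
  using assms(1)
proof (induction t rule: tensor_induct[OF assms(3,4), consumes 1, case_names pure add])
  case (pure m n)
  then show ?case
    by (intro lin_hom_cong[OF \<phi> assms(2)]) (simp_all add: tensor_lift_pure bil assms)
next
  case (add s t)
  show ?case
    by (rule lin_hom_cong[OF lin_add[OF add(3,4)]])
     (use add assms in \<open>simp_all add: lin_hom_add[OF tensor_lift_lin_hom[OF _ _ _ bil]]\<close>)
qed

text \<open>Both sides are linear in \<open>t\<close> and agree on pure tensors; so linear maps pass
  inside Sweedler sums.\<close>

lemma lin_hom_tensor_lift:
  assumes "g \<in> lin_hom R P Q" "t \<in> carrier (M \<boxtimes> N)" "bilin M N P \<phi>"
    "module R M" "module R N" "module R P" "module R Q"
  shows "g (tensor_lift R P \<phi> t) = tensor_lift R Q (\<lambda>m n. g (\<phi> m n)) t"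
proof (rule tensor_lin_eq[OF assms(4,5,2)])
  have *: "bilin M N Q (\<lambda>m n. g (\<phi> m n))"
    by (intro bilinI lin_comp[OF assms(1)] bilinD[OF assms(3)])
  show "(\<lambda>t. g (tensor_lift R P \<phi> t)) \<in> lin_hom R (M \<boxtimes> N) Q"
    using assms by (intro lin_comp[OF assms(1)] tensor_lift_lin_hom)
  show "tensor_lift R Q (\<lambda>m n. g (\<phi> m n)) \<in> lin_hom R (M \<boxtimes> N) Q"
    using assms * by (intro tensor_lift_lin_hom)
  show "g (tensor_lift R P \<phi> (pure_tensor R M N m n)) = tensor_lift R Q (\<lambda>m n. g (\<phi> m n)) (pure_tensor R M N m n)"
    if "m \<in> carrier M" "n \<in> carrier N" for m n
    using assms * that by (simp add: tensor_lift_pure)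
qed

text \<open>Each rule peels one layer off an expression. Repeated resolution with them proves
  bilinearity of nested Sweedler sums by following the shape of the term.\<close>

lemmas lin_intros = bilinI lin_id lin_pure_left lin_pure_right lin_smult_left lin_smult_right
  lin_scalar_left lin_scalar_right lin_mult_left lin_mult_right lin_tensor_lift_arg lin_tensor_lift_fun

end

section \<open>Constructions that see only the module structure, and the opposite algebra\<close>

text \<open>Neither construction looks at multiplication or unit, so algebras that share their
  module structure, such as \<open>A\<close> and \<open>opposite A\<close> or the several records
  for the dual, have literally equal tensor products.\<close>

lemma tensor_cong:
  assumes "carrier M = carrier M'" "add M = add M'" "smult M = smult M'"
    and "carrier N = carrier N'" "add N = add N'" "smult N = smult N'"
  shows "tensor_module R M N = tensor_module R M' N'" "pure_tensor R M N = pure_tensor R M' N'"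
  using assms unfolding tensor_module_def pure_tensor_def tensor_kernel_def tensor_relations_def
  by simp_all

lemma lin_hom_cong_modules:
  assumes "carrier M = carrier M'" "add M = add M'" "smult M = smult M'"
    and "carrier N = carrier N'" "add N = add N'" "smult N = smult N'"
  shows "lin_hom R M N = lin_hom R M' N'"
  using assms unfolding lin_hom_def by simp

lemma opposite_simps [simp]:
  "carrier (opposite A) = carrier A" "add (opposite A) = add A" "zero (opposite A) = zero A"
  "one (opposite A) = one A" "smult (opposite A) = smult A"
  "x \<otimes>\<^bsub>opposite A\<^esub> y = y \<otimes>\<^bsub>A\<^esub> x"
  by (simp_all add: opposite_def)

lemma opposite_tensor [simp]:
  "tensor_module R M (opposite A) = tensor_module R M A"
  "pure_tensor R M (opposite A) = pure_tensor R M A"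
  "lin_hom R M (opposite A) = lin_hom R M A"
  by (rule tensor_cong lin_hom_cong_modules; simp)+

lemma opposite_tensor_lift [simp]: "tensor_lift R (opposite A) = tensor_lift R A"
  by (simp add: tensor_lift_def finsum_def fun_eq_iff)

context cring
begin

lemma lin_finsum:
  assumes "finite I" "\<And>i. i \<in> I \<Longrightarrow> (\<lambda>x. f i x) \<in> lin_hom R Q P" "module R Q" "module R P"
  shows "(\<lambda>x. \<Oplus>\<^bsub>P\<^esub>i\<in>I. f i x) \<in> lin_hom R Q P"
  using assms(1,2)
proof (induction I)
  interpret Q: module R Q by fact
  interpret P: module R P by fact
  case empty
  show ?case by (intro lin_homI) auto
next
  interpret P: module R P by fact
  case (insert i I)
  have f: "f j \<in> lin_hom R Q P" if "j \<in> insert i I" for j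
    using insert.prems[OF that] by simp
  have "(\<lambda>x. \<Oplus>\<^bsub>P\<^esub>i\<in>I. f i x) \<in> lin_hom R Q P"
    by (rule insert.IH) (simp add: f)
  from lin_add[OF f this assms(4)]
  have *: "(\<lambda>x. f i x \<oplus>\<^bsub>P\<^esub> (\<Oplus>\<^bsub>P\<^esub>i\<in>I. f i x)) \<in> lin_hom R Q P" by simp
  show ?case
  proof (rule lin_hom_cong[OF * assms(3)])
    fix x assume x: "x \<in> carrier Q"
    show "f i x \<oplus>\<^bsub>P\<^esub> (\<Oplus>\<^bsub>P\<^esub>i\<in>I. f i x) = (\<Oplus>\<^bsub>P\<^esub>i\<in>insert i I. f i x)"
      by (rule P.finsum_insert[symmetric]) (use insert.hyps lin_hom_closed[OF f x] in simp_all)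
  qed
qed

section \<open>Dual bases\<close>

text \<open>Coordinates for a finitely generated projective module: the \<open>e i\<close> generate,
  while \<open>c i (e j)\<close> may differ from the Kronecker delta.\<close>

definition dual_basis ::
    "('a, 'm, 'y) module_scheme \<Rightarrow> 'i set \<Rightarrow> ('i \<Rightarrow> 'm) \<Rightarrow> ('i \<Rightarrow> 'm \<Rightarrow> 'a) \<Rightarrow> bool"
  where "dual_basis M I e c \<longleftrightarrow> finite I \<and> (\<forall>i\<in>I. e i \<in> carrier M \<and> c i \<in> lin_hom R M scalars) \<and>
    (\<forall>x\<in>carrier M. (\<Oplus>\<^bsub>M\<^esub>i\<in>I. c i x \<odot>\<^bsub>M\<^esub> e i) = x)"

lemma dual_basisD:
  assumes "dual_basis M I e c"
  shows "finite I" "i \<in> I \<Longrightarrow> e i \<in> carrier M" "i \<in> I \<Longrightarrow> c i \<in> lin_hom R M scalars"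
    "x \<in> carrier M \<Longrightarrow> (\<Oplus>\<^bsub>M\<^esub>i\<in>I. c i x \<odot>\<^bsub>M\<^esub> e i) = x"
  using assms unfolding dual_basis_def by auto

text \<open>A finite generating set \<open>S\<close> gives a surjection from the free module on
  \<open>S\<close>. Projectivity splits it, and the coordinates of the splitting are the forms of
  the dual basis.\<close>

lemma finitely_generated_projective_dual_basis:
  fixes P :: "('a, 'p, 'y) module_scheme"
  assumes P: "module R P" and fg: "finitely_generated_module R P" and proj: "projective_module R P"
  shows "\<exists>(I :: 'p set) e c. dual_basis P I e c"
proof -
  interpret P: module R P by fact
  obtain S where S: "finite S" "S \<subseteq> carrier P" "submodule_span R P S = carrier P"
    using fg unfolding finitely_generated_module_def by auto
  let ?F = "free_module R S" and ?g = "lin_comb P (\<lambda>s. s)"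
  \<comment> \<open>\<open>projective_module\<close> quantifies over targets of the plain record
    type, so \<open>P\<close>, which may carry further fields, is replaced by its module
    reduct.\<close>
  define N :: "('a, 'p) module" where "N = module.truncate P"
  have N_simps: "carrier N = carrier P" "add N = add P" "smult N = smult P" "zero N = \<zero>\<^bsub>P\<^esub>"
    by (simp_all add: N_def module.truncate_def)
  have N: "module R N"
    by (intro moduleI abelian_groupI is_cring)
      (auto simp: N_simps P.a_ac P.smult_l_distr P.smult_r_distr P.smult_assoc1
        intro: bexI[of _ "\<ominus>\<^bsub>P\<^esub> _"] P.l_neg)
  interpret F: module R ?F by (rule free_module_module)
  have g: "?g \<in> lin_hom R ?F P" using S by (intro lin_comb_lin_hom P) auto
  \<comment> \<open>The image is a submodule containing \<open>S\<close>, hence contains its span: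
    this gives surjectivity.\<close>
  have "submodule (?g ` carrier ?F) R P"
  proof (rule P.submoduleI)
    show "\<zero>\<^bsub>P\<^esub> \<in> ?g ` carrier ?F"
      using lin_hom_zero[OF free_module_module P g] F.zero_closed by (metis imageI)
    fix x y assume x: "x \<in> ?g ` carrier ?F" and y: "y \<in> ?g ` carrier ?F"
    obtain u v where u: "u \<in> carrier ?F" "x = ?g u" and v: "v \<in> carrier ?F" "y = ?g v"
      using x y by auto
    show "x \<oplus>\<^bsub>P\<^esub> y \<in> ?g ` carrier ?F"
      using lin_hom_add[OF g u(1) v(1)] u v by (metis F.a_closed imageI)
    have "\<ominus>\<^bsub>P\<^esub> x = ?g (\<ominus>\<^bsub>?F\<^esub> u)"
      using u lin_hom_uminus[OF free_module_module P g] by simp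
    then show "\<ominus>\<^bsub>P\<^esub> x \<in> ?g ` carrier ?F" using u(1) by (metis F.a_inv_closed imageI)
  next
    fix r x assume r: "r \<in> carrier R" "x \<in> ?g ` carrier ?F"
    then obtain u where "u \<in> carrier ?F" "x = ?g u" by auto
    then show "r \<odot>\<^bsub>P\<^esub> x \<in> ?g ` carrier ?F"
      using lin_hom_smult[OF g r(1)] r by (metis F.smult_closed imageI)
  qed (use lin_hom_closed[OF g] in auto)
  moreover have "S \<subseteq> ?g ` carrier ?F"
  proof
    fix s assume s: "s \<in> S"
    then have "?g (free_basis R s) = s" using S by (intro lin_comb_free_basis P) auto
    then show "s \<in> ?g ` carrier ?F" using free_basis_closed[OF s] by (metis imageI)
  qed
  ultimately have "carrier P \<subseteq> ?g ` carrier ?F" using submodule_span_least S(3) by metis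
  then have surj: "?g ` carrier ?F = carrier N" using lin_hom_closed[OF g] by (auto simp: N_simps)
  \<comment> \<open>The map to be lifted is the identity, read as a map from \<open>P\<close> to its
    reduct.\<close>
  have id: "(\<lambda>x. x) \<in> lin_hom R P N" and gN: "?g \<in> lin_hom R ?F N"
    using lin_id[of P] g unfolding lin_hom_def N_simps by blast+
  obtain h where h: "h \<in> lin_hom R P ?F" "\<And>x. x \<in> carrier P \<Longrightarrow> ?g (h x) = x"
    using proj[unfolded projective_module_def, rule_format, OF conjI[OF free_module_module conjI[OF N conjI[OF gN conjI[OF surj id]]]]]
    by blast
  have "dual_basis P S (\<lambda>s. s) (\<lambda>s x. h x s)"
    unfolding dual_basis_def
  proof (intro conjI ballI)
    fix s assume "s \<in> S"
    then show "s \<in> carrier P" using S by auto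
    show "(\<lambda>x. h x s) \<in> lin_hom R P scalars"
      using lin_hom_closed[OF h(1)] lin_hom_add[OF h(1)] lin_hom_smult[OF h(1)]
      by (intro lin_homI) (auto simp: free_module_simps self_module_simps)
  next
    fix x assume x: "x \<in> carrier P"
    have "?g (h x) = (\<Oplus>\<^bsub>P\<^esub>s\<in>S. h x s \<odot>\<^bsub>P\<^esub> s)"
      using S lin_hom_closed[OF h(1) x]
      by (intro lin_comb_superset[OF P, of _ S]) (auto simp: free_module_simps)
    then show "(\<Oplus>\<^bsub>P\<^esub>s\<in>S. h x s \<odot>\<^bsub>P\<^esub> s) = x" using h(2)[OF x] by simp
  qed (rule S)
  then show ?thesis by blast
qed

section \<open>Contraction of one tensor factor with a linear form\<close>

text \<open>The map id \<otimes> f, followed by the identification of M \<otimes> k with M. Applied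
  to \<open>\<rho> a\<close> it is the action of the form on \<open>a\<close>.\<close>

definition contract_right :: "('a, 'm, 'y) module_scheme \<Rightarrow> ('n \<Rightarrow> 'a) \<Rightarrow> ('m \<times> 'n \<Rightarrow> 'a) set \<Rightarrow> 'm"
  where "contract_right M f = tensor_lift R M (\<lambda>m n. f n \<odot>\<^bsub>M\<^esub> m)"

definition contract_left :: "('a, 'n, 'y) module_scheme \<Rightarrow> ('m \<Rightarrow> 'a) \<Rightarrow> ('m \<times> 'n \<Rightarrow> 'a) set \<Rightarrow> 'n"
  where "contract_left N f = tensor_lift R N (\<lambda>m n. f m \<odot>\<^bsub>N\<^esub> n)"

context
  fixes M :: "('a, 'm, 'y) module_scheme" and N :: "('a, 'n, 'z) module_scheme"
  assumes M: "module R M" and N: "module R N"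
begin

interpretation M: module R M by (rule M)
interpretation N: module R N by (rule N)

lemma contract_right_bilin: "f \<in> lin_hom R N scalars \<Longrightarrow> bilin M N M (\<lambda>m n. f n \<odot>\<^bsub>M\<^esub> m)"
  using lin_hom_closed[of f R N scalars]
  by (intro bilinI lin_smult_left lin_smult_right lin_id M) (auto simp: self_module_simps)

lemma contract_left_bilin: "f \<in> lin_hom R M scalars \<Longrightarrow> bilin M N N (\<lambda>m n. f m \<odot>\<^bsub>N\<^esub> n)"
  using lin_hom_closed[of f R M scalars]
  by (intro bilinI lin_smult_left lin_smult_right lin_id N) (auto simp: self_module_simps)

lemma contract_right_lin_hom: "f \<in> lin_hom R N scalars \<Longrightarrow> contract_right M f \<in> lin_hom R (M \<boxtimes> N) M"
  unfolding contract_right_def by (intro tensor_lift_lin_hom M N contract_right_bilin)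

lemma contract_left_lin_hom: "f \<in> lin_hom R M scalars \<Longrightarrow> contract_left N f \<in> lin_hom R (M \<boxtimes> N) N"
  unfolding contract_left_def by (intro tensor_lift_lin_hom M N contract_left_bilin)

lemma contract_right_pure:
  "\<lbrakk>f \<in> lin_hom R N scalars; m \<in> carrier M; n \<in> carrier N\<rbrakk> \<Longrightarrow>
     contract_right M f (pure_tensor R M N m n) = f n \<odot>\<^bsub>M\<^esub> m"
  unfolding contract_right_def by (subst tensor_lift_pure[OF M N M contract_right_bilin]) auto

lemma contract_left_pure:
  "\<lbrakk>f \<in> lin_hom R M scalars; m \<in> carrier M; n \<in> carrier N\<rbrakk> \<Longrightarrow>
     contract_left N f (pure_tensor R M N m n) = f m \<odot>\<^bsub>N\<^esub> n"
  unfolding contract_left_def by (subst tensor_lift_pure[OF M N N contract_left_bilin]) auto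

text \<open>On a pure tensor the scalar \<open>c i n\<close> moves across to the second factor,
  where the dual basis sums up to \<open>n\<close> again.\<close>

lemma contract_right_expand:
  assumes N_basis: "dual_basis N I e c" and t: "t \<in> carrier (M \<boxtimes> N)"
  shows "(\<Oplus>\<^bsub>M \<boxtimes> N\<^esub>i\<in>I. pure_tensor R M N (contract_right M (c i) t) (e i)) = t"
proof (rule tensor_lin_eq[OF M N t])
  note basis = dual_basisD[OF N_basis]
  note T = tensor_module_module[OF M N]
  show "(\<lambda>t. \<Oplus>\<^bsub>M \<boxtimes> N\<^esub>i\<in>I. pure_tensor R M N (contract_right M (c i) t) (e i)) \<in> lin_hom R (M \<boxtimes> N) (M \<boxtimes> N)"
    by (intro lin_finsum T lin_pure_left contract_right_lin_hom M N basis)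
  fix m n assume m: "m \<in> carrier M" and n: "n \<in> carrier N"
  note bil = bilinD[OF pure_tensor_bilin[OF M N]]
  have cn: "c i n \<in> carrier R" if "i \<in> I" for i
    using lin_hom_closed[OF basis(3)] n that by (simp add: self_module_simps)
  have "(\<Oplus>\<^bsub>M \<boxtimes> N\<^esub>i\<in>I. pure_tensor R M N (contract_right M (c i) (pure_tensor R M N m n)) (e i)) =
      (\<Oplus>\<^bsub>M \<boxtimes> N\<^esub>i\<in>I. pure_tensor R M N m (c i n \<odot>\<^bsub>N\<^esub> e i))"
  proof -
    interpret T: module R "M \<boxtimes> N" by (rule T)
    show ?thesis
      by (rule T.finsum_cong')
       (use m n cn in \<open>auto simp: contract_right_pure basis bil(3) lin_hom_smult[OF bil(1)] lin_hom_smult[OF bil(2)]\<close>)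
  qed
  also have "\<dots> = pure_tensor R M N m (\<Oplus>\<^bsub>N\<^esub>i\<in>I. c i n \<odot>\<^bsub>N\<^esub> e i)"
    using lin_hom_finsum[OF N T bil(2)[OF m] basis(1)] basis cn by simp
  finally show "(\<Oplus>\<^bsub>M \<boxtimes> N\<^esub>i\<in>I. pure_tensor R M N (contract_right M (c i) (pure_tensor R M N m n)) (e i)) =
      pure_tensor R M N m n"
    using basis n by simp
qed (rule lin_id)

lemma contract_left_expand:
  assumes M_basis: "dual_basis M I e c" and t: "t \<in> carrier (M \<boxtimes> N)"
  shows "(\<Oplus>\<^bsub>M \<boxtimes> N\<^esub>i\<in>I. pure_tensor R M N (e i) (contract_left N (c i) t)) = t"
proof (rule tensor_lin_eq[OF M N t])
  note basis = dual_basisD[OF M_basis]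
  note T = tensor_module_module[OF M N]
  show "(\<lambda>t. \<Oplus>\<^bsub>M \<boxtimes> N\<^esub>i\<in>I. pure_tensor R M N (e i) (contract_left N (c i) t)) \<in> lin_hom R (M \<boxtimes> N) (M \<boxtimes> N)"
    by (intro lin_finsum T lin_pure_right contract_left_lin_hom M N basis)
  fix m n assume m: "m \<in> carrier M" and n: "n \<in> carrier N"
  note bil = bilinD[OF pure_tensor_bilin[OF M N]]
  have cm: "c i m \<in> carrier R" if "i \<in> I" for i
    using lin_hom_closed[OF basis(3)] m that by (simp add: self_module_simps)
  have "(\<Oplus>\<^bsub>M \<boxtimes> N\<^esub>i\<in>I. pure_tensor R M N (e i) (contract_left N (c i) (pure_tensor R M N m n))) =
      (\<Oplus>\<^bsub>M \<boxtimes> N\<^esub>i\<in>I. pure_tensor R M N (c i m \<odot>\<^bsub>M\<^esub> e i) n)"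
  proof -
    interpret T: module R "M \<boxtimes> N" by (rule T)
    show ?thesis
      by (rule T.finsum_cong')
       (use m n cm in \<open>auto simp: contract_left_pure basis bil(3) lin_hom_smult[OF bil(1)] lin_hom_smult[OF bil(2)]\<close>)
  qed
  also have "\<dots> = pure_tensor R M N (\<Oplus>\<^bsub>M\<^esub>i\<in>I. c i m \<odot>\<^bsub>M\<^esub> e i) n"
    using lin_hom_finsum[OF M T bil(1)[OF n] basis(1)] basis cm by simp
  finally show "(\<Oplus>\<^bsub>M \<boxtimes> N\<^esub>i\<in>I. pure_tensor R M N (e i) (contract_left N (c i) (pure_tensor R M N m n))) =
      pure_tensor R M N m n"
    using basis m by simp
qed (rule lin_id)

text \<open>Extensional forms are the test objects because they make up the carrier of the dual.
  Each \<open>c i\<close> may take any value off the carrier, so it is first restricted, which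
  leaves its contractions unchanged.\<close>

lemma contract_right_eqI:
  assumes "dual_basis N I e c" "s \<in> carrier (M \<boxtimes> N)" "t \<in> carrier (M \<boxtimes> N)"
    and "\<And>f. f \<in> lin_hom R N scalars \<inter> extensional (carrier N) \<Longrightarrow> contract_right M f s = contract_right M f t"
  shows "s = t"
proof -
  have "contract_right M (c i) s = contract_right M (c i) t" if "i \<in> I" for i
  proof -
    note ci = dual_basisD(3)[OF assms(1) that]
    have *: "restrict (c i) (carrier N) \<in> lin_hom R N scalars"
      by (rule lin_hom_cong[OF ci N]) simp
    have "contract_right M (restrict (c i) (carrier N)) u = contract_right M (c i) u"
      if "u \<in> carrier (M \<boxtimes> N)" for u
      unfolding contract_right_def
      by (rule tensor_lift_cong[OF M N M that contract_right_bilin[OF *]]) simp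
    from this[OF assms(2)] this[OF assms(3)] show ?thesis
      using assms(4)[of "restrict (c i) (carrier N)"] * by simp
  qed
  then have "(\<Oplus>\<^bsub>M \<boxtimes> N\<^esub>i\<in>I. pure_tensor R M N (contract_right M (c i) s) (e i)) =
      (\<Oplus>\<^bsub>M \<boxtimes> N\<^esub>i\<in>I. pure_tensor R M N (contract_right M (c i) t) (e i))"
  proof -
    interpret T: module R "M \<boxtimes> N" by (rule tensor_module_module[OF M N])
    note basis = dual_basisD[OF assms(1)]
    assume *: "\<And>i. i \<in> I \<Longrightarrow> contract_right M (c i) s = contract_right M (c i) t"
    show ?thesis
      by (rule T.finsum_cong')
        (use assms * in \<open>auto intro!: pure_tensor_closed M N lin_hom_closed[OF contract_right_lin_hom] basis\<close>)
  qed
  then show ?thesis using contract_right_expand[OF assms(1)] assms by simp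
qed

text \<open>Here the coordinate forms themselves are the test objects: the lemma is meant for the
  dual basis of \<open>H\<^sup>*\<close>, whose forms are the evaluations at the
  \<open>e i\<close>.\<close>

lemma contract_left_eqI:
  assumes "dual_basis M I e c" "s \<in> carrier (M \<boxtimes> N)" "t \<in> carrier (M \<boxtimes> N)"
    and *: "\<And>i. i \<in> I \<Longrightarrow> contract_left N (c i) s = contract_left N (c i) t"
  shows "s = t"
proof -
  interpret T: module R "M \<boxtimes> N" by (rule tensor_module_module[OF M N])
  note basis = dual_basisD[OF assms(1)]
  have "(\<Oplus>\<^bsub>M \<boxtimes> N\<^esub>i\<in>I. pure_tensor R M N (e i) (contract_left N (c i) s)) =
      (\<Oplus>\<^bsub>M \<boxtimes> N\<^esub>i\<in>I. pure_tensor R M N (e i) (contract_left N (c i) t))"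
    by (rule T.finsum_cong')
      (use assms * in \<open>auto intro!: pure_tensor_closed M N lin_hom_closed[OF contract_left_lin_hom] basis\<close>)
  then show ?thesis using contract_left_expand[OF assms(1)] assms by simp
qed

end

section \<open>Products of algebras\<close>

lemma k_algebra_module: "k_algebra R A \<Longrightarrow> module R A"
  by (simp add: k_algebra_def)

lemma k_algebraI:
  assumes "module R A" "monoid A"
    and "\<And>x y z. \<lbrakk>x \<in> carrier A; y \<in> carrier A; z \<in> carrier A\<rbrakk> \<Longrightarrow> (x \<oplus>\<^bsub>A\<^esub> y) \<otimes>\<^bsub>A\<^esub> z = x \<otimes>\<^bsub>A\<^esub> z \<oplus>\<^bsub>A\<^esub> y \<otimes>\<^bsub>A\<^esub> z"
    and "\<And>x y z. \<lbrakk>x \<in> carrier A; y \<in> carrier A; z \<in> carrier A\<rbrakk> \<Longrightarrow> z \<otimes>\<^bsub>A\<^esub> (x \<oplus>\<^bsub>A\<^esub> y) = z \<otimes>\<^bsub>A\<^esub> x \<oplus>\<^bsub>A\<^esub> z \<otimes>\<^bsub>A\<^esub> y"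
    and "\<And>r x y. \<lbrakk>r \<in> carrier R; x \<in> carrier A; y \<in> carrier A\<rbrakk> \<Longrightarrow> (r \<odot>\<^bsub>A\<^esub> x) \<otimes>\<^bsub>A\<^esub> y = r \<odot>\<^bsub>A\<^esub> (x \<otimes>\<^bsub>A\<^esub> y)"
    and "\<And>r x y. \<lbrakk>r \<in> carrier R; x \<in> carrier A; y \<in> carrier A\<rbrakk> \<Longrightarrow> x \<otimes>\<^bsub>A\<^esub> (r \<odot>\<^bsub>A\<^esub> y) = r \<odot>\<^bsub>A\<^esub> (x \<otimes>\<^bsub>A\<^esub> y)"
  shows "k_algebra R A"
proof -
  interpret A: module R A by fact
  show ?thesis
    by (intro k_algebra.intro k_algebra_axioms.intro ringI A.abelian_group_axioms) (use assms in auto)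
qed

lemma opposite_k_algebra:
  assumes "k_algebra R A"
  shows "k_algebra R (opposite A)"
proof -
  interpret A: k_algebra R A by fact
  show ?thesis
    by (intro k_algebraI moduleI abelian_groupI monoidI is_cring)
      (auto simp: A.a_ac A.smult_l_distr A.smult_r_distr A.smult_assoc1 A.m_assoc A.l_distr A.r_distr
        A.smult_mult_left A.smult_mult_right intro: bexI[of _ "\<ominus>\<^bsub>A\<^esub> _"] A.l_neg)
qed

lemma tensor_algebra_one: "\<one>\<^bsub>tensor_algebra R A B\<^esub> = pure_tensor R A B \<one>\<^bsub>A\<^esub> \<one>\<^bsub>B\<^esub>"
  by (simp add: tensor_algebra_def)

context
  fixes A :: "('a, 'm, 'y) module_scheme" and B :: "('a, 'n, 'z) module_scheme"
  assumes A: "k_algebra R A" and B: "k_algebra R B"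
begin

interpretation A: k_algebra R A by (rule A)
interpretation B: k_algebra R B by (rule B)

private lemmas intros = lin_intros k_algebra_module[OF A] k_algebra_module[OF B] A B
  tensor_module_module A.m_closed B.m_closed

lemma tensor_algebra_bilin: "bilin (A \<boxtimes> B) (A \<boxtimes> B) (A \<boxtimes> B) (mult (tensor_algebra R A B))"
  unfolding tensor_algebra_def monoid.simps partial_object.simps
  by simp ((rule intros | assumption)+)

lemma tensor_algebra_pure:
  assumes "a \<in> carrier A" "b \<in> carrier B" "c \<in> carrier A" "d \<in> carrier B"
  shows "pure_tensor R A B a b \<otimes>\<^bsub>tensor_algebra R A B\<^esub> pure_tensor R A B c d =
    pure_tensor R A B (a \<otimes>\<^bsub>A\<^esub> c) (b \<otimes>\<^bsub>B\<^esub> d)"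
proof -
  note mods = k_algebra_module[OF A] k_algebra_module[OF B]
  note T = tensor_module_module[OF mods]
  have "bilin A B (A \<boxtimes> B) (\<lambda>c d. pure_tensor R A B (a \<otimes>\<^bsub>A\<^esub> c) (b \<otimes>\<^bsub>B\<^esub> d))" if "a \<in> carrier A" "b \<in> carrier B" for a b
    using that by - ((rule intros | assumption)+)
  moreover have "bilin A B (A \<boxtimes> B) (\<lambda>a b. tensor_lift R (A \<boxtimes> B)
      (\<lambda>c d. pure_tensor R A B (a \<otimes>\<^bsub>A\<^esub> c) (b \<otimes>\<^bsub>B\<^esub> d)) (pure_tensor R A B c d))"
    using assms by - ((rule intros pure_tensor_closed | assumption)+)
  ultimately show ?thesis using assms
    by (simp add: tensor_algebra_def tensor_lift_pure[OF mods T])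
qed

end

section \<open>Pairing tensors with two or three forms\<close>

text \<open>The form f \<otimes> g with values multiplied in the base ring. On
  \<open>comult H h\<close> it is the convolution product at \<open>h\<close>; with evaluations as
  forms it reads off a tensor of forms at two points.\<close>

definition pair :: "('m \<Rightarrow> 'a) \<Rightarrow> ('n \<Rightarrow> 'a) \<Rightarrow> ('m \<times> 'n \<Rightarrow> 'a) set \<Rightarrow> 'a"
  where "pair f g = tensor_lift R scalars (\<lambda>m n. f m \<otimes> g n)"

lemma scalar_form_closed: "\<lbrakk>f \<in> lin_hom R M scalars; m \<in> carrier M\<rbrakk> \<Longrightarrow> f m \<in> carrier R"
  using lin_hom_closed[of f R M scalars] by (simp add: self_module_simps)

lemma tensor_lift_scalar_closed:
  "\<lbrakk>t \<in> carrier (M \<boxtimes> N); module R M; module R N; bilin M N scalars \<phi>\<rbrakk> \<Longrightarrow>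
     tensor_lift R scalars \<phi> t \<in> carrier R"
  using tensor_lift_closed[of M N scalars \<phi> t] self_module_module by (simp add: self_module_simps)

lemma pair_bilin:
  assumes "f \<in> lin_hom R M scalars" "g \<in> lin_hom R N scalars"
  shows "bilin M N scalars (\<lambda>m n. f m \<otimes> g n)"
  using assms by - (rule lin_intros scalar_form_closed | assumption)+

lemma pair_lin_hom:
  assumes "module R M" "module R N" "f \<in> lin_hom R M scalars" "g \<in> lin_hom R N scalars"
  shows "pair f g \<in> lin_hom R (M \<boxtimes> N) scalars"
  unfolding pair_def using assms by (intro tensor_lift_lin_hom self_module_module pair_bilin)

lemma pair_pure:
  assumes "module R M" "module R N" "f \<in> lin_hom R M scalars" "g \<in> lin_hom R N scalars"
    and "m \<in> carrier M" "n \<in> carrier N"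
  shows "pair f g (pure_tensor R M N m n) = f m \<otimes> g n"
  unfolding pair_def using assms by (intro tensor_lift_pure self_module_module pair_bilin)

lemma pair_closed:
  assumes "t \<in> carrier (M \<boxtimes> N)" "module R M" "module R N" "f \<in> lin_hom R M scalars" "g \<in> lin_hom R N scalars"
  shows "pair f g t \<in> carrier R"
  using scalar_form_closed[OF pair_lin_hom assms(1)] assms by blast

lemma pair_cong:
  assumes "module R M" "module R N" "t \<in> carrier (M \<boxtimes> N)"
    and "f \<in> lin_hom R M scalars" "g \<in> lin_hom R N scalars"
    and "\<And>m. m \<in> carrier M \<Longrightarrow> f m = f' m" "\<And>n. n \<in> carrier N \<Longrightarrow> g n = g' n"
  shows "pair f g t = pair f' g' t"
  unfolding pair_def
  by (rule tensor_lift_cong[OF assms(1,2) self_module_module assms(3)]) (use assms in \<open>simp_all add: pair_bilin\<close>)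

lemma lin_pair:
  assumes "E \<in> lin_hom R Q (M \<boxtimes> N)" "module R M" "module R N" "f \<in> lin_hom R M scalars" "g \<in> lin_hom R N scalars"
  shows "(\<lambda>x. pair f g (E x)) \<in> lin_hom R Q scalars"
  using lin_comp[OF pair_lin_hom assms(1)] assms by simp

text \<open>A second form applied to a contraction leaves a pairing. With evaluations as second
  forms, contractions of tensors over the dual are thus compared pointwise.\<close>

lemma contract_left_apply:
  assumes "module R M" "module R N" "f \<in> lin_hom R M scalars" "p \<in> lin_hom R N scalars"
    and "t \<in> carrier (M \<boxtimes> N)"
  shows "p (contract_left N f t) = pair f p t"
proof (rule tensor_lin_eq[OF assms(1,2,5)])
  show "(\<lambda>t. p (contract_left N f t)) \<in> lin_hom R (M \<boxtimes> N) scalars"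
    by (rule lin_comp[OF assms(4) contract_left_lin_hom[OF assms(1-3)]])
  show "pair f p \<in> lin_hom R (M \<boxtimes> N) scalars" by (rule pair_lin_hom[OF assms(1-4)])
  show "p (contract_left N f (pure_tensor R M N m n)) = pair f p (pure_tensor R M N m n)"
    if "m \<in> carrier M" "n \<in> carrier N" for m n
    using that assms scalar_form_closed[of f M m]
    by (simp add: contract_left_pure pair_pure lin_hom_smult[OF assms(4)] self_module_simps)
qed

lemma contract_right_apply:
  assumes "module R M" "module R N" "f \<in> lin_hom R N scalars" "p \<in> lin_hom R M scalars"
    and "t \<in> carrier (M \<boxtimes> N)"
  shows "p (contract_right M f t) = pair p f t"
proof (rule tensor_lin_eq[OF assms(1,2,5)])
  show "(\<lambda>t. p (contract_right M f t)) \<in> lin_hom R (M \<boxtimes> N) scalars"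
    by (rule lin_comp[OF assms(4) contract_right_lin_hom[OF assms(1-3)]])
  show "pair p f \<in> lin_hom R (M \<boxtimes> N) scalars" by (rule pair_lin_hom) (use assms in auto)
  show "p (contract_right M f (pure_tensor R M N m n)) = pair p f (pure_tensor R M N m n)"
    if "m \<in> carrier M" "n \<in> carrier N" for m n
    using that assms scalar_form_closed[of f N n] scalar_form_closed[of p M m]
    by (simp add: contract_right_pure pair_pure lin_hom_smult[OF assms(4)] self_module_simps m_comm)
qed

lemma flip_bilin: "\<lbrakk>module R M; module R N\<rbrakk> \<Longrightarrow> bilin M N (N \<boxtimes> M) (\<lambda>x y. pure_tensor R N M y x)"
  by - (rule lin_intros | assumption)+

text \<open>Through this the opposite comultiplication swaps the two points of evaluation.\<close>

lemma pair_flip: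
  assumes "module R M" "module R N" "f \<in> lin_hom R N scalars" "g \<in> lin_hom R M scalars"
    and "t \<in> carrier (M \<boxtimes> N)"
  shows "pair f g (tensor_lift R (N \<boxtimes> M) (\<lambda>x y. pure_tensor R N M y x) t) = pair g f t"
proof (rule tensor_lin_eq[OF assms(1,2,5)])
  note T = tensor_module_module[OF assms(2,1)]
  note flip = flip_bilin[OF assms(1,2)]
  show "(\<lambda>t. pair f g (tensor_lift R (N \<boxtimes> M) (\<lambda>x y. pure_tensor R N M y x) t)) \<in> lin_hom R (M \<boxtimes> N) scalars"
    by (rule lin_pair[OF tensor_lift_lin_hom[OF assms(1,2) T flip] assms(2,1,3,4)])
  show "pair g f \<in> lin_hom R (M \<boxtimes> N) scalars" by (rule pair_lin_hom) (use assms in auto)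
  show "pair f g (tensor_lift R (N \<boxtimes> M) (\<lambda>x y. pure_tensor R N M y x) (pure_tensor R M N m n)) =
      pair g f (pure_tensor R M N m n)" if "m \<in> carrier M" "n \<in> carrier N" for m n
    using that assms scalar_form_closed[of f N n] scalar_form_closed[of g M m]
    by (simp add: tensor_lift_pure[OF assms(1,2) T flip] pair_pure m_comm)
qed

text \<open>\<open>D\<close> is left general because coassociativity is used twice: as an axiom for
  \<open>comult H\<close> and as a goal for the comultiplication of the dual.\<close>

lemma coassoc_left_bilin:
  assumes M: "module R M" and D: "D \<in> lin_hom R M (M \<boxtimes> M)"
  shows "bilin M M (M \<boxtimes> (M \<boxtimes> M))
    (\<lambda>x z. tensor_lift R (M \<boxtimes> (M \<boxtimes> M)) (\<lambda>x1 x2. pure_tensor R M (M \<boxtimes> M) x1 (pure_tensor R M M x2 z)) (D x))"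
  using M by - (rule lin_intros tensor_module_module pure_tensor_closed D lin_hom_closed[OF D] | assumption)+

lemma coassoc_right_bilin:
  assumes M: "module R M" and D: "D \<in> lin_hom R M (M \<boxtimes> M)"
  shows "bilin M M (M \<boxtimes> (M \<boxtimes> M)) (\<lambda>x z. pure_tensor R M (M \<boxtimes> M) x (D z))"
  using M by - (rule lin_intros tensor_module_module D lin_hom_closed[OF D] | assumption)+

context
  fixes M :: "('a, 'm, 'y) module_scheme" and D f g k
  assumes M: "module R M" and D: "D \<in> lin_hom R M (M \<boxtimes> M)"
    and f: "f \<in> lin_hom R M scalars" and g: "g \<in> lin_hom R M scalars" and k: "k \<in> lin_hom R M scalars"
begin

private lemmas T = tensor_module_module[OF M M] tensor_module_module[OF M tensor_module_module[OF M M]]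
private lemmas gk = pair_lin_hom[OF M M g k]
private lemmas fgk = pair_lin_hom[OF M T(1) f gk]
private lemmas closed = scalar_form_closed[OF f] scalar_form_closed[OF g] scalar_form_closed[OF k]
  lin_hom_closed[OF D]

text \<open>With convolution along \<open>D\<close> as product of forms, the value is that of (f g)
  k, and the lemma after it yields f (g k). Read on \<open>H\<close>, coassociativity makes the dual
  associative; read on the dual, associativity of \<open>H\<close> makes it coassociative.\<close>

lemma pair_coassoc_left:
  assumes t: "t \<in> carrier (M \<boxtimes> M)"
  shows "pair f (pair g k) (tensor_lift R (M \<boxtimes> (M \<boxtimes> M))
      (\<lambda>x z. tensor_lift R (M \<boxtimes> (M \<boxtimes> M)) (\<lambda>x1 x2. pure_tensor R M (M \<boxtimes> M) x1 (pure_tensor R M M x2 z)) (D x)) t) =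
    pair (\<lambda>x. pair f g (D x)) k t"
proof -
  have inner: "bilin M M (M \<boxtimes> (M \<boxtimes> M)) (\<lambda>x1 x2. pure_tensor R M (M \<boxtimes> M) x1 (pure_tensor R M M x2 z))"
    if "z \<in> carrier M" for z
    using that T M by - (rule lin_intros pure_tensor_closed | assumption)+
  note outer = coassoc_left_bilin[OF M D]
  \<comment> \<open>The tensor \<open>D x\<close> of the inner sum is replaced by an arbitrary
    \<open>u\<close>, which may then be taken pure.\<close>
  have *: "pair f (pair g k) (tensor_lift R (M \<boxtimes> (M \<boxtimes> M))
      (\<lambda>x1 x2. pure_tensor R M (M \<boxtimes> M) x1 (pure_tensor R M M x2 z)) u) = pair f g u \<otimes> k z"
    if u: "u \<in> carrier (M \<boxtimes> M)" and z: "z \<in> carrier M" for u z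
  proof (rule tensor_lin_eq[OF M M u])
    show "(\<lambda>u. pair f (pair g k) (tensor_lift R (M \<boxtimes> (M \<boxtimes> M))
      (\<lambda>x1 x2. pure_tensor R M (M \<boxtimes> M) x1 (pure_tensor R M M x2 z)) u)) \<in> lin_hom R (M \<boxtimes> M) scalars"
      by (intro lin_comp[OF fgk] tensor_lift_lin_hom M T inner z)
    show "(\<lambda>u. pair f g u \<otimes> k z) \<in> lin_hom R (M \<boxtimes> M) scalars"
      by (intro lin_scalar_left pair_lin_hom M f g closed z)
  qed (simp add: tensor_lift_pure[OF M M T(2) inner] z pair_pure[OF M T(1) f gk] pair_pure[OF M M f g] pair_pure[OF M M g k]
      pure_tensor_closed[OF M M] closed m_assoc)
  show ?thesis
    unfolding lin_hom_tensor_lift[OF fgk t outer M M T(2) self_module_module]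
    by (subst (3) pair_def, rule tensor_lift_cong[OF M M self_module_module t bilinI])
     (auto simp: * closed intro!: lin_comp[OF fgk] bilinD[OF outer])
qed

lemma pair_coassoc_right:
  assumes t: "t \<in> carrier (M \<boxtimes> M)"
  shows "pair f (pair g k) (tensor_lift R (M \<boxtimes> (M \<boxtimes> M)) (\<lambda>x z. pure_tensor R M (M \<boxtimes> M) x (D z)) t) =
    pair f (\<lambda>z. pair g k (D z)) t"
proof -
  note outer = coassoc_right_bilin[OF M D]
  show ?thesis
    unfolding lin_hom_tensor_lift[OF fgk t outer M M T(2) self_module_module]
    by (subst (3) pair_def, rule tensor_lift_cong[OF M M self_module_module t bilinI])
     (auto simp: pair_pure[OF M T(1) f gk] closed intro!: lin_comp[OF fgk] bilinD[OF outer])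
qed

end

text \<open>On pure tensors both sides are the same product of four scalars. The grouping on the
  left, first components together and second components together, is the one that a product of
  tensors produces.\<close>

lemma tensor_lift_mult_pair:
  assumes M: "module R M" and N: "module R N" and M': "module R M'" and N': "module R N'"
    and s: "s \<in> carrier (M \<boxtimes> N)" and t: "t \<in> carrier (M' \<boxtimes> N')"
    and p: "p \<in> lin_hom R M scalars" and a: "a \<in> lin_hom R N scalars"
    and q: "q \<in> lin_hom R M' scalars" and b: "b \<in> lin_hom R N' scalars"
  shows "tensor_lift R scalars (\<lambda>m n. tensor_lift R scalars (\<lambda>m' n'. (p m \<otimes> q m') \<otimes> (a n \<otimes> b n')) t) s =
    pair p a s \<otimes> pair q b t"
proof (rule tensor_lin_eq[OF M N s])
  note closed = p[THEN scalar_form_closed] a[THEN scalar_form_closed] q[THEN scalar_form_closed] b[THEN scalar_form_closed]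
  note intros = lin_intros tensor_lift_scalar_closed m_closed closed p a q b M N M' N' t self_module_module
  have b1: "bilin M' N' scalars (\<lambda>m' n'. (p m \<otimes> q m') \<otimes> (a n \<otimes> b n'))" if "m \<in> carrier M" "n \<in> carrier N" for m n
    using that by - (rule intros | assumption)+
  have b2: "bilin M N scalars (\<lambda>m n. tensor_lift R scalars (\<lambda>m' n'. (p m \<otimes> q m') \<otimes> (a n \<otimes> b n')) t)"
    by - (rule intros | assumption)+
  show "tensor_lift R scalars (\<lambda>m n. tensor_lift R scalars (\<lambda>m' n'. (p m \<otimes> q m') \<otimes> (a n \<otimes> b n')) t) \<in> lin_hom R (M \<boxtimes> N) scalars"
    by (rule tensor_lift_lin_hom[OF M N self_module_module b2])
  show "(\<lambda>s. pair p a s \<otimes> pair q b t) \<in> lin_hom R (M \<boxtimes> N) scalars"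
    by (intro lin_scalar_left pair_lin_hom pair_closed[OF t] M N M' N' p a q b)
  fix m n assume m: "m \<in> carrier M" and n: "n \<in> carrier N"
  have "tensor_lift R scalars (\<lambda>m' n'. (p m \<otimes> q m') \<otimes> (a n \<otimes> b n')) t = (p m \<otimes> a n) \<otimes> pair q b t"
  proof (rule tensor_lin_eq[OF M' N' t tensor_lift_lin_hom[OF M' N' self_module_module b1[OF m n]]])
    show "(\<lambda>t. (p m \<otimes> a n) \<otimes> pair q b t) \<in> lin_hom R (M' \<boxtimes> N') scalars"
      by (intro lin_scalar_right pair_lin_hom M' N' q b m_closed closed m n)
  qed (simp add: tensor_lift_pure[OF M' N' self_module_module b1] m n closed pair_pure[OF M' N' q b] m_ac)
  then show "tensor_lift R scalars (\<lambda>m n. tensor_lift R scalars (\<lambda>m' n'. (p m \<otimes> q m') \<otimes> (a n \<otimes> b n')) t)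
      (pure_tensor R M N m n) = pair p a (pure_tensor R M N m n) \<otimes> pair q b t"
    by (simp add: tensor_lift_pure[OF M N self_module_module b2] m n pair_pure[OF M N p a])
qed

lemma pair_tensor_algebra_mult:
  assumes A: "k_algebra R A" and B: "k_algebra R B"
    and p: "p \<in> lin_hom R A scalars" and q: "q \<in> lin_hom R B scalars"
    and s: "s \<in> carrier (A \<boxtimes> B)" and t: "t \<in> carrier (A \<boxtimes> B)"
  shows "pair p q (s \<otimes>\<^bsub>tensor_algebra R A B\<^esub> t) =
    tensor_lift R scalars (\<lambda>a b. tensor_lift R scalars (\<lambda>c d. p (a \<otimes>\<^bsub>A\<^esub> c) \<otimes> q (b \<otimes>\<^bsub>B\<^esub> d)) t) s"
proof -
  interpret A: k_algebra R A by (rule A)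
  interpret B: k_algebra R B by (rule B)
  note mods = k_algebra_module[OF A] k_algebra_module[OF B]
  note intros = lin_intros lin_comp[OF p] lin_comp[OF q] tensor_lift_scalar_closed scalar_form_closed[OF p]
    scalar_form_closed[OF q] A.m_closed B.m_closed self_module_module
  have b1: "bilin A B scalars (\<lambda>c d. p (a \<otimes>\<^bsub>A\<^esub> c) \<otimes> q (b \<otimes>\<^bsub>B\<^esub> d))" if "a \<in> carrier A" "b \<in> carrier B" for a b
    using that mods A B by - (rule intros | assumption)+
  have b2: "bilin A B scalars (\<lambda>a b. tensor_lift R scalars (\<lambda>c d. p (a \<otimes>\<^bsub>A\<^esub> c) \<otimes> q (b \<otimes>\<^bsub>B\<^esub> d)) t)"
    if "t \<in> carrier (A \<boxtimes> B)" for t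
    using that mods A B by - (rule intros | assumption)+
  note bil = bilinD[OF tensor_algebra_bilin[OF A B]]
  show ?thesis
  proof (rule tensor_lin_eq[OF mods s])
    show "(\<lambda>s. pair p q (s \<otimes>\<^bsub>tensor_algebra R A B\<^esub> t)) \<in> lin_hom R (A \<boxtimes> B) scalars"
      by (rule lin_pair[OF bil(1)[OF t] mods p q])
    show "tensor_lift R scalars (\<lambda>a b. tensor_lift R scalars (\<lambda>c d. p (a \<otimes>\<^bsub>A\<^esub> c) \<otimes> q (b \<otimes>\<^bsub>B\<^esub> d)) t)
        \<in> lin_hom R (A \<boxtimes> B) scalars"
      by (intro tensor_lift_lin_hom mods self_module_module b2 t)
    fix a b assume a: "a \<in> carrier A" and b: "b \<in> carrier B"
    note ab = pure_tensor_closed[OF mods a b]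
    have "pair p q (pure_tensor R A B a b \<otimes>\<^bsub>tensor_algebra R A B\<^esub> t) =
        tensor_lift R scalars (\<lambda>c d. p (a \<otimes>\<^bsub>A\<^esub> c) \<otimes> q (b \<otimes>\<^bsub>B\<^esub> d)) t"
    proof (rule tensor_lin_eq[OF mods t])
      show "(\<lambda>t. pair p q (pure_tensor R A B a b \<otimes>\<^bsub>tensor_algebra R A B\<^esub> t)) \<in> lin_hom R (A \<boxtimes> B) scalars"
        by (rule lin_pair[OF bil(2)[OF ab] mods p q])
      show "tensor_lift R scalars (\<lambda>c d. p (a \<otimes>\<^bsub>A\<^esub> c) \<otimes> q (b \<otimes>\<^bsub>B\<^esub> d)) \<in> lin_hom R (A \<boxtimes> B) scalars"
        by (intro tensor_lift_lin_hom mods self_module_module b1 a b)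
    qed (simp add: tensor_algebra_pure[OF A B] pair_pure[OF mods p q] tensor_lift_pure[OF mods self_module_module b1] a b)
    then show "pair p q (pure_tensor R A B a b \<otimes>\<^bsub>tensor_algebra R A B\<^esub> t) =
      tensor_lift R scalars (\<lambda>a b. tensor_lift R scalars (\<lambda>c d. p (a \<otimes>\<^bsub>A\<^esub> c) \<otimes> q (b \<otimes>\<^bsub>B\<^esub> d)) t) (pure_tensor R A B a b)"
      by (simp add: tensor_lift_pure[OF mods self_module_module b2] a b t)
  qed
qed

end

section \<open>The dual bialgebra\<close>

text \<open>The dual basis is a parameter, so that all constructions below may refer to one fixed
  choice; the theorem interprets the locale with a basis obtained from its hypotheses on
  \<open>H\<close>.\<close>

locale bialgebra_dual_basis = bialgebra R H
  for R :: "('k, 'x) ring_scheme" (structure)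
    and H :: "('k, 'h, 'z) bialgebra_scheme" (structure) +
  fixes I :: "'i set" and e :: "'i \<Rightarrow> 'h" and c :: "'i \<Rightarrow> 'h \<Rightarrow> 'k"
  assumes basis: "dual_basis H I e c"
begin

text \<open>\<open>H\<^sup>*\<close> carries the opposite comultiplication: it is the paper's \<open>H\<^sup>*\<^sup>c\<^sup>o\<^sup>p\<close>.\<close>

abbreviation dual :: "('k, 'h \<Rightarrow> 'k) bialgebra" (\<open>H\<^sup>*\<close>)
  where "H\<^sup>* \<equiv> coopposite R (dual_bialgebra R H)"

lemma H_module: "module R H" ..

lemma H_algebra: "k_algebra R H" ..

lemma dual_simps:
  "carrier H\<^sup>* = lin_hom R H scalars \<inter> extensional (carrier H)"
  "f \<otimes>\<^bsub>H\<^sup>*\<^esub> g = (\<lambda>h\<in>carrier H. pair f g (comult H h))"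
  "\<one>\<^bsub>H\<^sup>*\<^esub> = (\<lambda>h\<in>carrier H. counit H h)"
  "\<zero>\<^bsub>H\<^sup>*\<^esub> = (\<lambda>h\<in>carrier H. \<zero>\<^bsub>R\<^esub>)"
  "f \<oplus>\<^bsub>H\<^sup>*\<^esub> g = (\<lambda>h\<in>carrier H. f h \<oplus>\<^bsub>R\<^esub> g h)"
  "r \<odot>\<^bsub>H\<^sup>*\<^esub> f = (\<lambda>h\<in>carrier H. r \<otimes>\<^bsub>R\<^esub> f h)"
  "counit H\<^sup>* f = f \<one>\<^bsub>H\<^esub>"
  by (simp_all add: coopposite_def dual_bialgebra_def dual_algebra_def module.defs pair_def)

text \<open>The comultiplication is described over \<open>dual_algebra\<close>, the action over
  \<open>dual_bialgebra\<close>, and the bialgebra in play is the co-opposite of the latter; as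
  modules all three coincide.\<close>

lemma dual_tensor:
  "tensor_module R (dual_algebra R H) (dual_algebra R H) = H\<^sup>* \<boxtimes> H\<^sup>*"
  "tensor_module R (dual_bialgebra R H) (dual_bialgebra R H) = H\<^sup>* \<boxtimes> H\<^sup>*"
  "pure_tensor R (dual_bialgebra R H) (dual_bialgebra R H) = pure_tensor R H\<^sup>* H\<^sup>*"
  "tensor_module R (dual_bialgebra R H) N = H\<^sup>* \<boxtimes> N"
  by (intro tensor_cong; simp add: coopposite_def dual_bialgebra_def dual_algebra_def module.defs)+

lemma dual_lin_hom: "f \<in> carrier H\<^sup>* \<Longrightarrow> f \<in> lin_hom R H scalars"
  by (simp add: dual_simps)

lemma dual_apply_closed: "\<lbrakk>f \<in> carrier H\<^sup>*; h \<in> carrier H\<rbrakk> \<Longrightarrow> f h \<in> carrier R"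
  by (rule scalar_form_closed[OF dual_lin_hom])

lemma restrict_dual_closed: "f \<in> lin_hom R H scalars \<Longrightarrow> restrict f (carrier H) \<in> carrier H\<^sup>*"
  unfolding dual_simps by (auto intro: lin_hom_cong[OF _ H_module])

lemma dual_eqI: "\<lbrakk>f \<in> carrier H\<^sup>*; g \<in> carrier H\<^sup>*; \<And>h. h \<in> carrier H \<Longrightarrow> f h = g h\<rbrakk> \<Longrightarrow> f = g"
  unfolding dual_simps by (auto intro: extensionalityI)

lemma comult_closed: "h \<in> carrier H \<Longrightarrow> comult H h \<in> carrier (H \<boxtimes> H)"
  by (rule lin_hom_closed[OF comult_linear])

lemma dual_add_closed: "\<lbrakk>f \<in> carrier H\<^sup>*; g \<in> carrier H\<^sup>*\<rbrakk> \<Longrightarrow> f \<oplus>\<^bsub>H\<^sup>*\<^esub> g \<in> carrier H\<^sup>*"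
  unfolding dual_simps(5)
  using restrict_dual_closed[OF lin_add[OF _ _ self_module_module]] dual_lin_hom
  by (simp add: self_module_simps)

lemma dual_smult_closed: "\<lbrakk>r \<in> carrier R; f \<in> carrier H\<^sup>*\<rbrakk> \<Longrightarrow> r \<odot>\<^bsub>H\<^sup>*\<^esub> f \<in> carrier H\<^sup>*"
  unfolding dual_simps(6) by (rule restrict_dual_closed[OF lin_scalar_right[OF dual_lin_hom]])

lemma dual_mult_closed: "\<lbrakk>f \<in> carrier H\<^sup>*; g \<in> carrier H\<^sup>*\<rbrakk> \<Longrightarrow> f \<otimes>\<^bsub>H\<^sup>*\<^esub> g \<in> carrier H\<^sup>*"
  unfolding dual_simps(2)
  by (rule restrict_dual_closed[OF lin_pair[OF comult_linear H_module H_module dual_lin_hom dual_lin_hom]])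

lemma dual_one_closed: "\<one>\<^bsub>H\<^sup>*\<^esub> \<in> carrier H\<^sup>*"
  unfolding dual_simps(3) by (rule restrict_dual_closed[OF counit_linear])

lemma dual_apply:
  assumes "h \<in> carrier H"
  shows "(f \<otimes>\<^bsub>H\<^sup>*\<^esub> g) h = pair f g (comult H h)" "\<one>\<^bsub>H\<^sup>*\<^esub> h = counit H h" "\<zero>\<^bsub>H\<^sup>*\<^esub> h = \<zero>\<^bsub>R\<^esub>"
    "(f \<oplus>\<^bsub>H\<^sup>*\<^esub> g) h = f h \<oplus>\<^bsub>R\<^esub> g h" "(r \<odot>\<^bsub>H\<^sup>*\<^esub> f) h = r \<otimes>\<^bsub>R\<^esub> f h"
  using assms by (simp_all add: dual_simps)

lemma dual_zero_closed: "\<zero>\<^bsub>H\<^sup>*\<^esub> \<in> carrier H\<^sup>*"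
  unfolding dual_simps(4) by (intro restrict_dual_closed lin_homI) (auto simp: self_module_simps)

lemma dual_module: "module R H\<^sup>*"
proof (intro moduleI abelian_groupI R.is_cring)
  fix f assume f: "f \<in> carrier H\<^sup>*"
  have "(\<ominus>\<^bsub>R\<^esub> \<one>\<^bsub>R\<^esub>) \<odot>\<^bsub>H\<^sup>*\<^esub> f \<oplus>\<^bsub>H\<^sup>*\<^esub> f = \<zero>\<^bsub>H\<^sup>*\<^esub>"
    using dual_apply_closed[OF f]
    by (simp add: dual_simps R.l_minus R.l_neg cong: restrict_cong)
  then show "\<exists>g\<in>carrier H\<^sup>*. g \<oplus>\<^bsub>H\<^sup>*\<^esub> f = \<zero>\<^bsub>H\<^sup>*\<^esub>"
    using dual_smult_closed[OF _ f] by (metis R.a_inv_closed R.one_closed)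
qed (auto intro!: dual_eqI dual_add_closed dual_smult_closed dual_zero_closed
    simp: dual_apply dual_apply_closed R.a_ac R.l_distr R.r_distr R.m_assoc)

lemma lin_eval: "\<lbrakk>E \<in> lin_hom R Q H\<^sup>*; h \<in> carrier H\<rbrakk> \<Longrightarrow> (\<lambda>x. E x h) \<in> lin_hom R Q scalars"
  by (rule lin_homI)
    (auto simp: lin_hom_add[of E] lin_hom_smult[of E] dual_apply self_module_simps
      dual_apply_closed[OF lin_hom_closed[of E]])

abbreviation eval :: "'h \<Rightarrow> ('h \<Rightarrow> 'k) \<Rightarrow> 'k"
  where "eval h \<equiv> (\<lambda>f. f h)"

lemma eval_lin_hom: "h \<in> carrier H \<Longrightarrow> eval h \<in> lin_hom R H\<^sup>* scalars"
  by (rule lin_eval[OF lin_id])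

text \<open>A form applied to the expansion of \<open>h\<close> is the sum of c_i(h) f(e_i). Read as
  a function of \<open>h\<close>, this expands \<open>f\<close> in the \<open>c i\<close> with
  coefficients f(e_i).\<close>

lemma dual_dual_basis: "dual_basis H\<^sup>* I (\<lambda>i. restrict (c i) (carrier H)) (\<lambda>i f. f (e i))"
  unfolding dual_basis_def
proof (intro conjI ballI)
  note b = dual_basisD[OF basis]
  note rc = restrict_dual_closed[OF b(3)]
  show "finite I" by (rule b)
  fix f assume f: "f \<in> carrier H\<^sup>*"
  interpret D: module R "H\<^sup>*" by (rule dual_module)
  interpret S: module R scalars by (rule self_module_module)
  have fe: "f (e i) \<in> carrier R" if "i \<in> I" for i using dual_apply_closed[OF f b(2)] that by simp
  show "(\<Oplus>\<^bsub>H\<^sup>*\<^esub>i\<in>I. f (e i) \<odot>\<^bsub>H\<^sup>*\<^esub> restrict (c i) (carrier H)) = f"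
  proof (rule dual_eqI[OF _ f])
    show "(\<Oplus>\<^bsub>H\<^sup>*\<^esub>i\<in>I. f (e i) \<odot>\<^bsub>H\<^sup>*\<^esub> restrict (c i) (carrier H)) \<in> carrier H\<^sup>*"
      using fe rc by (intro D.finsum_closed) auto
    fix h assume h: "h \<in> carrier H"
    have ch: "c i h \<in> carrier R" if "i \<in> I" for i using scalar_form_closed[OF b(3) h] that by simp
    have "(\<Oplus>\<^bsub>H\<^sup>*\<^esub>i\<in>I. f (e i) \<odot>\<^bsub>H\<^sup>*\<^esub> restrict (c i) (carrier H)) h =
        (\<Oplus>\<^bsub>scalars\<^esub>i\<in>I. (f (e i) \<odot>\<^bsub>H\<^sup>*\<^esub> restrict (c i) (carrier H)) h)"
      by (rule lin_hom_finsum[OF dual_module self_module_module eval_lin_hom[OF h] b(1)]) (use fe rc in auto)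
    also have "\<dots> = (\<Oplus>\<^bsub>scalars\<^esub>i\<in>I. f (c i h \<odot>\<^bsub>H\<^esub> e i))"
      by (rule S.finsum_cong')
        (use h fe ch b(2) in \<open>auto simp: dual_apply lin_hom_smult[OF dual_lin_hom[OF f]] self_module_simps R.m_comm\<close>)
    also have "\<dots> = f (\<Oplus>\<^bsub>H\<^esub>i\<in>I. c i h \<odot>\<^bsub>H\<^esub> e i)"
      by (rule lin_hom_finsum[OF H_module self_module_module dual_lin_hom[OF f] b(1), symmetric])
        (use ch b(2) in auto)
    finally show "(\<Oplus>\<^bsub>H\<^sup>*\<^esub>i\<in>I. f (e i) \<odot>\<^bsub>H\<^sup>*\<^esub> restrict (c i) (carrier H)) h = f h"
      using b(4)[OF h] by simp
  qed
qed (use dual_basisD[OF basis] in \<open>auto intro: restrict_dual_closed eval_lin_hom\<close>)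

lemmas dual_tensor_module = tensor_module_module[OF dual_module dual_module]

text \<open>Contraction with the evaluation at \<open>e i\<close> leaves a form, and forms are
  compared pointwise. This is the uniqueness behind the description of the comultiplication.\<close>

lemma dual_tensor_eqI:
  assumes "s \<in> carrier (H\<^sup>* \<boxtimes> H\<^sup>*)" "t \<in> carrier (H\<^sup>* \<boxtimes> H\<^sup>*)"
    and "\<And>h g. \<lbrakk>h \<in> carrier H; g \<in> carrier H\<rbrakk> \<Longrightarrow> pair (eval h) (eval g) s = pair (eval h) (eval g) t"
  shows "s = t"
proof (rule contract_left_eqI[OF dual_module dual_module dual_dual_basis assms(1,2)])
  fix i assume "i \<in> I"
  then have ei: "e i \<in> carrier H" by (rule dual_basisD[OF basis])
  show "contract_left H\<^sup>* (eval (e i)) s = contract_left H\<^sup>* (eval (e i)) t"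
    by (rule dual_eqI)
      (simp_all add: lin_hom_closed[OF contract_left_lin_hom[OF dual_module dual_module eval_lin_hom[OF ei]]]
        contract_left_apply[OF dual_module dual_module eval_lin_hom[OF ei] eval_lin_hom] ei assms)
qed

lemma dual_tensor3_eqI:
  assumes "s \<in> carrier (H\<^sup>* \<boxtimes> (H\<^sup>* \<boxtimes> H\<^sup>*))" "t \<in> carrier (H\<^sup>* \<boxtimes> (H\<^sup>* \<boxtimes> H\<^sup>*))"
    and "\<And>h g l. \<lbrakk>h \<in> carrier H; g \<in> carrier H; l \<in> carrier H\<rbrakk> \<Longrightarrow>
      pair (eval h) (pair (eval g) (eval l)) s = pair (eval h) (pair (eval g) (eval l)) t"
  shows "s = t"
proof (rule contract_left_eqI[OF dual_module dual_tensor_module dual_dual_basis assms(1,2)])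
  fix i assume "i \<in> I"
  then have ei: "e i \<in> carrier H" by (rule dual_basisD[OF basis])
  show "contract_left (H\<^sup>* \<boxtimes> H\<^sup>*) (eval (e i)) s = contract_left (H\<^sup>* \<boxtimes> H\<^sup>*) (eval (e i)) t"
    by (rule dual_tensor_eqI)
      (simp_all add: lin_hom_closed[OF contract_left_lin_hom[OF dual_module dual_tensor_module eval_lin_hom[OF ei]]]
        contract_left_apply[OF dual_module dual_tensor_module eval_lin_hom[OF ei]
          pair_lin_hom[OF dual_module dual_module eval_lin_hom eval_lin_hom]] ei assms)
qed

text \<open>Evaluation at pairs of points shows that the description has at most one solution; the
  dual basis provides one. In the last claim \<open>g\<close> precedes \<open>h\<close> because of
  the co-opposite.\<close>

lemma dual_comult:
  assumes f: "f \<in> carrier H\<^sup>*"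
  shows dual_comult_closed: "comult H\<^sup>* f \<in> carrier (H\<^sup>* \<boxtimes> H\<^sup>*)"
    and pair_eval_dual_comult: "\<lbrakk>h \<in> carrier H; g \<in> carrier H\<rbrakk> \<Longrightarrow>
      pair (eval h) (eval g) (comult H\<^sup>* f) = f (g \<otimes>\<^bsub>H\<^esub> h)"
proof -
  interpret D2: module R "H\<^sup>* \<boxtimes> H\<^sup>*" by (rule dual_tensor_module)
  interpret S: module R scalars by (rule self_module_module)
  note b = dual_basisD[OF basis]
  note f' = dual_lin_hom[OF f]
  \<comment> \<open>Expanding \<open>h\<close> turns f(h g) into the sum of c_i(h) f(e_i g). So the
    tensor sought is the sum of c_i \<otimes> f(e_i -), and \<open>u i\<close>, \<open>w i\<close>
    are its factors.\<close>
  define w where "w i = (\<lambda>g\<in>carrier H. f (e i \<otimes>\<^bsub>H\<^esub> g))" for i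
  define u where "u i = restrict (c i) (carrier H)" for i
  have w: "w i \<in> carrier H\<^sup>*" if "i \<in> I" for i
    unfolding w_def using b(2)[OF that]
    by (intro restrict_dual_closed lin_comp[OF f'] lin_mult_right lin_id H_algebra)
  have u: "u i \<in> carrier H\<^sup>*" if "i \<in> I" for i
    unfolding u_def by (intro restrict_dual_closed b that)
  have ch: "c i h \<in> carrier R" if "i \<in> I" "h \<in> carrier H" for i h using scalar_form_closed[OF b(3)] that by simp
  define t where "t = (\<Oplus>\<^bsub>H\<^sup>* \<boxtimes> H\<^sup>*\<^esub>i\<in>I. pure_tensor R H\<^sup>* H\<^sup>* (u i) (w i))"
  have t: "t \<in> carrier (H\<^sup>* \<boxtimes> H\<^sup>*)"
    unfolding t_def using u w by (intro D2.finsum_closed) (auto intro: pure_tensor_closed dual_module)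
  have pair_t: "pair (eval h) (eval g) t = f (h \<otimes>\<^bsub>H\<^esub> g)" if h: "h \<in> carrier H" and g: "g \<in> carrier H" for h g
  proof -
    have summand: "pair (eval h) (eval g) (pure_tensor R H\<^sup>* H\<^sup>* (u i) (w i)) = f ((c i h \<odot>\<^bsub>H\<^esub> e i) \<otimes>\<^bsub>H\<^esub> g)"
      if i: "i \<in> I" for i
      using h g ch[OF i h] b(2)[OF i]
      by (simp add: pair_pure[OF dual_module dual_module eval_lin_hom eval_lin_hom u[OF i] w[OF i]])
        (simp add: u_def w_def smult_mult_left lin_hom_smult[OF f'] self_module_simps)
    have "pair (eval h) (eval g) t =
        (\<Oplus>\<^bsub>scalars\<^esub>i\<in>I. pair (eval h) (eval g) (pure_tensor R H\<^sup>* H\<^sup>* (u i) (w i)))"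
      unfolding t_def
      by (rule lin_hom_finsum[OF dual_tensor_module self_module_module pair_lin_hom b(1)])
        (auto intro: dual_module eval_lin_hom h g pure_tensor_closed u w)
    also have "\<dots> = (\<Oplus>\<^bsub>scalars\<^esub>i\<in>I. f ((c i h \<odot>\<^bsub>H\<^esub> e i) \<otimes>\<^bsub>H\<^esub> g))"
      by (rule S.finsum_cong')
        (use h g ch b(2) in \<open>auto simp: summand self_module_simps scalar_form_closed[OF f']\<close>)
    also have "\<dots> = f ((\<Oplus>\<^bsub>H\<^esub>i\<in>I. c i h \<odot>\<^bsub>H\<^esub> e i) \<otimes>\<^bsub>H\<^esub> g)"
      by (rule lin_hom_finsum[OF H_module self_module_module
            lin_comp[OF f' lin_mult_left[OF lin_id H_algebra g]] b(1), symmetric])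
        (use ch h b(2) in auto)
    finally show ?thesis using b(4)[OF h] by simp
  qed
  have "comult (dual_bialgebra R H) f = (THE t. t \<in> carrier (H\<^sup>* \<boxtimes> H\<^sup>*) \<and>
      (\<forall>h\<in>carrier H. \<forall>g\<in>carrier H. f (h \<otimes>\<^bsub>H\<^esub> g) = pair (eval h) (eval g) t))"
    unfolding pair_def dual_tensor(1)[symmetric] by (simp add: dual_bialgebra_def module.defs)
  also have "\<dots> = t"
  proof (rule the_equality)
    fix t' assume "t' \<in> carrier (H\<^sup>* \<boxtimes> H\<^sup>*) \<and>
      (\<forall>h\<in>carrier H. \<forall>g\<in>carrier H. f (h \<otimes>\<^bsub>H\<^esub> g) = pair (eval h) (eval g) t')"
    then show "t' = t" using t pair_t by (intro dual_tensor_eqI) simp_all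
  qed (simp add: t pair_t)
  \<comment> \<open>The tensor \<open>t\<close> belongs to the comultiplication of
    \<open>dual_bialgebra\<close>; the flip comes in only now.\<close>
  finally have *: "comult H\<^sup>* f = tensor_lift R (H\<^sup>* \<boxtimes> H\<^sup>*) (\<lambda>x y. pure_tensor R H\<^sup>* H\<^sup>* y x) t"
    unfolding dual_tensor(2,3)[symmetric] by (simp add: coopposite_def[of R "dual_bialgebra R H"])
  show "comult H\<^sup>* f \<in> carrier (H\<^sup>* \<boxtimes> H\<^sup>*)"
    unfolding *
    by (rule tensor_lift_closed[OF dual_module dual_module dual_tensor_module flip_bilin[OF dual_module dual_module] t])
  show "pair (eval h) (eval g) (comult H\<^sup>* f) = f (g \<otimes>\<^bsub>H\<^esub> h)" if "h \<in> carrier H" "g \<in> carrier H"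
    unfolding * using that
    by (simp add: pair_flip[OF dual_module dual_module eval_lin_hom eval_lin_hom t] pair_t)
qed

text \<open>The value is given by a description, so linearity is read off from its evaluations,
  which are visibly linear in \<open>f\<close>.\<close>

lemma dual_comult_lin_hom: "comult H\<^sup>* \<in> lin_hom R H\<^sup>* (H\<^sup>* \<boxtimes> H\<^sup>*)"
proof (rule lin_homI)
  interpret D: module R "H\<^sup>*" by (rule dual_module)
  interpret D2: module R "H\<^sup>* \<boxtimes> H\<^sup>*" by (rule dual_tensor_module)
  note ev2 = pair_lin_hom[OF dual_module dual_module eval_lin_hom eval_lin_hom]
  fix f assume f: "f \<in> carrier H\<^sup>*"
  show "comult H\<^sup>* f \<in> carrier (H\<^sup>* \<boxtimes> H\<^sup>*)" by (rule dual_comult_closed[OF f])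
  show "comult H\<^sup>* (f \<oplus>\<^bsub>H\<^sup>*\<^esub> g) = comult H\<^sup>* f \<oplus>\<^bsub>H\<^sup>* \<boxtimes> H\<^sup>*\<^esub> comult H\<^sup>* g" if g: "g \<in> carrier H\<^sup>*" for g
    using f g by (intro dual_tensor_eqI)
     (simp_all add: dual_comult lin_hom_add[OF ev2] dual_apply self_module_simps)
  show "comult H\<^sup>* (r \<odot>\<^bsub>H\<^sup>*\<^esub> f) = r \<odot>\<^bsub>H\<^sup>* \<boxtimes> H\<^sup>*\<^esub> comult H\<^sup>* f" if r: "r \<in> carrier R" for r
    using f r by (intro dual_tensor_eqI)
     (simp_all add: dual_comult lin_hom_smult[OF ev2] dual_apply self_module_simps)
qed

lemma dual_algebra: "k_algebra R H\<^sup>*"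
proof -
  interpret D: module R "H\<^sup>*" by (rule dual_module)
  have m: "(\<lambda>f. pair f g (comult H h)) \<in> lin_hom R H\<^sup>* scalars"
    and m': "(\<lambda>f. pair g f (comult H h)) \<in> lin_hom R H\<^sup>* scalars"
    if "g \<in> carrier H\<^sup>*" "h \<in> carrier H" for g h
    unfolding pair_def using that dual_module H_module
    by - (rule lin_intros lin_eval self_module_module comult_closed dual_lin_hom dual_apply_closed | assumption)+
  show ?thesis
  proof (intro k_algebraI dual_module monoidI)
    fix f g k assume fgk: "f \<in> carrier H\<^sup>*" "g \<in> carrier H\<^sup>*" "k \<in> carrier H\<^sup>*"
    note l = fgk[THEN dual_lin_hom]
    show "f \<otimes>\<^bsub>H\<^sup>*\<^esub> g \<otimes>\<^bsub>H\<^sup>*\<^esub> k = f \<otimes>\<^bsub>H\<^sup>*\<^esub> (g \<otimes>\<^bsub>H\<^sup>*\<^esub> k)"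
    proof (rule dual_eqI)
      fix h assume h: "h \<in> carrier H"
      note \<delta> = comult_closed[OF h]
      have "(f \<otimes>\<^bsub>H\<^sup>*\<^esub> g \<otimes>\<^bsub>H\<^sup>*\<^esub> k) h = pair (\<lambda>x. pair f g (comult H x)) k (comult H h)"
        \<comment> \<open>The inner convolution is a restricted function; the pairing sees it only
          on the carrier, where it may be replaced by its body.\<close>
        unfolding dual_apply[OF h]
        by (rule pair_cong[OF H_module H_module \<delta>]) (use fgk l in \<open>simp_all add: dual_apply dual_lin_hom dual_mult_closed\<close>)
      also have "\<dots> = pair f (\<lambda>x. pair g k (comult H x)) (comult H h)"
        using pair_coassoc_left[OF H_module comult_linear l \<delta>] pair_coassoc_right[OF H_module comult_linear l \<delta>]
          comult_coassoc[OF h] by simp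
      also have "\<dots> = (f \<otimes>\<^bsub>H\<^sup>*\<^esub> (g \<otimes>\<^bsub>H\<^sup>*\<^esub> k)) h"
        unfolding dual_apply[OF h]
        by (rule pair_cong[OF H_module H_module \<delta>, symmetric]) (use fgk l in \<open>simp_all add: dual_apply dual_lin_hom dual_mult_closed\<close>)
      finally show "(f \<otimes>\<^bsub>H\<^sup>*\<^esub> g \<otimes>\<^bsub>H\<^sup>*\<^esub> k) h = (f \<otimes>\<^bsub>H\<^sup>*\<^esub> (g \<otimes>\<^bsub>H\<^sup>*\<^esub> k)) h" .
    qed (intro dual_mult_closed fgk)+
  next
    fix f assume f: "f \<in> carrier H\<^sup>*"
    note l = dual_lin_hom[OF f]
    show "\<one>\<^bsub>H\<^sup>*\<^esub> \<otimes>\<^bsub>H\<^sup>*\<^esub> f = f"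
    proof (rule dual_eqI)
      fix h assume h: "h \<in> carrier H"
      have "pair \<one>\<^bsub>H\<^sup>*\<^esub> f (comult H h) = pair (counit H) f (comult H h)"
        by (rule pair_cong[OF H_module H_module comult_closed[OF h]])
         (simp_all add: dual_lin_hom dual_one_closed f dual_apply)
      \<comment> \<open>With the counit in one slot the pairing is \<open>f\<close> applied to a
        contraction, and the counit axiom of \<open>H\<close> computes that contraction.\<close>
      also have "\<dots> = f (contract_left H (counit H) (comult H h))"
        by (rule contract_left_apply[OF H_module H_module counit_linear l comult_closed[OF h], symmetric])
      finally show "(\<one>\<^bsub>H\<^sup>*\<^esub> \<otimes>\<^bsub>H\<^sup>*\<^esub> f) h = f h"
        using h by (simp add: dual_apply contract_left_def counit_left)
    qed (intro dual_mult_closed dual_one_closed f)+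
    show "f \<otimes>\<^bsub>H\<^sup>*\<^esub> \<one>\<^bsub>H\<^sup>*\<^esub> = f"
    proof (rule dual_eqI)
      fix h assume h: "h \<in> carrier H"
      have "pair f \<one>\<^bsub>H\<^sup>*\<^esub> (comult H h) = pair f (counit H) (comult H h)"
        by (rule pair_cong[OF H_module H_module comult_closed[OF h]])
         (simp_all add: dual_lin_hom dual_one_closed f dual_apply)
      also have "\<dots> = f (contract_right H (counit H) (comult H h))"
        by (rule contract_right_apply[OF H_module H_module counit_linear l comult_closed[OF h], symmetric])
      finally show "(f \<otimes>\<^bsub>H\<^sup>*\<^esub> \<one>\<^bsub>H\<^sup>*\<^esub>) h = f h"
        using h by (simp add: dual_apply contract_right_def counit_right)
    qed (intro dual_mult_closed dual_one_closed f)+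
  qed (intro dual_eqI dual_mult_closed dual_one_closed D.a_closed D.smult_closed | assumption |
      simp add: dual_apply lin_hom_add[OF m] lin_hom_add[OF m'] lin_hom_smult[OF m] lin_hom_smult[OF m'] self_module_simps)+
qed

lemma dual_bialgebra: "bialgebra R H\<^sup>*"
proof (intro bialgebra.intro dual_algebra bialgebra_axioms.intro)
  show "comult H\<^sup>* \<in> lin_hom R H\<^sup>* (H\<^sup>* \<boxtimes> H\<^sup>*)" by (rule dual_comult_lin_hom)
  show "counit H\<^sup>* \<in> lin_hom R H\<^sup>* scalars"
  proof -
    have "counit H\<^sup>* = eval \<one>\<^bsub>H\<^esub>" by (rule ext) (rule dual_simps(7))
    then show ?thesis using eval_lin_hom[OF one_closed] by simp
  qed
next
  fix f assume f: "f \<in> carrier H\<^sup>*"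
  note t = dual_comult_closed[OF f]
  note DD = dual_module dual_module
  note D3 = tensor_module_module[OF dual_module dual_tensor_module]
  note \<Delta> = dual_comult_lin_hom
  show "tensor_lift R (H\<^sup>* \<boxtimes> (H\<^sup>* \<boxtimes> H\<^sup>*))
         (\<lambda>x z. tensor_lift R (H\<^sup>* \<boxtimes> (H\<^sup>* \<boxtimes> H\<^sup>*))
           (\<lambda>x1 x2. pure_tensor R H\<^sup>* (H\<^sup>* \<boxtimes> H\<^sup>*) x1 (pure_tensor R H\<^sup>* H\<^sup>* x2 z)) (comult H\<^sup>* x))
         (comult H\<^sup>* f) =
       tensor_lift R (H\<^sup>* \<boxtimes> (H\<^sup>* \<boxtimes> H\<^sup>*)) (\<lambda>x z. pure_tensor R H\<^sup>* (H\<^sup>* \<boxtimes> H\<^sup>*) x (comult H\<^sup>* z)) (comult H\<^sup>* f)"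
    (is "?l = ?r")
  proof (rule dual_tensor3_eqI)
    show "?l \<in> carrier (H\<^sup>* \<boxtimes> (H\<^sup>* \<boxtimes> H\<^sup>*))"
      by (rule tensor_lift_closed[OF DD D3 coassoc_left_bilin[OF dual_module \<Delta>] t])
    show "?r \<in> carrier (H\<^sup>* \<boxtimes> (H\<^sup>* \<boxtimes> H\<^sup>*))"
      by (rule tensor_lift_closed[OF DD D3 coassoc_right_bilin[OF dual_module \<Delta>] t])
    fix a b d assume abd: "a \<in> carrier H" "b \<in> carrier H" "d \<in> carrier H"
    note ev = abd[THEN eval_lin_hom]
    have "pair (eval a) (pair (eval b) (eval d)) ?l = pair (\<lambda>x. pair (eval a) (eval b) (comult H\<^sup>* x)) (eval d) (comult H\<^sup>* f)"
      by (rule pair_coassoc_left[OF dual_module \<Delta> ev t])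
    \<comment> \<open>The opposite order shows here: evaluating at \<open>a\<close> and then at
      \<open>b\<close> amounts to evaluating at the product b a. Both sides end as \<open>f\<close>
      at d b a, bracketed in two ways.\<close>
    also have "\<dots> = pair (eval (b \<otimes>\<^bsub>H\<^esub> a)) (eval d) (comult H\<^sup>* f)"
      by (rule pair_cong[OF DD t, symmetric]) (use abd in \<open>simp_all add: eval_lin_hom pair_eval_dual_comult\<close>)
    also have "\<dots> = pair (eval a) (eval (d \<otimes>\<^bsub>H\<^esub> b)) (comult H\<^sup>* f)"
      using abd by (simp add: pair_eval_dual_comult f m_assoc)
    also have "\<dots> = pair (eval a) (\<lambda>x. pair (eval b) (eval d) (comult H\<^sup>* x)) (comult H\<^sup>* f)"
      by (rule pair_cong[OF DD t]) (use abd in \<open>simp_all add: eval_lin_hom pair_eval_dual_comult\<close>)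
    also have "\<dots> = pair (eval a) (pair (eval b) (eval d)) ?r"
      by (rule pair_coassoc_right[OF dual_module \<Delta> ev t, symmetric])
    finally show "pair (eval a) (pair (eval b) (eval d)) ?l = pair (eval a) (pair (eval b) (eval d)) ?r" .
  qed
  note ev1 = eval_lin_hom[OF one_closed]
  \<comment> \<open>The counit of the dual is evaluation at 1, so the contraction takes
    \<open>h\<close> to the value of \<open>f\<close> at \<open>h\<close> times 1.\<close>
  have "contract_left H\<^sup>* (eval \<one>\<^bsub>H\<^esub>) (comult H\<^sup>* f) = f"
    by (rule dual_eqI)
      (simp_all add: f contract_left_apply[OF DD ev1 eval_lin_hom] dual_comult
        lin_hom_closed[OF contract_left_lin_hom[OF DD ev1]])
  then show "tensor_lift R H\<^sup>* (\<lambda>x y. counit H\<^sup>* x \<odot>\<^bsub>H\<^sup>*\<^esub> y) (comult H\<^sup>* f) = f"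
    by (simp add: contract_left_def dual_simps(7))
  have "contract_right H\<^sup>* (eval \<one>\<^bsub>H\<^esub>) (comult H\<^sup>* f) = f"
    by (rule dual_eqI)
      (simp_all add: f contract_right_apply[OF DD ev1 eval_lin_hom] dual_comult
        lin_hom_closed[OF contract_right_lin_hom[OF DD ev1]])
  then show "tensor_lift R H\<^sup>* (\<lambda>x y. counit H\<^sup>* y \<odot>\<^bsub>H\<^sup>*\<^esub> x) (comult H\<^sup>* f) = f"
    by (simp add: contract_right_def dual_simps(7))
next
  fix f g assume f: "f \<in> carrier H\<^sup>*" and g: "g \<in> carrier H\<^sup>*"
  note lf = dual_lin_hom[OF f] and lg = dual_lin_hom[OF g]
  note HH = H_module H_module
  note DD = dual_module dual_module
  note AD = dual_algebra dual_algebra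
  note \<Delta>f = dual_comult_closed[OF f] and \<Delta>g = dual_comult_closed[OF g]
  note bil = bilinD[OF tensor_algebra_bilin[OF AD]]
  note bilH = bilinD[OF tensor_algebra_bilin[OF H_algebra H_algebra]]
  show "counit H\<^sup>* (f \<otimes>\<^bsub>H\<^sup>*\<^esub> g) = counit H\<^sup>* f \<otimes>\<^bsub>R\<^esub> counit H\<^sup>* g"
    by (simp add: dual_simps(7) dual_apply comult_one tensor_algebra_one pair_pure[OF HH lf lg])
  show "comult H\<^sup>* (f \<otimes>\<^bsub>H\<^sup>*\<^esub> g) = comult H\<^sup>* f \<otimes>\<^bsub>tensor_algebra R H\<^sup>* H\<^sup>*\<^esub> comult H\<^sup>* g"
  proof (rule dual_tensor_eqI)
    show "comult H\<^sup>* (f \<otimes>\<^bsub>H\<^sup>*\<^esub> g) \<in> carrier (H\<^sup>* \<boxtimes> H\<^sup>*)" by (intro dual_comult_closed dual_mult_closed f g)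
    show "comult H\<^sup>* f \<otimes>\<^bsub>tensor_algebra R H\<^sup>* H\<^sup>*\<^esub> comult H\<^sup>* g \<in> carrier (H\<^sup>* \<boxtimes> H\<^sup>*)"
      by (rule bil(3)[OF \<Delta>f \<Delta>g])
    fix h l assume h: "h \<in> carrier H" and l: "l \<in> carrier H"
    \<comment> \<open>This is f1(v1) g1(v2) f2(u1) g2(u2), with free tensors \<open>u\<close> and
      \<open>v\<close> in place of \<open>comult H l\<close> and \<open>comult H h\<close>. It
      mediates between the pairing of \<open>f\<close> and \<open>g\<close> with the product u v and
      the evaluated product of the two comultiplications; \<open>v\<close> meets the first
      components because the comultiplication is opposite.\<close>
    define \<Psi> where "\<Psi> u v = tensor_lift R scalars (\<lambda>f1 f2. tensor_lift R scalars
      (\<lambda>g1 g2. pair f1 g1 v \<otimes>\<^bsub>R\<^esub> pair f2 g2 u) (comult H\<^sup>* g)) (comult H\<^sup>* f)" for u v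
    note intros = lin_intros tensor_lift_scalar_closed dual_apply_closed lin_eval self_module_module
      dual_module H_module \<Delta>f \<Delta>g dual_lin_hom
    have b1: "bilin H\<^sup>* H\<^sup>* scalars (\<lambda>g1 g2. pair f1 g1 v \<otimes>\<^bsub>R\<^esub> pair f2 g2 u)"
      if "f1 \<in> carrier H\<^sup>*" "f2 \<in> carrier H\<^sup>*" "u \<in> carrier (H \<boxtimes> H)" "v \<in> carrier (H \<boxtimes> H)" for f1 f2 u v
      unfolding pair_def using that by - (rule intros | assumption)+
    have b2: "bilin H\<^sup>* H\<^sup>* scalars (\<lambda>f1 f2. tensor_lift R scalars
        (\<lambda>g1 g2. pair f1 g1 v \<otimes>\<^bsub>R\<^esub> pair f2 g2 u) (comult H\<^sup>* g))"
      if "u \<in> carrier (H \<boxtimes> H)" "v \<in> carrier (H \<boxtimes> H)" for u v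
      unfolding pair_def using that by - (rule intros | assumption)+
    have lu: "(\<lambda>u. \<Psi> u v) \<in> lin_hom R (H \<boxtimes> H) scalars" if "v \<in> carrier (H \<boxtimes> H)" for v
      unfolding \<Psi>_def pair_def using that by - (rule intros tensor_module_module | assumption)+
    have lv: "\<Psi> u \<in> lin_hom R (H \<boxtimes> H) scalars" if "u \<in> carrier (H \<boxtimes> H)" for u
      unfolding \<Psi>_def pair_def using that by - (rule intros tensor_module_module | assumption)+
    have \<Psi>_pure: "\<Psi> (pure_tensor R H H a b) (pure_tensor R H H p q) = f (a \<otimes>\<^bsub>H\<^esub> p) \<otimes>\<^bsub>R\<^esub> g (b \<otimes>\<^bsub>H\<^esub> q)"
      if abpq: "a \<in> carrier H" "b \<in> carrier H" "p \<in> carrier H" "q \<in> carrier H" for a b p q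
    proof -
      note ab = pure_tensor_closed[OF HH abpq(1,2)] and pq = pure_tensor_closed[OF HH abpq(3,4)]
      note ev = abpq[THEN eval_lin_hom]
      have "\<Psi> (pure_tensor R H H a b) (pure_tensor R H H p q) = tensor_lift R scalars (\<lambda>f1 f2. tensor_lift R scalars
          (\<lambda>g1 g2. (f1 p \<otimes>\<^bsub>R\<^esub> g1 q) \<otimes>\<^bsub>R\<^esub> (f2 a \<otimes>\<^bsub>R\<^esub> g2 b)) (comult H\<^sup>* g)) (comult H\<^sup>* f)"
        unfolding \<Psi>_def
        by (intro tensor_lift_cong[OF DD self_module_module] b1 b2 ab pq \<Delta>f \<Delta>g)
          (simp_all add: pair_pure[OF HH] dual_lin_hom abpq)
      \<comment> \<open>The double sum separates into a factor for \<open>f\<close> and one for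
        \<open>g\<close>, which are their values at a p and at b q.\<close>
      also have "\<dots> = pair (eval p) (eval a) (comult H\<^sup>* f) \<otimes>\<^bsub>R\<^esub> pair (eval q) (eval b) (comult H\<^sup>* g)"
        by (rule tensor_lift_mult_pair[OF DD DD \<Delta>f \<Delta>g ev(3) ev(1) ev(4) ev(2)])
      finally show ?thesis using abpq by (simp add: dual_comult f g)
    qed
    have *: "pair f g (u \<otimes>\<^bsub>tensor_algebra R H H\<^esub> v) = \<Psi> u v"
      if u: "u \<in> carrier (H \<boxtimes> H)" and v: "v \<in> carrier (H \<boxtimes> H)" for u v
    proof (rule tensor_lin_eq[OF HH u lin_pair[OF bilH(1)[OF v] HH lf lg] lu[OF v]])
      fix a b assume ab: "a \<in> carrier H" "b \<in> carrier H"
      note ab' = pure_tensor_closed[OF HH ab]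
      show "pair f g (pure_tensor R H H a b \<otimes>\<^bsub>tensor_algebra R H H\<^esub> v) = \<Psi> (pure_tensor R H H a b) v"
        by (rule tensor_lin_eq[OF HH v lin_pair[OF bilH(2)[OF ab'] HH lf lg] lv[OF ab']])
          (simp add: ab tensor_algebra_pure[OF H_algebra H_algebra] pair_pure[OF HH lf lg] \<Psi>_pure)
    qed
    note \<delta>h = comult_closed[OF h] and \<delta>l = comult_closed[OF l]
    have "pair (eval h) (eval l) (comult H\<^sup>* (f \<otimes>\<^bsub>H\<^sup>*\<^esub> g)) = pair f g (comult H (l \<otimes>\<^bsub>H\<^esub> h))"
      using h l by (simp add: dual_comult dual_mult_closed f g dual_apply)
    \<comment> \<open>Multiplicativity of \<open>comult H\<close> splits the tensor of l h into the
      product to which the general identity applies.\<close>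
    also have "\<dots> = \<Psi> (comult H l) (comult H h)"
      using h l by (simp add: comult_mult * \<delta>h \<delta>l)
    also have "\<dots> = pair (eval h) (eval l) (comult H\<^sup>* f \<otimes>\<^bsub>tensor_algebra R H\<^sup>* H\<^sup>*\<^esub> comult H\<^sup>* g)"
      unfolding pair_tensor_algebra_mult[OF AD eval_lin_hom[OF h] eval_lin_hom[OF l] \<Delta>f \<Delta>g] \<Psi>_def dual_apply(1)[OF h] dual_apply(1)[OF l] ..
    finally show "pair (eval h) (eval l) (comult H\<^sup>* (f \<otimes>\<^bsub>H\<^sup>*\<^esub> g)) =
        pair (eval h) (eval l) (comult H\<^sup>* f \<otimes>\<^bsub>tensor_algebra R H\<^sup>* H\<^sup>*\<^esub> comult H\<^sup>* g)" .
  qed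
next
  note DD = dual_module dual_module
  \<comment> \<open>At a pair of points the left side is the counit of their product and the right
    side the product of their counits in the other order.\<close>
  show "comult H\<^sup>* \<one>\<^bsub>H\<^sup>*\<^esub> = \<one>\<^bsub>tensor_algebra R H\<^sup>* H\<^sup>*\<^esub>"
    unfolding tensor_algebra_one
    by (rule dual_tensor_eqI)
      (simp_all add: dual_comult dual_one_closed pure_tensor_closed[OF DD] dual_apply counit_mult
        pair_pure[OF DD eval_lin_hom eval_lin_hom] R.m_comm scalar_form_closed[OF counit_linear])
  show "counit H\<^sup>* \<one>\<^bsub>H\<^sup>*\<^esub> = \<one>\<^bsub>R\<^esub>" by (simp add: dual_simps(7) dual_apply counit_one)
qed

end

section \<open>Coactions and actions of the dual\<close>

context cring
begin

lemma contract_right_closed: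
  "\<lbrakk>t \<in> carrier (M \<boxtimes> N); module R M; module R N; f \<in> lin_hom R N scalars\<rbrakk> \<Longrightarrow> contract_right M f t \<in> carrier M"
  by (rule lin_hom_closed[OF contract_right_lin_hom])

lemma lin_contract_right:
  "\<lbrakk>E \<in> lin_hom R Q (M \<boxtimes> N); module R M; module R N; f \<in> lin_hom R N scalars\<rbrakk> \<Longrightarrow>
     (\<lambda>x. contract_right M f (E x)) \<in> lin_hom R Q M"
  by (rule lin_comp[OF contract_right_lin_hom])

lemma contract_right_cong:
  assumes "t \<in> carrier (M \<boxtimes> N)" "module R M" "module R N" "f \<in> lin_hom R N scalars"
    and "\<And>n. n \<in> carrier N \<Longrightarrow> f n = g n"
  shows "contract_right M f t = contract_right M g t"
  unfolding contract_right_def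
  by (rule tensor_lift_cong[OF assms(2,3,2,1)]) (use assms in \<open>simp_all add: contract_right_bilin\<close>)

lemma pair_smult:
  assumes "module R M" "module R N" "module R P" "t \<in> carrier (M \<boxtimes> N)"
    and "f \<in> lin_hom R M scalars" "g \<in> lin_hom R N scalars" "p \<in> carrier P"
  shows "tensor_lift R P (\<lambda>m n. (f m \<otimes> g n) \<odot>\<^bsub>P\<^esub> p) t = pair f g t \<odot>\<^bsub>P\<^esub> p"
  unfolding pair_def
  using lin_hom_tensor_lift[OF lin_smult_left[OF lin_id assms(3,7)] assms(4) pair_bilin[OF assms(5,6)] assms(1,2)
      self_module_module assms(3)] by simp

lemma pair_mult_right:
  assumes "module R M" "module R N" "t \<in> carrier (M \<boxtimes> N)"
    and "f \<in> lin_hom R M scalars" "g \<in> lin_hom R N scalars" "r \<in> carrier R"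
  shows "pair f (\<lambda>n. g n \<otimes> r) t = pair f g t \<otimes> r"
proof (rule tensor_lin_eq[OF assms(1-3)])
  show "pair f (\<lambda>n. g n \<otimes> r) \<in> lin_hom R (M \<boxtimes> N) scalars" "(\<lambda>t. pair f g t \<otimes> r) \<in> lin_hom R (M \<boxtimes> N) scalars"
    by (intro pair_lin_hom lin_scalar_left assms)+
  show "pair f (\<lambda>n. g n \<otimes> r) (pure_tensor R M N m n) = pair f g (pure_tensor R M N m n) \<otimes> r"
    if "m \<in> carrier M" "n \<in> carrier N" for m n
    using that assms by (simp add: pair_pure lin_scalar_left scalar_form_closed[OF assms(4)] scalar_form_closed[OF assms(5)] m_assoc)
qed

end

section \<open>Contractions of A \<otimes> H and of its tensor product with H\<close>

locale bialgebra_dual_basis_algebra = bialgebra_dual_basis R H I e c + A: k_algebra R A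
  for R :: "('k, 'x) ring_scheme" (structure)
    and H :: "('k, 'h, 'z) bialgebra_scheme" (structure)
    and I :: "'i set" and e c
    and A :: "('k, 'a, 'y) module_scheme" (structure)
begin

lemma A_module: "module R A" ..

lemma A_algebra: "k_algebra R A" ..

lemmas AH_module = tensor_module_module[OF A_module H_module]
lemmas AHH_module = tensor_module_module[OF AH_module H_module]

abbreviation "AHH \<equiv> (A \<boxtimes> H) \<boxtimes> H"

text \<open>Linearity in the form with the tensor fixed: this makes expressions in the two
  components of the comultiplication of \<open>x\<close> bilinear.\<close>

lemma lin_contract_right_form:
  assumes "E \<in> lin_hom R Q H\<^sup>*" "t \<in> carrier (M \<boxtimes> H)" "module R Q" "module R M"
  shows "(\<lambda>x. contract_right M (E x) t) \<in> lin_hom R Q M"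
  unfolding contract_right_def
  by (rule lin_tensor_lift_fun[OF assms(2,3,4) H_module assms(4)])
    (auto intro: lin_smult_left[OF lin_eval[OF assms(1)] assms(4)] contract_right_bilin[OF assms(4) H_module]
      dual_lin_hom lin_hom_closed[OF assms(1)])

lemmas intros = lin_intros lin_eval lin_contract_right lin_contract_right_form
  contract_right_closed pure_tensor_closed tensor_lift_closed dual_apply_closed
  dual_module H_module A_module H_algebra A_algebra dual_algebra self_module_module tensor_module_module
  comult_linear comult_closed dual_comult_lin_hom dual_comult_closed dual_mult_closed
  A.m_closed m_closed scalar_form_closed[OF counit_linear] counit_linear
  lin_comp[OF dual_lin_hom] dual_lin_hom

text \<open>On pure tensors both sides are x(h g) times a b. The opposite comultiplication splits
  this coefficient as x1(g) x2(h), which sends \<open>x2\<close> to the left factor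
  \<open>s\<close>.\<close>

lemma contract_right_mult:
  assumes s: "s \<in> carrier (A \<boxtimes> H)" and t: "t \<in> carrier (A \<boxtimes> H)" and x: "x \<in> carrier H\<^sup>*"
  shows "contract_right A x (s \<otimes>\<^bsub>tensor_algebra R A H\<^esub> t) =
    tensor_lift R A (\<lambda>x1 x2. contract_right A x2 s \<otimes>\<^bsub>A\<^esub> contract_right A x1 t) (comult H\<^sup>* x)"
proof -
  note bil = bilinD[OF tensor_algebra_bilin[OF A_algebra H_algebra]]
  note CR = lin_contract_right[OF _ A_module H_module dual_lin_hom[OF x]]
  have b: "bilin H\<^sup>* H\<^sup>* A (\<lambda>x1 x2. contract_right A x2 s \<otimes>\<^bsub>A\<^esub> contract_right A x1 t)"
    if "s \<in> carrier (A \<boxtimes> H)" "t \<in> carrier (A \<boxtimes> H)" for s t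
    using that by - (rule intros | assumption)+
  have ls: "(\<lambda>s. tensor_lift R A (\<lambda>x1 x2. contract_right A x2 s \<otimes>\<^bsub>A\<^esub> contract_right A x1 t) (comult H\<^sup>* x))
      \<in> lin_hom R (A \<boxtimes> H) A" if "t \<in> carrier (A \<boxtimes> H)" for t
    using that x by - (rule intros | assumption)+
  have lt: "(\<lambda>t. tensor_lift R A (\<lambda>x1 x2. contract_right A x2 s \<otimes>\<^bsub>A\<^esub> contract_right A x1 t) (comult H\<^sup>* x))
      \<in> lin_hom R (A \<boxtimes> H) A" if "s \<in> carrier (A \<boxtimes> H)" for s
    using that x by - (rule intros | assumption)+
  show ?thesis
  proof (rule tensor_lin_eq[OF A_module H_module s CR[OF bil(1)[OF t]] ls[OF t]])
    fix a h assume ah: "a \<in> carrier A" "h \<in> carrier H"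
    note ah' = pure_tensor_closed[OF A_module H_module ah]
    show "contract_right A x (pure_tensor R A H a h \<otimes>\<^bsub>tensor_algebra R A H\<^esub> t) =
      tensor_lift R A (\<lambda>x1 x2. contract_right A x2 (pure_tensor R A H a h) \<otimes>\<^bsub>A\<^esub> contract_right A x1 t) (comult H\<^sup>* x)"
    proof (rule tensor_lin_eq[OF A_module H_module t CR[OF bil(2)[OF ah']] lt[OF ah']])
      fix b g assume bg: "b \<in> carrier A" "g \<in> carrier H"
      note bg' = pure_tensor_closed[OF A_module H_module bg]
      have "tensor_lift R A (\<lambda>x1 x2. contract_right A x2 (pure_tensor R A H a h) \<otimes>\<^bsub>A\<^esub> contract_right A x1 (pure_tensor R A H b g))
          (comult H\<^sup>* x) = tensor_lift R A (\<lambda>x1 x2. (x1 g \<otimes>\<^bsub>R\<^esub> x2 h) \<odot>\<^bsub>A\<^esub> (a \<otimes>\<^bsub>A\<^esub> b)) (comult H\<^sup>* x)"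
        by (rule tensor_lift_cong[OF dual_module dual_module A_module dual_comult_closed[OF x] b[OF ah' bg']])
          (simp add: contract_right_pure[OF A_module H_module] dual_lin_hom dual_apply_closed ah bg
            A.smult_mult_left A.smult_mult_right A.smult_assoc1 R.m_comm)
      also have "\<dots> = x (h \<otimes>\<^bsub>H\<^esub> g) \<odot>\<^bsub>A\<^esub> (a \<otimes>\<^bsub>A\<^esub> b)"
        using ah bg x by (simp add: pair_smult[OF dual_module dual_module A_module dual_comult_closed[OF x]
              eval_lin_hom eval_lin_hom] dual_comult)
      finally show "contract_right A x (pure_tensor R A H a h \<otimes>\<^bsub>tensor_algebra R A H\<^esub> pure_tensor R A H b g) =
        tensor_lift R A (\<lambda>x1 x2. contract_right A x2 (pure_tensor R A H a h) \<otimes>\<^bsub>A\<^esub> contract_right A x1 (pure_tensor R A H b g))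
          (comult H\<^sup>* x)"
        using ah bg x by (simp add: tensor_algebra_pure[OF A_algebra H_algebra] contract_right_pure[OF A_module H_module] dual_lin_hom)
    qed
  qed
qed

text \<open>The right-hand side of the lax coassociativity axiom is \<open>coassoc_rhs (\<rho> b) (\<rho> 1)\<close>; the module
  axiom for \<open>H\<^sup>*\<close> needs \<open>coassoc_rhs (\<rho> b) (\<rho> a)\<close>.\<close>

definition coassoc_rhs where
  "coassoc_rhs t s = tensor_lift R AHH (\<lambda>a0 a1. tensor_lift R AHH (\<lambda>e0 e1. tensor_lift R AHH
     (\<lambda>h1 h2. pure_tensor R (A \<boxtimes> H) H (pure_tensor R A H (a0 \<otimes>\<^bsub>A\<^esub> e0) (h1 \<otimes>\<^bsub>H\<^esub> e1)) h2)
     (comult H a1)) s) t"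

lemma coassoc_rhs_bilins:
  shows "\<lbrakk>b \<in> carrier A; g \<in> carrier H\<rbrakk> \<Longrightarrow>
      bilin H H AHH (\<lambda>h1 h2. pure_tensor R (A \<boxtimes> H) H (pure_tensor R A H b (h1 \<otimes>\<^bsub>H\<^esub> g)) h2)"
    and "\<lbrakk>a \<in> carrier A; h \<in> carrier H\<rbrakk> \<Longrightarrow>
      bilin A H AHH (\<lambda>e0 e1. tensor_lift R AHH
        (\<lambda>h1 h2. pure_tensor R (A \<boxtimes> H) H (pure_tensor R A H (a \<otimes>\<^bsub>A\<^esub> e0) (h1 \<otimes>\<^bsub>H\<^esub> e1)) h2) (comult H h))"
    and "s \<in> carrier (A \<boxtimes> H) \<Longrightarrow>
      bilin A H AHH (\<lambda>a0 a1. tensor_lift R AHH (\<lambda>e0 e1. tensor_lift R AHH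
        (\<lambda>h1 h2. pure_tensor R (A \<boxtimes> H) H (pure_tensor R A H (a0 \<otimes>\<^bsub>A\<^esub> e0) (h1 \<otimes>\<^bsub>H\<^esub> e1)) h2)
        (comult H a1)) s)"
    and "bilin (A \<boxtimes> H) (A \<boxtimes> H) AHH coassoc_rhs"
  unfolding coassoc_rhs_def by (atomize (full), intro conjI impI) ((rule intros | assumption | erule conjE)+)

lemma coassoc_rhs_pure:
  assumes "a \<in> carrier A" "h \<in> carrier H" "b \<in> carrier A" "g \<in> carrier H"
  shows "coassoc_rhs (pure_tensor R A H a h) (pure_tensor R A H b g) = tensor_lift R AHH
     (\<lambda>h1 h2. pure_tensor R (A \<boxtimes> H) H (pure_tensor R A H (a \<otimes>\<^bsub>A\<^esub> b) (h1 \<otimes>\<^bsub>H\<^esub> g)) h2) (comult H h)"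
  unfolding coassoc_rhs_def using assms
  by (simp add: tensor_lift_pure[OF A_module H_module AHH_module coassoc_rhs_bilins(3)]
      tensor_lift_pure[OF A_module H_module AHH_module coassoc_rhs_bilins(2)] pure_tensor_closed[OF A_module H_module])

text \<open>On pure tensors, with \<open>h\<close> from \<open>t\<close> and \<open>g\<close> from
  \<open>s\<close>, the coefficient x(h1 g) y(h2) equals x1(g) x2(h1) y(h2), and the sum over
  \<open>comult H h\<close> turns x2 and y into their convolution at \<open>h\<close>.\<close>

lemma contract_coassoc_rhs:
  assumes t: "t \<in> carrier (A \<boxtimes> H)" and s: "s \<in> carrier (A \<boxtimes> H)" and x: "x \<in> carrier H\<^sup>*" and y: "y \<in> carrier H\<^sup>*"
  shows "contract_right A x (contract_right (A \<boxtimes> H) y (coassoc_rhs t s)) =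
    tensor_lift R A (\<lambda>x1 x2. contract_right A (x2 \<otimes>\<^bsub>H\<^sup>*\<^esub> y) t \<otimes>\<^bsub>A\<^esub> contract_right A x1 s) (comult H\<^sup>* x)"
proof -
  note xl = dual_lin_hom[OF x] and yl = dual_lin_hom[OF y]
  note \<Delta>x = dual_comult_closed[OF x]
  note bil = bilinD[OF coassoc_rhs_bilins(4)]
  have CC: "(\<lambda>u. contract_right A x (contract_right (A \<boxtimes> H) y (E u))) \<in> lin_hom R Q A"
    if "E \<in> lin_hom R Q AHH" for E Q
    by (intro lin_contract_right[OF lin_contract_right[OF that AH_module H_module yl] A_module H_module xl])
  have b: "bilin H\<^sup>* H\<^sup>* A (\<lambda>x1 x2. contract_right A (x2 \<otimes>\<^bsub>H\<^sup>*\<^esub> y) t \<otimes>\<^bsub>A\<^esub> contract_right A x1 s)"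
    if "s \<in> carrier (A \<boxtimes> H)" "t \<in> carrier (A \<boxtimes> H)" for s t
    using that y by - (rule intros | assumption)+
  have lt: "(\<lambda>t. tensor_lift R A (\<lambda>x1 x2. contract_right A (x2 \<otimes>\<^bsub>H\<^sup>*\<^esub> y) t \<otimes>\<^bsub>A\<^esub> contract_right A x1 s) (comult H\<^sup>* x))
      \<in> lin_hom R (A \<boxtimes> H) A" if "s \<in> carrier (A \<boxtimes> H)" for s
    using that x y by - (rule intros | assumption)+
  have ls: "(\<lambda>s. tensor_lift R A (\<lambda>x1 x2. contract_right A (x2 \<otimes>\<^bsub>H\<^sup>*\<^esub> y) t \<otimes>\<^bsub>A\<^esub> contract_right A x1 s) (comult H\<^sup>* x))
      \<in> lin_hom R (A \<boxtimes> H) A" if "t \<in> carrier (A \<boxtimes> H)" for t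
    using that x y by - (rule intros | assumption)+
  \<comment> \<open>Stated for every tensor \<open>u\<close> in place of \<open>comult H h\<close>,
    so that it can be checked on pure tensors.\<close>
  have scalar: "pair (\<lambda>h1. x (h1 \<otimes>\<^bsub>H\<^esub> g)) y u = pair (eval g) (\<lambda>x2. pair x2 y u) (comult H\<^sup>* x)"
    if g: "g \<in> carrier H" and u: "u \<in> carrier (H \<boxtimes> H)" for g u
  proof -
    have xg: "(\<lambda>h1. x (h1 \<otimes>\<^bsub>H\<^esub> g)) \<in> lin_hom R H scalars"
      by (intro lin_comp[OF xl] lin_mult_left lin_id H_algebra g)
    have p: "(\<lambda>x2. pair x2 y u) \<in> lin_hom R H\<^sup>* scalars" if "u \<in> carrier (H \<boxtimes> H)" for u
      unfolding pair_def using that y by - (rule intros | assumption)+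
    have r: "(\<lambda>u. pair (eval g) (\<lambda>x2. pair x2 y u) (comult H\<^sup>* x)) \<in> lin_hom R (H \<boxtimes> H) scalars"
      unfolding pair_def using g x y by - (rule intros tensor_lift_scalar_closed | assumption)+
    show ?thesis
    proof (rule tensor_lin_eq[OF H_module H_module u pair_lin_hom[OF H_module H_module xg yl] r])
      fix h h' assume h: "h \<in> carrier H" and h': "h' \<in> carrier H"
      note yh' = dual_apply_closed[OF y h']
      have "pair (eval g) (\<lambda>x2. pair x2 y (pure_tensor R H H h h')) (comult H\<^sup>* x) =
          pair (eval g) (\<lambda>x2. x2 h \<otimes>\<^bsub>R\<^esub> y h') (comult H\<^sup>* x)"
        by (rule pair_cong[OF dual_module dual_module \<Delta>x eval_lin_hom[OF g] p])
          (simp_all add: pure_tensor_closed h h' H_module pair_pure[OF H_module H_module dual_lin_hom yl])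
      also have "\<dots> = x (h \<otimes>\<^bsub>H\<^esub> g) \<otimes>\<^bsub>R\<^esub> y h'"
        by (simp add: pair_mult_right[OF dual_module dual_module \<Delta>x] eval_lin_hom g h yh' dual_comult x)
      finally show "pair (\<lambda>h1. x (h1 \<otimes>\<^bsub>H\<^esub> g)) y (pure_tensor R H H h h') =
          pair (eval g) (\<lambda>x2. pair x2 y (pure_tensor R H H h h')) (comult H\<^sup>* x)"
        by (simp add: pair_pure[OF H_module H_module xg yl] h h')
    qed
  qed
  show ?thesis
  proof (rule tensor_lin_eq[OF A_module H_module t CC[OF bil(1)[OF s]] lt[OF s]])
    fix a h assume ah: "a \<in> carrier A" "h \<in> carrier H"
    note ah' = pure_tensor_closed[OF A_module H_module ah]
    show "contract_right A x (contract_right (A \<boxtimes> H) y (coassoc_rhs (pure_tensor R A H a h) s)) =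
      tensor_lift R A (\<lambda>x1 x2. contract_right A (x2 \<otimes>\<^bsub>H\<^sup>*\<^esub> y) (pure_tensor R A H a h) \<otimes>\<^bsub>A\<^esub> contract_right A x1 s) (comult H\<^sup>* x)"
    proof (rule tensor_lin_eq[OF A_module H_module s CC[OF bil(2)[OF ah']] ls[OF ah']])
      fix b g assume bg: "b \<in> carrier A" "g \<in> carrier H"
      note bg' = pure_tensor_closed[OF A_module H_module bg]
      note ab = A.m_closed[OF ah(1) bg(1)]
      note \<delta> = comult_closed[OF ah(2)]
      note b1 = coassoc_rhs_bilins(1)[OF ab bg(2)]
      have xg: "(\<lambda>h1. x (h1 \<otimes>\<^bsub>H\<^esub> g)) \<in> lin_hom R H scalars"
        by (intro lin_comp[OF xl] lin_mult_left lin_id H_algebra bg)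
      have "contract_right A x (contract_right (A \<boxtimes> H) y (coassoc_rhs (pure_tensor R A H a h) (pure_tensor R A H b g))) =
          tensor_lift R A (\<lambda>h1 h2. contract_right A x (contract_right (A \<boxtimes> H) y
            (pure_tensor R (A \<boxtimes> H) H (pure_tensor R A H (a \<otimes>\<^bsub>A\<^esub> b) (h1 \<otimes>\<^bsub>H\<^esub> g)) h2))) (comult H h)"
        unfolding coassoc_rhs_pure[OF ah bg]
        by (rule lin_hom_tensor_lift[OF CC[OF lin_id] \<delta> b1 H_module H_module AHH_module A_module])
      also have "\<dots> = tensor_lift R A (\<lambda>h1 h2. (x (h1 \<otimes>\<^bsub>H\<^esub> g) \<otimes>\<^bsub>R\<^esub> y h2) \<odot>\<^bsub>A\<^esub> (a \<otimes>\<^bsub>A\<^esub> b)) (comult H h)"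
      proof (rule tensor_lift_cong[OF H_module H_module A_module \<delta>])
        show "bilin H H A (\<lambda>h1 h2. contract_right A x (contract_right (A \<boxtimes> H) y
            (pure_tensor R (A \<boxtimes> H) H (pure_tensor R A H (a \<otimes>\<^bsub>A\<^esub> b) (h1 \<otimes>\<^bsub>H\<^esub> g)) h2)))"
          by (intro bilinI CC bilinD[OF b1])
        fix h1 h2 assume hh: "h1 \<in> carrier H" "h2 \<in> carrier H"
        then have "y h2 \<in> carrier R" "x (h1 \<otimes>\<^bsub>H\<^esub> g) \<in> carrier R" using bg by (simp_all add: dual_apply_closed x y)
        then show "contract_right A x (contract_right (A \<boxtimes> H) y
            (pure_tensor R (A \<boxtimes> H) H (pure_tensor R A H (a \<otimes>\<^bsub>A\<^esub> b) (h1 \<otimes>\<^bsub>H\<^esub> g)) h2)) =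
          (x (h1 \<otimes>\<^bsub>H\<^esub> g) \<otimes>\<^bsub>R\<^esub> y h2) \<odot>\<^bsub>A\<^esub> (a \<otimes>\<^bsub>A\<^esub> b)"
          using hh bg ab
          by (simp add: contract_right_pure[OF AH_module H_module yl] contract_right_pure[OF A_module H_module xl]
              pure_tensor_closed[OF A_module H_module] lin_hom_smult[OF contract_right_lin_hom[OF A_module H_module xl]]
              A.smult_assoc1 R.m_comm)
      qed
      also have "\<dots> = pair (eval g) (\<lambda>x2. pair x2 y (comult H h)) (comult H\<^sup>* x) \<odot>\<^bsub>A\<^esub> (a \<otimes>\<^bsub>A\<^esub> b)"
        by (simp add: pair_smult[OF H_module H_module A_module \<delta> xg yl ab] scalar[OF bg(2) \<delta>])
      also have "\<dots> = pair (eval g) (\<lambda>x2. (x2 \<otimes>\<^bsub>H\<^sup>*\<^esub> y) h) (comult H\<^sup>* x) \<odot>\<^bsub>A\<^esub> (a \<otimes>\<^bsub>A\<^esub> b)"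
        by (simp add: dual_apply ah)
      also have "\<dots> = tensor_lift R A (\<lambda>x1 x2. (x1 g \<otimes>\<^bsub>R\<^esub> (x2 \<otimes>\<^bsub>H\<^sup>*\<^esub> y) h) \<odot>\<^bsub>A\<^esub> (a \<otimes>\<^bsub>A\<^esub> b)) (comult H\<^sup>* x)"
        by (rule pair_smult[OF dual_module dual_module A_module \<Delta>x eval_lin_hom[OF bg(2)] _ ab, symmetric])
          (intro lin_eval lin_mult_left lin_id dual_algebra y ah)
      also have "\<dots> = tensor_lift R A (\<lambda>x1 x2. contract_right A (x2 \<otimes>\<^bsub>H\<^sup>*\<^esub> y) (pure_tensor R A H a h) \<otimes>\<^bsub>A\<^esub>
          contract_right A x1 (pure_tensor R A H b g)) (comult H\<^sup>* x)"
        by (rule tensor_lift_cong[OF dual_module dual_module A_module \<Delta>x b[OF bg' ah'], symmetric])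
          (simp add: contract_right_pure[OF A_module H_module dual_lin_hom] dual_mult_closed y dual_apply_closed ah bg
            A.smult_mult_left A.smult_mult_right A.smult_assoc1 R.m_comm)
      finally show "contract_right A x (contract_right (A \<boxtimes> H) y (coassoc_rhs (pure_tensor R A H a h) (pure_tensor R A H b g))) =
        tensor_lift R A (\<lambda>x1 x2. contract_right A (x2 \<otimes>\<^bsub>H\<^sup>*\<^esub> y) (pure_tensor R A H a h) \<otimes>\<^bsub>A\<^esub>
          contract_right A x1 (pure_tensor R A H b g)) (comult H\<^sup>* x)" .
    qed
  qed
qed

text \<open>Right multiplication by \<open>v\<close> on the first two factors, with the last one
  untouched.\<close>

definition times_tensor where
  "times_tensor v = tensor_lift R AHH (\<lambda>u h. pure_tensor R (A \<boxtimes> H) H (u \<otimes>\<^bsub>tensor_algebra R A H\<^esub> v) h)"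

lemma times_tensor_bilin:
  assumes "v \<in> carrier (A \<boxtimes> H)"
  shows "bilin (A \<boxtimes> H) H AHH (\<lambda>u h. pure_tensor R (A \<boxtimes> H) H (u \<otimes>\<^bsub>tensor_algebra R A H\<^esub> v) h)"
proof -
  note bil = bilinD[OF tensor_algebra_bilin[OF A_algebra H_algebra]]
  show ?thesis using assms by - (rule intros bil | assumption)+
qed

lemma times_tensor_lin_hom: "v \<in> carrier (A \<boxtimes> H) \<Longrightarrow> times_tensor v \<in> lin_hom R AHH AHH"
  unfolding times_tensor_def by (rule tensor_lift_lin_hom[OF AH_module H_module AHH_module times_tensor_bilin])

lemma times_tensor_pure:
  "\<lbrakk>v \<in> carrier (A \<boxtimes> H); u \<in> carrier (A \<boxtimes> H); h \<in> carrier H\<rbrakk> \<Longrightarrow>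
     times_tensor v (pure_tensor R (A \<boxtimes> H) H u h) = pure_tensor R (A \<boxtimes> H) H (u \<otimes>\<^bsub>tensor_algebra R A H\<^esub> v) h"
  unfolding times_tensor_def by (rule tensor_lift_pure[OF AH_module H_module AHH_module times_tensor_bilin])

text \<open>On pure tensors this is associativity in \<open>A\<close> and in \<open>H\<close>: the
  factor \<open>s\<close> multiplies \<open>t\<close> from the right, and \<open>v\<close>
  multiplies \<open>s\<close> from the right.\<close>

lemma times_tensor_coassoc_rhs:
  assumes t: "t \<in> carrier (A \<boxtimes> H)" and s: "s \<in> carrier (A \<boxtimes> H)" and v: "v \<in> carrier (A \<boxtimes> H)"
  shows "times_tensor v (coassoc_rhs t s) = coassoc_rhs t (s \<otimes>\<^bsub>tensor_algebra R A H\<^esub> v)"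
proof -
  note AH = A_module H_module
  note bil = bilinD[OF tensor_algebra_bilin[OF A_algebra H_algebra]]
  note cbil = bilinD[OF coassoc_rhs_bilins(4)]
  have lv: "(\<lambda>v. times_tensor v w) \<in> lin_hom R (A \<boxtimes> H) AHH" if "w \<in> carrier AHH" for w
    unfolding times_tensor_def using that by - (rule intros bil | assumption)+
  show ?thesis
  proof (rule tensor_lin_eq[OF AH t lin_comp[OF times_tensor_lin_hom[OF v] cbil(1)[OF s]] cbil(1)[OF bil(3)[OF s v]]])
    fix a h assume ah: "a \<in> carrier A" "h \<in> carrier H"
    note ah' = pure_tensor_closed[OF AH ah]
    show "times_tensor v (coassoc_rhs (pure_tensor R A H a h) s) =
      coassoc_rhs (pure_tensor R A H a h) (s \<otimes>\<^bsub>tensor_algebra R A H\<^esub> v)"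
    proof (rule tensor_lin_eq[OF AH s lin_comp[OF times_tensor_lin_hom[OF v] cbil(2)[OF ah']] lin_comp[OF cbil(2)[OF ah'] bil(1)[OF v]]])
      fix b g assume bg: "b \<in> carrier A" "g \<in> carrier H"
      note bg' = pure_tensor_closed[OF AH bg]
      show "times_tensor v (coassoc_rhs (pure_tensor R A H a h) (pure_tensor R A H b g)) =
        coassoc_rhs (pure_tensor R A H a h) (pure_tensor R A H b g \<otimes>\<^bsub>tensor_algebra R A H\<^esub> v)"
      proof (rule tensor_lin_eq[OF AH v lv[OF cbil(3)[OF ah' bg']] lin_comp[OF cbil(2)[OF ah'] bil(2)[OF bg']]])
        fix d l assume dl: "d \<in> carrier A" "l \<in> carrier H"
        note dl' = pure_tensor_closed[OF AH dl]
        note ab = A.m_closed[OF ah(1) bg(1)]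
        note b1 = coassoc_rhs_bilins(1)[OF ab bg(2)]
        note \<delta> = comult_closed[OF ah(2)]
        let ?w = "pure_tensor R A H d l"
        have "times_tensor ?w (coassoc_rhs (pure_tensor R A H a h) (pure_tensor R A H b g)) =
          tensor_lift R AHH (\<lambda>h1 h2. times_tensor ?w
            (pure_tensor R (A \<boxtimes> H) H (pure_tensor R A H (a \<otimes>\<^bsub>A\<^esub> b) (h1 \<otimes>\<^bsub>H\<^esub> g)) h2)) (comult H h)"
          unfolding coassoc_rhs_pure[OF ah bg]
          by (rule lin_hom_tensor_lift[OF times_tensor_lin_hom[OF dl'] \<delta> b1 H_module H_module AHH_module AHH_module])
        also have "\<dots> = tensor_lift R AHH (\<lambda>h1 h2.
            pure_tensor R (A \<boxtimes> H) H (pure_tensor R A H (a \<otimes>\<^bsub>A\<^esub> (b \<otimes>\<^bsub>A\<^esub> d)) (h1 \<otimes>\<^bsub>H\<^esub> (g \<otimes>\<^bsub>H\<^esub> l))) h2) (comult H h)"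
          by (rule tensor_lift_cong[OF H_module H_module AHH_module \<delta>])
            (use ah bg dl in \<open>auto simp: times_tensor_pure pure_tensor_closed[OF AH] tensor_algebra_pure[OF A_algebra H_algebra]
                A.m_assoc m_assoc intro!: bilinI lin_comp[OF times_tensor_lin_hom[OF dl']] bilinD[OF b1]\<close>)
        also have "\<dots> = coassoc_rhs (pure_tensor R A H a h) (pure_tensor R A H b g \<otimes>\<^bsub>tensor_algebra R A H\<^esub> ?w)"
          using ah bg dl by (simp add: tensor_algebra_pure[OF A_algebra H_algebra] coassoc_rhs_pure)
        finally show "times_tensor ?w (coassoc_rhs (pure_tensor R A H a h) (pure_tensor R A H b g)) =
          coassoc_rhs (pure_tensor R A H a h) (pure_tensor R A H b g \<otimes>\<^bsub>tensor_algebra R A H\<^esub> ?w)" .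
      qed
    qed
  qed
qed

lemma AH_eqI:
  assumes "s \<in> carrier (A \<boxtimes> H)" "t \<in> carrier (A \<boxtimes> H)"
    and "\<And>x. x \<in> carrier H\<^sup>* \<Longrightarrow> contract_right A x s = contract_right A x t"
  shows "s = t"
  using assms by (intro contract_right_eqI[OF A_module H_module basis]) (simp_all add: dual_simps)

lemma AHH_eqI:
  assumes "s \<in> carrier AHH" "t \<in> carrier AHH"
    and "\<And>x y. \<lbrakk>x \<in> carrier H\<^sup>*; y \<in> carrier H\<^sup>*\<rbrakk> \<Longrightarrow>
      contract_right A x (contract_right (A \<boxtimes> H) y s) = contract_right A x (contract_right (A \<boxtimes> H) y t)"
  shows "s = t"
proof (rule contract_right_eqI[OF AH_module H_module basis assms(1,2)])
  fix y assume "y \<in> lin_hom R H scalars \<inter> extensional (carrier H)"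
  then have y: "y \<in> carrier H\<^sup>*" by (simp add: dual_simps)
  show "contract_right (A \<boxtimes> H) y s = contract_right (A \<boxtimes> H) y t"
    using assms y contract_right_closed[OF _ AH_module H_module dual_lin_hom[OF y]] by (intro AH_eqI) auto
qed

abbreviation "\<epsilon> \<equiv> \<one>\<^bsub>H\<^sup>*\<^esub>"

text \<open>The unit \<open>\<epsilon>\<close> of the dual is the counit restricted to the carrier,
  and a contraction sees its form only there. Counit conditions thereby become statements about the
  action of \<open>\<epsilon>\<close>.\<close>

lemma contract_counit:
  assumes "module R M" "t \<in> carrier (M \<boxtimes> H)"
  shows "tensor_lift R M (\<lambda>m h. counit H h \<odot>\<^bsub>M\<^esub> m) t = contract_right M \<epsilon> t"
  using contract_right_cong[OF assms(2,1) H_module counit_linear, of \<epsilon>]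
  by (simp add: contract_right_def dual_apply)

section \<open>Translation of the coaction axioms into the action\<close>

context
  fixes \<rho> assumes \<rho>: "\<rho> \<in> lin_hom R A (A \<boxtimes> H)"
begin

private lemmas \<rho>_closed = lin_hom_closed[OF \<rho>]

private abbreviation act (infixr \<open>\<cdot>\<close> 75) where "x \<cdot> a \<equiv> contract_right A x (\<rho> a)"

private lemma act_closed: "\<lbrakk>x \<in> carrier H\<^sup>*; a \<in> carrier A\<rbrakk> \<Longrightarrow> x \<cdot> a \<in> carrier A"
  by (rule contract_right_closed[OF \<rho>_closed A_module H_module dual_lin_hom])

lemma dual_action_bilin: "bilin H\<^sup>* A A (\<lambda>x a. x \<cdot> a)"
  by (rule intros \<rho> \<rho>_closed | assumption)+

lemma dual_action_eq:
  "dual_action R H A \<rho> = restrict (tensor_lift R A (\<lambda>x a. x \<cdot> a)) (carrier (H\<^sup>* \<boxtimes> A))"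
  unfolding dual_action_def dual_tensor contract_right_def ..

lemma dual_action_lin_hom: "dual_action R H A \<rho> \<in> lin_hom R (H\<^sup>* \<boxtimes> A) A \<inter> extensional (carrier (H\<^sup>* \<boxtimes> A))"
  unfolding dual_action_eq
  by (auto intro: lin_hom_cong[OF tensor_lift_lin_hom[OF dual_module A_module A_module dual_action_bilin]
      tensor_module_module[OF dual_module A_module]])

lemma dual_action_pure:
  "\<lbrakk>x \<in> carrier H\<^sup>*; a \<in> carrier A\<rbrakk> \<Longrightarrow> dual_action R H A \<rho> (pure_tensor R H\<^sup>* A x a) = x \<cdot> a"
  unfolding dual_action_eq
  by (simp add: pure_tensor_closed dual_module A_module tensor_lift_pure[OF dual_module A_module A_module dual_action_bilin])

text \<open>All products are written in \<open>A\<close>; the module axiom for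
  \<open>opposite A\<close> therefore appears with both of its products reversed.\<close>

lemma coaction_mult_iff:
  "(\<forall>a\<in>carrier A. \<forall>b\<in>carrier A. \<rho> (a \<otimes>\<^bsub>A\<^esub> b) = \<rho> a \<otimes>\<^bsub>tensor_algebra R A H\<^esub> \<rho> b) \<longleftrightarrow>
   (\<forall>x\<in>carrier H\<^sup>*. \<forall>a\<in>carrier A. \<forall>b\<in>carrier A.
      x \<cdot> (b \<otimes>\<^bsub>A\<^esub> a) = tensor_lift R A (\<lambda>x1 x2. (x2 \<cdot> b) \<otimes>\<^bsub>A\<^esub> (x1 \<cdot> a)) (comult H\<^sup>* x))"
  (is "?l \<longleftrightarrow> ?r")
proof
  assume ?l
  then show ?r by (simp add: contract_right_mult \<rho>_closed)
next
  assume r: ?r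
  note bil = bilinD[OF tensor_algebra_bilin[OF A_algebra H_algebra]]
  show ?l
    by (intro ballI AH_eqI \<rho>_closed A.m_closed bil(3)) (simp_all add: r contract_right_mult \<rho>_closed)
qed

text \<open>At \<open>t = \<rho> b\<close> this is \<rho>(b_0 a) \<otimes> b_1, and for
  \<open>a = 1\<close> it is the twofold coaction of \<open>b\<close>.\<close>

private definition "shifted t a = tensor_lift R AHH (\<lambda>b0 b1. pure_tensor R (A \<boxtimes> H) H (\<rho> (b0 \<otimes>\<^bsub>A\<^esub> a)) b1) t"

private lemma shifted_bilin:
  "a \<in> carrier A \<Longrightarrow> bilin A H AHH (\<lambda>b0 b1. pure_tensor R (A \<boxtimes> H) H (\<rho> (b0 \<otimes>\<^bsub>A\<^esub> a)) b1)"
  by (rule intros lin_comp[OF \<rho>] \<rho>_closed | assumption)+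

private lemma shifted_lin_hom: "a \<in> carrier A \<Longrightarrow> (\<lambda>t. shifted t a) \<in> lin_hom R (A \<boxtimes> H) AHH"
  unfolding shifted_def by (rule tensor_lift_lin_hom[OF A_module H_module AHH_module shifted_bilin])

private lemma shifted_pure:
  "\<lbrakk>a \<in> carrier A; b \<in> carrier A; h \<in> carrier H\<rbrakk> \<Longrightarrow>
    shifted (pure_tensor R A H b h) a = pure_tensor R (A \<boxtimes> H) H (\<rho> (b \<otimes>\<^bsub>A\<^esub> a)) h"
  unfolding shifted_def by (rule tensor_lift_pure[OF A_module H_module AHH_module shifted_bilin])

private lemma contract_shifted:
  assumes t: "t \<in> carrier (A \<boxtimes> H)" and a: "a \<in> carrier A" and x: "x \<in> carrier H\<^sup>*" and y: "y \<in> carrier H\<^sup>*"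
  shows "contract_right A x (contract_right (A \<boxtimes> H) y (shifted t a)) = x \<cdot> (contract_right A y t \<otimes>\<^bsub>A\<^esub> a)"
proof (rule tensor_lin_eq[OF A_module H_module t])
  note xl = dual_lin_hom[OF x] and yl = dual_lin_hom[OF y]
  show "(\<lambda>t. contract_right A x (contract_right (A \<boxtimes> H) y (shifted t a))) \<in> lin_hom R (A \<boxtimes> H) A"
    by (rule lin_contract_right[OF lin_contract_right[OF shifted_lin_hom[OF a] AH_module H_module yl] A_module H_module xl])
  show "(\<lambda>t. x \<cdot> (contract_right A y t \<otimes>\<^bsub>A\<^esub> a)) \<in> lin_hom R (A \<boxtimes> H) A"
    by (rule lin_contract_right[OF lin_comp[OF \<rho> lin_mult_left[OF contract_right_lin_hom[OF A_module H_module yl]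
            A_algebra a]] A_module H_module xl])
  fix b h assume bh: "b \<in> carrier A" "h \<in> carrier H"
  then show "contract_right A x (contract_right (A \<boxtimes> H) y (shifted (pure_tensor R A H b h) a)) =
      x \<cdot> (contract_right A y (pure_tensor R A H b h) \<otimes>\<^bsub>A\<^esub> a)"
    using a dual_apply_closed[OF y]
    by (simp add: shifted_pure contract_right_pure[OF AH_module H_module yl] contract_right_pure[OF A_module H_module yl]
        \<rho>_closed A.smult_mult_left lin_hom_smult[OF \<rho>])
qed

lemma coaction_coassoc_iff:
  assumes mult: "\<And>a b. \<lbrakk>a \<in> carrier A; b \<in> carrier A\<rbrakk> \<Longrightarrow> \<rho> (a \<otimes>\<^bsub>A\<^esub> b) = \<rho> a \<otimes>\<^bsub>tensor_algebra R A H\<^esub> \<rho> b"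
  shows "(\<forall>a\<in>carrier A. tensor_lift R AHH (\<lambda>a0 a1. pure_tensor R (A \<boxtimes> H) H (\<rho> a0) a1) (\<rho> a) =
      coassoc_rhs (\<rho> a) (\<rho> \<one>\<^bsub>A\<^esub>)) \<longleftrightarrow>
    (\<forall>x\<in>carrier H\<^sup>*. \<forall>y\<in>carrier H\<^sup>*. \<forall>a\<in>carrier A. \<forall>b\<in>carrier A. x \<cdot> ((y \<cdot> b) \<otimes>\<^bsub>A\<^esub> a) =
      tensor_lift R A (\<lambda>x1 x2. ((x2 \<otimes>\<^bsub>H\<^sup>*\<^esub> y) \<cdot> b) \<otimes>\<^bsub>A\<^esub> (x1 \<cdot> a)) (comult H\<^sup>* x))"
  (is "?l \<longleftrightarrow> ?r")
proof -
  have one: "tensor_lift R AHH (\<lambda>a0 a1. pure_tensor R (A \<boxtimes> H) H (\<rho> a0) a1) t = shifted t \<one>\<^bsub>A\<^esub>"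
    if "t \<in> carrier (A \<boxtimes> H)" for t
    unfolding shifted_def
    by (rule tensor_lift_cong[OF A_module H_module AHH_module that shifted_bilin[OF A.one_closed], symmetric]) simp
  \<comment> \<open>Multiplicativity of the coaction enters here: \<rho>(b_0) \<rho>(a) is
    \<rho>(b_0 a).\<close>
  have times: "times_tensor (\<rho> a) (shifted t \<one>\<^bsub>A\<^esub>) = shifted t a" if t: "t \<in> carrier (A \<boxtimes> H)" and a: "a \<in> carrier A" for t a
    by (rule tensor_lin_eq[OF A_module H_module t lin_comp[OF times_tensor_lin_hom[OF \<rho>_closed[OF a]]
            shifted_lin_hom[OF A.one_closed]] shifted_lin_hom[OF a]])
      (simp add: shifted_pure a times_tensor_pure \<rho>_closed mult)
  have shifted_closed: "shifted t a \<in> carrier AHH" if "t \<in> carrier (A \<boxtimes> H)" "a \<in> carrier A" for t a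
    by (rule lin_hom_closed[OF shifted_lin_hom]) (rule that)+
  note rhs_closed = bilinD(3)[OF coassoc_rhs_bilins(4)]
  \<comment> \<open>Lax coassociativity is the instance \<open>a = 1\<close> of the statement for
    all \<open>a\<close>. The way up multiplies that instance by \<open>\<rho> a\<close>, which
    absorbs the factor \<rho>(1).\<close>
  have "?l \<longleftrightarrow> (\<forall>b\<in>carrier A. \<forall>a\<in>carrier A. shifted (\<rho> b) a = coassoc_rhs (\<rho> b) (\<rho> a))"
  proof (intro iffI ballI)
    fix a b assume l: ?l and a: "a \<in> carrier A" and b: "b \<in> carrier A"
    have "shifted (\<rho> b) a = times_tensor (\<rho> a) (coassoc_rhs (\<rho> b) (\<rho> \<one>\<^bsub>A\<^esub>))"
      using bspec[OF l b] times[OF \<rho>_closed[OF b] a] one[OF \<rho>_closed[OF b]] by metis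
    also have "\<dots> = coassoc_rhs (\<rho> b) (\<rho> a)"
      using times_tensor_coassoc_rhs[OF \<rho>_closed[OF b] \<rho>_closed[OF A.one_closed] \<rho>_closed[OF a]]
        mult[OF A.one_closed a] a by simp
    finally show "shifted (\<rho> b) a = coassoc_rhs (\<rho> b) (\<rho> a)" .
  qed (simp add: one \<rho>_closed)
  also have "\<dots> \<longleftrightarrow> ?r"
  proof (intro iffI ballI)
    fix x y a b
    assume "\<forall>b\<in>carrier A. \<forall>a\<in>carrier A. shifted (\<rho> b) a = coassoc_rhs (\<rho> b) (\<rho> a)"
      and xyab: "x \<in> carrier H\<^sup>*" "y \<in> carrier H\<^sup>*" "a \<in> carrier A" "b \<in> carrier A"
    then have "contract_right A x (contract_right (A \<boxtimes> H) y (shifted (\<rho> b) a)) =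
        contract_right A x (contract_right (A \<boxtimes> H) y (coassoc_rhs (\<rho> b) (\<rho> a)))" by simp
    then show "x \<cdot> ((y \<cdot> b) \<otimes>\<^bsub>A\<^esub> a) =
        tensor_lift R A (\<lambda>x1 x2. ((x2 \<otimes>\<^bsub>H\<^sup>*\<^esub> y) \<cdot> b) \<otimes>\<^bsub>A\<^esub> (x1 \<cdot> a)) (comult H\<^sup>* x)"
      using xyab by (simp add: contract_shifted contract_coassoc_rhs \<rho>_closed)
  next
    fix a b assume r: ?r and ab: "b \<in> carrier A" "a \<in> carrier A"
    show "shifted (\<rho> b) a = coassoc_rhs (\<rho> b) (\<rho> a)"
      by (rule AHH_eqI) (use r ab in \<open>simp_all add: shifted_closed rhs_closed \<rho>_closed contract_shifted contract_coassoc_rhs\<close>)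
  qed
  finally show ?thesis .
qed

lemma coaction_counit_iff:
  assumes a: "a \<in> carrier A"
  shows "tensor_lift R A (\<lambda>a0 a1. counit H a1 \<odot>\<^bsub>A\<^esub> a0) (\<rho> a) =
      tensor_lift R A (\<lambda>e0 e1. counit H e1 \<odot>\<^bsub>A\<^esub> (e0 \<otimes>\<^bsub>A\<^esub> a)) (\<rho> \<one>\<^bsub>A\<^esub>) \<longleftrightarrow>
    (\<epsilon> \<cdot> \<one>\<^bsub>A\<^esub>) \<otimes>\<^bsub>A\<^esub> a = \<epsilon> \<cdot> a"
proof -
  have "tensor_lift R A (\<lambda>e0 e1. counit H e1 \<odot>\<^bsub>A\<^esub> (e0 \<otimes>\<^bsub>A\<^esub> a)) (\<rho> \<one>\<^bsub>A\<^esub>) =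
      tensor_lift R A (\<lambda>e0 e1. (counit H e1 \<odot>\<^bsub>A\<^esub> e0) \<otimes>\<^bsub>A\<^esub> a) (\<rho> \<one>\<^bsub>A\<^esub>)"
  proof (rule tensor_lift_cong[OF A_module H_module A_module \<rho>_closed[OF A.one_closed]])
    show "bilin A H A (\<lambda>e0 e1. counit H e1 \<odot>\<^bsub>A\<^esub> (e0 \<otimes>\<^bsub>A\<^esub> a))"
      using a by - (rule intros | assumption)+
  qed (use a in \<open>simp add: A.smult_mult_left scalar_form_closed[OF counit_linear]\<close>)
  \<comment> \<open>Right multiplication by \<open>a\<close> is linear, so it comes out of the
    Sweedler sum.\<close>
  also have "\<dots> = tensor_lift R A (\<lambda>e0 e1. counit H e1 \<odot>\<^bsub>A\<^esub> e0) (\<rho> \<one>\<^bsub>A\<^esub>) \<otimes>\<^bsub>A\<^esub> a"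
    by (rule lin_hom_tensor_lift[symmetric, OF lin_mult_left[OF lin_id A_algebra a] \<rho>_closed[OF A.one_closed]
          contract_right_bilin[OF A_module H_module counit_linear] A_module H_module A_module A_module])
  finally show ?thesis using a by (auto simp: contract_counit[OF A_module] \<rho>_closed)
qed

lemma coaction_one_iff:
  "\<rho> \<one>\<^bsub>A\<^esub> = tensor_lift R (A \<boxtimes> H)
     (\<lambda>d0 d1. tensor_lift R (A \<boxtimes> H)
       (\<lambda>e0 e1. pure_tensor R A H (counit H d1 \<odot>\<^bsub>A\<^esub> (d0 \<otimes>\<^bsub>A\<^esub> e0)) e1) (\<rho> \<one>\<^bsub>A\<^esub>)) (\<rho> \<one>\<^bsub>A\<^esub>) \<longleftrightarrow>
   (\<forall>x\<in>carrier H\<^sup>*. x \<cdot> \<one>\<^bsub>A\<^esub> = (\<epsilon> \<cdot> \<one>\<^bsub>A\<^esub>) \<otimes>\<^bsub>A\<^esub> (x \<cdot> \<one>\<^bsub>A\<^esub>))"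
proof -
  \<comment> \<open>The right side of the axiom with its two copies of \<rho>(1) decoupled. As a
    bilinear map it can be checked on pure tensors, where it multiplies the first factor of
    \<open>t\<close> from the left by (id \<otimes> counit)(s).\<close>
  define V where "V s t = tensor_lift R (A \<boxtimes> H) (\<lambda>d0 d1. tensor_lift R (A \<boxtimes> H)
       (\<lambda>e0 e1. pure_tensor R A H (counit H d1 \<odot>\<^bsub>A\<^esub> (d0 \<otimes>\<^bsub>A\<^esub> e0)) e1) t) s" for s t
  note smult = A.smult_closed scalar_form_closed[OF counit_linear]
  have b1: "bilin A H (A \<boxtimes> H) (\<lambda>e0 e1. pure_tensor R A H (counit H h \<odot>\<^bsub>A\<^esub> (a \<otimes>\<^bsub>A\<^esub> e0)) e1)"
    if "a \<in> carrier A" "h \<in> carrier H" for a h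
    using that by - (rule intros smult | assumption)+
  have b2: "bilin A H (A \<boxtimes> H) (\<lambda>d0 d1. tensor_lift R (A \<boxtimes> H)
       (\<lambda>e0 e1. pure_tensor R A H (counit H d1 \<odot>\<^bsub>A\<^esub> (d0 \<otimes>\<^bsub>A\<^esub> e0)) e1) t)" if "t \<in> carrier (A \<boxtimes> H)" for t
    using that by - (rule intros smult | assumption)+
  have V: "bilin (A \<boxtimes> H) (A \<boxtimes> H) (A \<boxtimes> H) V"
    unfolding V_def by (rule intros smult | assumption)+
  have V_pure: "V (pure_tensor R A H a h) (pure_tensor R A H b g) = pure_tensor R A H (counit H h \<odot>\<^bsub>A\<^esub> (a \<otimes>\<^bsub>A\<^esub> b)) g"
    if "a \<in> carrier A" "h \<in> carrier H" "b \<in> carrier A" "g \<in> carrier H" for a h b g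
    unfolding V_def using that
    by (simp add: tensor_lift_pure[OF A_module H_module AH_module b2] tensor_lift_pure[OF A_module H_module AH_module b1]
        pure_tensor_closed[OF A_module H_module])
  have contract_V: "contract_right A x (V s t) = contract_right A \<epsilon> s \<otimes>\<^bsub>A\<^esub> contract_right A x t"
    if x: "x \<in> carrier H\<^sup>*" and s: "s \<in> carrier (A \<boxtimes> H)" and t: "t \<in> carrier (A \<boxtimes> H)" for x s t
  proof -
    note xl = dual_lin_hom[OF x] and \<epsilon>l = dual_lin_hom[OF dual_one_closed]
    note CR = lin_contract_right[OF _ A_module H_module xl]
    note CR_closed = contract_right_closed[OF _ A_module H_module]
    show ?thesis
    proof (rule tensor_lin_eq[OF A_module H_module s CR[OF bilinD(1)[OF V t]]])
      show "(\<lambda>s. contract_right A \<epsilon> s \<otimes>\<^bsub>A\<^esub> contract_right A x t) \<in> lin_hom R (A \<boxtimes> H) A"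
        by (rule lin_mult_left[OF contract_right_lin_hom[OF A_module H_module \<epsilon>l] A_algebra CR_closed[OF t xl]])
      fix a h assume ah: "a \<in> carrier A" "h \<in> carrier H"
      note ah' = pure_tensor_closed[OF A_module H_module ah]
      show "contract_right A x (V (pure_tensor R A H a h) t) =
        contract_right A \<epsilon> (pure_tensor R A H a h) \<otimes>\<^bsub>A\<^esub> contract_right A x t"
      proof (rule tensor_lin_eq[OF A_module H_module t CR[OF bilinD(2)[OF V ah']]])
        show "(\<lambda>t. contract_right A \<epsilon> (pure_tensor R A H a h) \<otimes>\<^bsub>A\<^esub> contract_right A x t) \<in> lin_hom R (A \<boxtimes> H) A"
          by (rule lin_mult_right[OF contract_right_lin_hom[OF A_module H_module xl] A_algebra CR_closed[OF ah' \<epsilon>l]])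
        fix b g assume bg: "b \<in> carrier A" "g \<in> carrier H"
        show "contract_right A x (V (pure_tensor R A H a h) (pure_tensor R A H b g)) =
          contract_right A \<epsilon> (pure_tensor R A H a h) \<otimes>\<^bsub>A\<^esub> contract_right A x (pure_tensor R A H b g)"
          using ah bg dual_apply_closed[OF x] scalar_form_closed[OF counit_linear]
          by (simp add: V_pure contract_right_pure[OF A_module H_module xl] contract_right_pure[OF A_module H_module \<epsilon>l]
              dual_apply A.smult_mult_left A.smult_mult_right)
      qed
    qed
  qed
  have one: "\<rho> \<one>\<^bsub>A\<^esub> \<in> carrier (A \<boxtimes> H)" by (simp add: \<rho>_closed)
  have "\<rho> \<one>\<^bsub>A\<^esub> = V (\<rho> \<one>\<^bsub>A\<^esub>) (\<rho> \<one>\<^bsub>A\<^esub>) \<longleftrightarrow>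
      (\<forall>x\<in>carrier H\<^sup>*. x \<cdot> \<one>\<^bsub>A\<^esub> = (\<epsilon> \<cdot> \<one>\<^bsub>A\<^esub>) \<otimes>\<^bsub>A\<^esub> (x \<cdot> \<one>\<^bsub>A\<^esub>))"
  proof
    assume "\<rho> \<one>\<^bsub>A\<^esub> = V (\<rho> \<one>\<^bsub>A\<^esub>) (\<rho> \<one>\<^bsub>A\<^esub>)"
    then show "\<forall>x\<in>carrier H\<^sup>*. x \<cdot> \<one>\<^bsub>A\<^esub> = (\<epsilon> \<cdot> \<one>\<^bsub>A\<^esub>) \<otimes>\<^bsub>A\<^esub> (x \<cdot> \<one>\<^bsub>A\<^esub>)"
      using contract_V[OF _ one one] by metis
  next
    assume r: "\<forall>x\<in>carrier H\<^sup>*. x \<cdot> \<one>\<^bsub>A\<^esub> = (\<epsilon> \<cdot> \<one>\<^bsub>A\<^esub>) \<otimes>\<^bsub>A\<^esub> (x \<cdot> \<one>\<^bsub>A\<^esub>)"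
    show "\<rho> \<one>\<^bsub>A\<^esub> = V (\<rho> \<one>\<^bsub>A\<^esub>) (\<rho> \<one>\<^bsub>A\<^esub>)"
      by (rule AH_eqI[OF one bilinD(3)[OF V one one]]) (simp only: contract_V one bspec[OF r, symmetric])
  qed
  then show ?thesis unfolding V_def .
qed

section \<open>Equivalence of the lax and of the partial notions\<close>

lemma lax_comodule_iff_lax_module:
  "lax_comodule_algebra R H A \<rho> \<longleftrightarrow> lax_module_algebra R H\<^sup>* (opposite A) (dual_action R H A \<rho>)"
proof -
  \<comment> \<open>Every condition is put in terms of the action and the product of
    \<open>A\<close>. The letters C and M mark comodule and module axioms; \<open>C3\<close> is
    common to both sides, being the counit axiom on one and the law for the unit of the dual on the
    other.\<close>
  define C3 where "C3 \<longleftrightarrow> (\<forall>a\<in>carrier A. (\<epsilon> \<cdot> \<one>\<^bsub>A\<^esub>) \<otimes>\<^bsub>A\<^esub> a = \<epsilon> \<cdot> a)"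
  define M1 where "M1 \<longleftrightarrow> (\<forall>x\<in>carrier H\<^sup>*. \<forall>a\<in>carrier A. \<forall>b\<in>carrier A.
      x \<cdot> (b \<otimes>\<^bsub>A\<^esub> a) = tensor_lift R A (\<lambda>x1 x2. (x2 \<cdot> b) \<otimes>\<^bsub>A\<^esub> (x1 \<cdot> a)) (comult H\<^sup>* x))"
  define M2 where "M2 \<longleftrightarrow> (\<forall>x\<in>carrier H\<^sup>*. \<forall>y\<in>carrier H\<^sup>*. \<forall>a\<in>carrier A. \<forall>b\<in>carrier A. x \<cdot> ((y \<cdot> b) \<otimes>\<^bsub>A\<^esub> a) =
      tensor_lift R A (\<lambda>x1 x2. ((x2 \<otimes>\<^bsub>H\<^sup>*\<^esub> y) \<cdot> b) \<otimes>\<^bsub>A\<^esub> (x1 \<cdot> a)) (comult H\<^sup>* x))"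
  define C4 where "C4 \<longleftrightarrow> (\<forall>x\<in>carrier H\<^sup>*. x \<cdot> \<one>\<^bsub>A\<^esub> = (\<epsilon> \<cdot> \<one>\<^bsub>A\<^esub>) \<otimes>\<^bsub>A\<^esub> (x \<cdot> \<one>\<^bsub>A\<^esub>))"
  define M4 where "M4 \<longleftrightarrow> (\<forall>x\<in>carrier H\<^sup>*. \<forall>a\<in>carrier A. (x \<cdot> \<one>\<^bsub>A\<^esub>) \<otimes>\<^bsub>A\<^esub> a = \<epsilon> \<cdot> ((x \<cdot> \<one>\<^bsub>A\<^esub>) \<otimes>\<^bsub>A\<^esub> a))"
  \<comment> \<open>Under \<open>C3\<close>, acting by \<open>\<epsilon>\<close> is left
    multiplication by \<open>\<epsilon> \<cdot> 1\<close>. Multiplying \<open>C4\<close> by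
    \<open>a\<close> on the right then gives \<open>M4\<close>, and \<open>a = 1\<close> leads
    back.\<close>
  have "C4 \<longleftrightarrow> M4" if c3: C3
  proof -
    have *: "\<epsilon> \<cdot> a = (\<epsilon> \<cdot> \<one>\<^bsub>A\<^esub>) \<otimes>\<^bsub>A\<^esub> a" if "a \<in> carrier A" for a using c3 that by (simp add: C3_def)
    show ?thesis
    proof
      assume C4
      then show M4 unfolding M4_def C4_def
        by (intro ballI, subst *) (auto simp: act_closed dual_one_closed A.m_assoc[symmetric])
    next
      assume m4: M4
      show C4 unfolding C4_def
      proof
        fix x assume x: "x \<in> carrier H\<^sup>*"
        note xc = act_closed[OF x A.one_closed]
        have "(x \<cdot> \<one>\<^bsub>A\<^esub>) \<otimes>\<^bsub>A\<^esub> \<one>\<^bsub>A\<^esub> = \<epsilon> \<cdot> ((x \<cdot> \<one>\<^bsub>A\<^esub>) \<otimes>\<^bsub>A\<^esub> \<one>\<^bsub>A\<^esub>)"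
          using m4 x unfolding M4_def by blast
        then have "x \<cdot> \<one>\<^bsub>A\<^esub> = \<epsilon> \<cdot> (x \<cdot> \<one>\<^bsub>A\<^esub>)" using xc by simp
        then show "x \<cdot> \<one>\<^bsub>A\<^esub> = (\<epsilon> \<cdot> \<one>\<^bsub>A\<^esub>) \<otimes>\<^bsub>A\<^esub> (x \<cdot> \<one>\<^bsub>A\<^esub>)" using *[OF xc] by simp
      qed
    qed
  qed
  moreover have "lax_comodule_algebra R H A \<rho> \<longleftrightarrow> M1 \<and> M2 \<and> C3 \<and> C4"
  proof -
    have "lax_comodule_algebra R H A \<rho> \<longleftrightarrow>
      (\<forall>a\<in>carrier A. \<forall>b\<in>carrier A. \<rho> (a \<otimes>\<^bsub>A\<^esub> b) = \<rho> a \<otimes>\<^bsub>tensor_algebra R A H\<^esub> \<rho> b) \<and>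
      (\<forall>a\<in>carrier A. tensor_lift R AHH (\<lambda>a0 a1. pure_tensor R (A \<boxtimes> H) H (\<rho> a0) a1) (\<rho> a) =
        coassoc_rhs (\<rho> a) (\<rho> \<one>\<^bsub>A\<^esub>)) \<and> C3 \<and> C4"
      unfolding lax_comodule_algebra_def lax_comodule_algebra_axioms_def C3_def C4_def coassoc_rhs_def
        coaction_one_iff[symmetric]
      using \<rho> bialgebra_axioms A_algebra coaction_counit_iff by auto
    also have "\<dots> \<longleftrightarrow> M1 \<and> M2 \<and> C3 \<and> C4"
      using coaction_mult_iff coaction_coassoc_iff unfolding M1_def M2_def by blast
    finally show ?thesis .
  qed
  moreover have "lax_module_algebra R H\<^sup>* (opposite A) (dual_action R H A \<rho>) \<longleftrightarrow> M1 \<and> M2 \<and> C3 \<and> M4"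
  proof -
    \<comment> \<open>The module axioms speak of \<open>dual_action\<close> at pure tensors. Under
      the Sweedler sum its value is known only for components in the carrier, so it is replaced by
      congruence.\<close>
    have t1: "tensor_lift R A (\<lambda>x1 x2. dual_action R H A \<rho> (pure_tensor R H\<^sup>* A x2 b) \<otimes>\<^bsub>A\<^esub>
          dual_action R H A \<rho> (pure_tensor R H\<^sup>* A x1 a)) (comult H\<^sup>* x) =
        tensor_lift R A (\<lambda>x1 x2. (x2 \<cdot> b) \<otimes>\<^bsub>A\<^esub> (x1 \<cdot> a)) (comult H\<^sup>* x)"
      if "x \<in> carrier H\<^sup>*" "a \<in> carrier A" "b \<in> carrier A" for x a b
    proof (rule tensor_lift_cong[OF dual_module dual_module A_module dual_comult_closed[OF that(1)], symmetric])
      show "bilin H\<^sup>* H\<^sup>* A (\<lambda>x1 x2. (x2 \<cdot> b) \<otimes>\<^bsub>A\<^esub> (x1 \<cdot> a))"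
        using that by - (rule intros \<rho>_closed | assumption)+
    qed (use that in \<open>simp add: dual_action_pure\<close>)
    have t2: "tensor_lift R A (\<lambda>x1 x2. dual_action R H A \<rho> (pure_tensor R H\<^sup>* A (x2 \<otimes>\<^bsub>H\<^sup>*\<^esub> y) b) \<otimes>\<^bsub>A\<^esub>
          dual_action R H A \<rho> (pure_tensor R H\<^sup>* A x1 a)) (comult H\<^sup>* x) =
        tensor_lift R A (\<lambda>x1 x2. ((x2 \<otimes>\<^bsub>H\<^sup>*\<^esub> y) \<cdot> b) \<otimes>\<^bsub>A\<^esub> (x1 \<cdot> a)) (comult H\<^sup>* x)"
      if "x \<in> carrier H\<^sup>*" "y \<in> carrier H\<^sup>*" "a \<in> carrier A" "b \<in> carrier A" for x y a b
    proof (rule tensor_lift_cong[OF dual_module dual_module A_module dual_comult_closed[OF that(1)], symmetric])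
      show "bilin H\<^sup>* H\<^sup>* A (\<lambda>x1 x2. ((x2 \<otimes>\<^bsub>H\<^sup>*\<^esub> y) \<cdot> b) \<otimes>\<^bsub>A\<^esub> (x1 \<cdot> a))"
        using that by - (rule intros \<rho>_closed | assumption)+
    qed (use that in \<open>simp add: dual_action_pure dual_mult_closed\<close>)
    show ?thesis
      unfolding lax_module_algebra_def lax_module_algebra_axioms_def M1_def M2_def C3_def M4_def
      using dual_bialgebra opposite_k_algebra[OF A_algebra] dual_action_lin_hom
      by (simp add: t1 t2 dual_action_pure act_closed dual_one_closed Ball_def cong: imp_cong)
  qed
  ultimately show ?thesis by blast
qed

text \<open>Beyond the lax axioms, both partial notions ask that \<open>\<epsilon>\<close> send 1 to
  1.\<close>

lemma partial_comodule_iff_partial_module: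
  "partial_comodule_algebra R H A \<rho> \<longleftrightarrow> partial_module_algebra R H\<^sup>* (opposite A) (dual_action R H A \<rho>)"
  unfolding partial_comodule_algebra_def partial_module_algebra_def lax_comodule_iff_lax_module
    partial_comodule_algebra_axioms_def partial_module_algebra_axioms_def
  by (simp add: contract_counit[OF A_module] \<rho>_closed dual_action_pure dual_one_closed)

end

section \<open>Bijection between linear coactions and linear actions\<close>

lemma dual_action_bij:
  "bij_betw (dual_action R H A) (lin_hom R A (A \<boxtimes> H) \<inter> extensional (carrier A))
     (lin_hom R (H\<^sup>* \<boxtimes> A) A \<inter> extensional (carrier (H\<^sup>* \<boxtimes> A)))"
proof (rule bij_betwI')
  fix \<rho> \<sigma>
  assume \<rho>: "\<rho> \<in> lin_hom R A (A \<boxtimes> H) \<inter> extensional (carrier A)" and \<sigma>: "\<sigma> \<in> lin_hom R A (A \<boxtimes> H) \<inter> extensional (carrier A)"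
  show "dual_action R H A \<rho> = dual_action R H A \<sigma> \<longleftrightarrow> \<rho> = \<sigma>"
  proof
    assume eq: "dual_action R H A \<rho> = dual_action R H A \<sigma>"
    show "\<rho> = \<sigma>"
    proof (rule lin_hom_eqI[OF \<rho> \<sigma>])
      fix a assume a: "a \<in> carrier A"
      show "\<rho> a = \<sigma> a"
      proof (rule AH_eqI)
        show "\<rho> a \<in> carrier (A \<boxtimes> H)" "\<sigma> a \<in> carrier (A \<boxtimes> H)" using \<rho> \<sigma> a lin_hom_closed by fast+
        \<comment> \<open>Injectivity: the action records all contractions of \<rho>(a) with forms,
          and these determine \<rho>(a).\<close>
        show "contract_right A x (\<rho> a) = contract_right A x (\<sigma> a)" if x: "x \<in> carrier H\<^sup>*" for x
          using dual_action_pure[OF _ x a, of \<rho>] dual_action_pure[OF _ x a, of \<sigma>] \<rho> \<sigma> eq by simp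
      qed
    qed
  qed simp
next
  fix \<rho> assume "\<rho> \<in> lin_hom R A (A \<boxtimes> H) \<inter> extensional (carrier A)"
  then show "dual_action R H A \<rho> \<in> lin_hom R (H\<^sup>* \<boxtimes> A) A \<inter> extensional (carrier (H\<^sup>* \<boxtimes> A))"
    using dual_action_lin_hom by blast
next
  fix \<alpha> assume \<alpha>': "\<alpha> \<in> lin_hom R (H\<^sup>* \<boxtimes> A) A \<inter> extensional (carrier (H\<^sup>* \<boxtimes> A))"
  then have \<alpha>: "\<alpha> \<in> lin_hom R (H\<^sup>* \<boxtimes> A) A" by simp
  note b = dual_basisD[OF basis]
  note b' = dual_basisD[OF dual_dual_basis]
  define u where "u i = restrict (c i) (carrier H)" for i
  have u: "u i \<in> carrier H\<^sup>*" if "i \<in> I" for i unfolding u_def by (rule b'(2)[OF that])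
  \<comment> \<open>By the expansion through contractions, a coaction inducing
    \<open>\<alpha>\<close> must send \<open>a\<close> to the sum of (c_i . a) \<otimes> e_i; this
    is taken as its definition.\<close>
  define \<sigma> where "\<sigma> a = (\<Oplus>\<^bsub>A \<boxtimes> H\<^esub>i\<in>I. pure_tensor R A H (\<alpha> (pure_tensor R H\<^sup>* A (u i) a)) (e i))" for a
  have \<sigma>: "\<sigma> \<in> lin_hom R A (A \<boxtimes> H)"
    unfolding \<sigma>_def
    by (intro lin_finsum lin_pure_left lin_comp[OF \<alpha>] lin_pure_right lin_id b u A_module H_module AH_module dual_module)
  \<comment> \<open>Cut off outside \<open>carrier A\<close>, to lie in the domain of the
    bijection.\<close>
  define \<rho> where "\<rho> = restrict \<sigma> (carrier A)"
  have \<rho>: "\<rho> \<in> lin_hom R A (A \<boxtimes> H)"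
    unfolding \<rho>_def by (rule lin_hom_cong[OF \<sigma> A_module]) simp
  have "dual_action R H A \<rho> = \<alpha>"
  proof (rule lin_hom_eqI[OF dual_action_lin_hom[OF \<rho>] \<alpha>'])
    fix t assume t: "t \<in> carrier (H\<^sup>* \<boxtimes> A)"
    show "dual_action R H A \<rho> t = \<alpha> t"
    proof (rule tensor_lin_eq[OF dual_module A_module t IntD1[OF dual_action_lin_hom[OF \<rho>]] \<alpha>])
      fix x a assume x: "x \<in> carrier H\<^sup>*" and a: "a \<in> carrier A"
      note xl = dual_lin_hom[OF x]
      have \<alpha>u: "\<alpha> (pure_tensor R H\<^sup>* A (u i) a) \<in> carrier A" if "i \<in> I" for i
        by (intro lin_hom_closed[OF \<alpha>] pure_tensor_closed dual_module A_module u that a)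
      have xe: "x (e i) \<in> carrier R" if "i \<in> I" for i by (intro dual_apply_closed x b(2) that)
      note pa = bilinD(1)[OF pure_tensor_bilin[OF dual_module A_module] a]
      have "dual_action R H A \<rho> (pure_tensor R H\<^sup>* A x a) = contract_right A x (\<sigma> a)"
        using dual_action_pure[OF \<rho> x a] a by (simp add: \<rho>_def)
      also have "\<dots> = (\<Oplus>\<^bsub>A\<^esub>i\<in>I. contract_right A x (pure_tensor R A H (\<alpha> (pure_tensor R H\<^sup>* A (u i) a)) (e i)))"
        unfolding \<sigma>_def
        by (rule lin_hom_finsum[OF AH_module A_module contract_right_lin_hom[OF A_module H_module xl] b(1)])
          (intro pure_tensor_closed A_module H_module \<alpha>u b(2))
      also have "\<dots> = (\<Oplus>\<^bsub>A\<^esub>i\<in>I. \<alpha> (pure_tensor R H\<^sup>* A (x (e i) \<odot>\<^bsub>H\<^sup>*\<^esub> u i) a))"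
      proof (rule A.finsum_cong')
        fix i assume i: "i \<in> I"
        show "contract_right A x (pure_tensor R A H (\<alpha> (pure_tensor R H\<^sup>* A (u i) a)) (e i)) =
            \<alpha> (pure_tensor R H\<^sup>* A (x (e i) \<odot>\<^bsub>H\<^sup>*\<^esub> u i) a)"
          using \<alpha>u[OF i] xe[OF i] b(2)[OF i] u[OF i] a
          by (simp add: contract_right_pure[OF A_module H_module xl] lin_hom_smult[OF pa] lin_hom_smult[OF \<alpha>]
              pure_tensor_closed[OF dual_module A_module])
      qed (auto intro!: lin_hom_closed[OF \<alpha>] pure_tensor_closed dual_module A_module dual_smult_closed xe u a)
      also have "\<dots> = \<alpha> (pure_tensor R H\<^sup>* A (\<Oplus>\<^bsub>H\<^sup>*\<^esub>i\<in>I. x (e i) \<odot>\<^bsub>H\<^sup>*\<^esub> u i) a)"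
        by (rule lin_hom_finsum[OF dual_module A_module lin_comp[OF \<alpha> pa] b(1), symmetric])
          (intro dual_smult_closed xe u)
      \<comment> \<open>The dual basis of \<open>H\<^sup>*\<close> recovers \<open>x\<close> from
        its values at the \<open>e i\<close>.\<close>
      also have "(\<Oplus>\<^bsub>H\<^sup>*\<^esub>i\<in>I. x (e i) \<odot>\<^bsub>H\<^sup>*\<^esub> u i) = x"
        unfolding u_def by (rule b'(4)[OF x])
      finally show "dual_action R H A \<rho> (pure_tensor R H\<^sup>* A x a) = \<alpha> (pure_tensor R H\<^sup>* A x a)" .
    qed
  qed
  then show "\<exists>\<rho>\<in>lin_hom R A (A \<boxtimes> H) \<inter> extensional (carrier A). \<alpha> = dual_action R H A \<rho>"
    using \<rho> by (intro bexI[of _ \<rho>]) (auto simp: \<rho>_def)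
qed

end

theorem theorem4p7:
  fixes R :: "('k, 'x) ring_scheme"
    and A :: "('k, 'a, 'y) module_scheme"
    and H :: "('k, 'h, 'z) bialgebra_scheme"
  assumes "cring R"
    and "k_algebra R A"
    and "bialgebra R H"
    and "finitely_generated_module R H"
    and "projective_module R H"
  shows "bij_betw (dual_action R H A)
           (lin_hom R A (tensor_module R A H) \<inter> extensional (carrier A))
           (lin_hom R (tensor_module R (coopposite R (dual_bialgebra R H)) (opposite A)) (opposite A) \<inter>
              extensional (carrier (tensor_module R (coopposite R (dual_bialgebra R H)) (opposite A))))
       \<and> (\<forall>\<rho> \<in> lin_hom R A (tensor_module R A H) \<inter> extensional (carrier A).
            (lax_comodule_algebra R H A \<rho> \<longleftrightarrow>
               lax_module_algebra R (coopposite R (dual_bialgebra R H)) (opposite A) (dual_action R H A \<rho>)) \<and>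
            (partial_comodule_algebra R H A \<rho> \<longleftrightarrow>
               partial_module_algebra R (coopposite R (dual_bialgebra R H)) (opposite A) (dual_action R H A \<rho>)))"
proof -
  interpret cring R by fact
  interpret bialgebra R H by fact
  \<comment> \<open>The dual basis serves the proof only: neither the dual bialgebra nor the action
    depends on its choice.\<close>
  obtain I :: "'h set" and e c where "dual_basis H I e c"
    using finitely_generated_projective_dual_basis[OF module_axioms assms(4,5)] by blast
  then interpret bialgebra_dual_basis_algebra R H I e c A
    using assms by (intro bialgebra_dual_basis_algebra.intro bialgebra_dual_basis.intro
        bialgebra_dual_basis_axioms.intro)
  show ?thesis
    \<comment> \<open>The bijection was obtained for the module \<open>A\<close>; the simplifier
      reads it over \<open>opposite A\<close>, whose tensor products and linear maps are the
      same.\<close>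
    using dual_action_bij lax_comodule_iff_lax_module partial_comodule_iff_partial_module by simp
qed

end
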